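(* Let $\mu\in(0,7/2)$, $M>0$, $J>0$, and let $(\rho_n)\subset\mathcal F_M^{\mu}$ be a minimizing sequence of the functional $\mathcal E_J^{\mu}$ over $\mathcal F_M^{\mu}$, i.e. $\mathcal E_J^{\mu}(\rho_n)\to\inf\{\mathcal E_J^{\mu}(\rho):\rho\in\mathcal F_M^{\mu}\}$ as $n\to\infty$. Then there exist a sequence of translations $T_n$, a subsequence of $(\rho_n)$ (again denoted by $(\rho_n)$), a number $R>0$, and a function $\rho_0$ such that $$\int_{|x|\ge R}T_n\rho_n(x)\,dx\to 0\quad\text{as } n\to\infty,$$ $$T_n\rho_n\to\rho_0\quad\text{strongly in } L^{\frac{2\mu+5}{2\mu+3}}(\mathbb R^3),$$ $$\int_{B_R}\rho_0(x)\,dx=M\quad\text{and}\quad \mathrm{supp}(\rho_0)\subset B_R.$$ In addition, $$\nabla U_{T_n\rho_n}\to\nabla U_{\rho_0}\quad\text{strongly in } L^2(\mathbb R^3)\text{ as } n\to\infty,$$ and $\rho_0$ is a minimizer of the functional $\mathcal E_J^{\mu}$ over the set $\mathcal F_M^{\mu}$.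
   Context: For $\mu\in(0,7/2)$ and $M,J>0$ define the constraint set $$\mathcal F_M^{\mu}:=\Big\{\rho\in L^1(\mathbb R^3)\cap L^{\frac{2\mu+5}{2\mu+3}}(\mathbb R^3):\ \rho\ge0\ \text{a.e.},\ \int_{\mathbb R^3}\rho\,dx=M\Big\}$$ and, for $\rho\in\mathcal F_M^{\mu}$, the functional $$\mathcal E_J^{\mu}(\rho):=\frac{K_{1,1}}{J^{\frac{2(\mu+1)}{3}}}\Big(\int_{\mathbb R^3}\rho^{\frac{2\mu+5}{2\mu+3}}\,dx\Big)^{\frac{2\mu+3}{3}}+\mathcal E_{\mathrm{pot}}(\rho),\qquad \mathcal E_{\mathrm{pot}}(\rho):=-\frac12\iint\frac{\rho(x)\rho(y)}{|x-y|}\,dx\,dy,$$ where $K_{1,1}>0$ is a fixed constant (independent of $\rho$, $M$ and $J$) whose value plays no role. For a density $\rho$, $U_\rho$ denotes the gravitational potential it induces: $\Delta U_\rho=4\pi\rho$, $\lim_{|x|\to\infty}U_\rho(x)=0$, i.e. $U_\rho(x)=-\int\frac{\rho(y)}{|x-y|}\,dy$; one has $\mathcal E_{\mathrm{pot}}(\rho)=-\frac1{8\pi}\int|\nabla U_\rho|^2dx$. A translation is a mapping $T$ for which there is a shift vector $a\in\mathbb R^3$ with $Tf(\cdot)=f(\cdot-a)$ for every function $f:\mathbb R^3\to\mathbb R$. $B_R$ is the closed ball of radius $R$ centered at the origin in $\mathbb R^3$. *)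

theory Defs
  imports "HOL-Analysis.Analysis"
begin

type_synonym R3 = "real ^ 3"

text \<open>Elements of \<open>L\<^sup>p\<close> spaces are represented by Lebesgue measurable functions; nothing below
  depends on the choice of the representative.\<close>

definition Lp :: "real \<Rightarrow> (R3 \<Rightarrow> 'b::{banach, second_countable_topology}) set" where
  "Lp p = {f \<in> borel_measurable lebesgue. integrable lebesgue (\<lambda>x. norm (f x) powr p)}"

definition Lp_norm :: "real \<Rightarrow> (R3 \<Rightarrow> 'b::{banach, second_countable_topology}) \<Rightarrow> real" where
  "Lp_norm p f = (LINT x|lebesgue. norm (f x) powr p) powr (1 / p)"

definition Lp_converges ::
  "real \<Rightarrow> (nat \<Rightarrow> R3 \<Rightarrow> 'b::{banach, second_countable_topology}) \<Rightarrow> (R3 \<Rightarrow> 'b) \<Rightarrow> bool" where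
  "Lp_converges p f g \<longleftrightarrow>
     (\<forall>n. f n \<in> Lp p) \<and> g \<in> Lp p \<and> (\<lambda>n. Lp_norm p (\<lambda>x. f n x - g x)) \<longlonglongrightarrow> 0"

text \<open>The support of an \<open>L\<^sup>p\<close> function: the complement of the largest open set on which it
  vanishes almost everywhere.\<close>

definition ess_supp :: "(R3 \<Rightarrow> real) \<Rightarrow> R3 set" where
  "ess_supp f = - \<Union>{V. open V \<and> (AE x in lebesgue. x \<in> V \<longrightarrow> f x = 0)}"

primrec C_k :: "nat \<Rightarrow> (R3 \<Rightarrow> real) \<Rightarrow> bool" where
  "C_k 0 f \<longleftrightarrow> continuous_on UNIV f"
| "C_k (Suc k) f \<longleftrightarrow> (\<exists>Df. (\<forall>x. GDERIV f x :> Df x) \<and> (\<forall>i. C_k k (\<lambda>x. Df x $ i)))"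

definition test_function :: "(R3 \<Rightarrow> real) \<Rightarrow> bool" where
  "test_function \<phi> \<longleftrightarrow> (\<forall>k. C_k k \<phi>) \<and> compact (closure {x. \<phi> x \<noteq> 0})"

definition locally_integrable :: "(R3 \<Rightarrow> 'b::{banach, second_countable_topology}) \<Rightarrow> bool" where
  "locally_integrable f \<longleftrightarrow> (\<forall>K. compact K \<longrightarrow> set_integrable lebesgue K f)"

text \<open>For densities in the relevant \<open>L\<^sup>p\<close> spaces the potential need not be differentiable, or even
  finite, at every point, so its gradient is the distributional one. It is unique up to null sets.\<close>

definition weak_gradient :: "(R3 \<Rightarrow> real) \<Rightarrow> (R3 \<Rightarrow> R3) \<Rightarrow> bool" where
  "weak_gradient u g \<longleftrightarrow> locally_integrable u \<and> locally_integrable g \<and>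
     (\<forall>\<phi> D\<phi>. test_function \<phi> \<and> (\<forall>x. GDERIV \<phi> x :> D\<phi> x) \<longrightarrow>
        (LINT x|lebesgue. u x *\<^sub>R D\<phi> x) = - (LINT x|lebesgue. \<phi> x *\<^sub>R g x))"

definition translation :: "((R3 \<Rightarrow> real) \<Rightarrow> (R3 \<Rightarrow> real)) \<Rightarrow> bool" where
  "translation T \<longleftrightarrow> (\<exists>a. \<forall>f. T f = (\<lambda>x. f (x - a)))"

definition grav_potential :: "(R3 \<Rightarrow> real) \<Rightarrow> R3 \<Rightarrow> real" where
  "grav_potential \<rho> x = - (LINT y|lebesgue. \<rho> y / norm (x - y))"

definition E_pot :: "(R3 \<Rightarrow> real) \<Rightarrow> real" where
  "E_pot \<rho> = - (1 / 2) * (LINT x|lebesgue. LINT y|lebesgue. \<rho> x * \<rho> y / norm (x - y))"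

definition expo :: "real \<Rightarrow> real" where
  "expo \<mu> = (2 * \<mu> + 5) / (2 * \<mu> + 3)"

definition constraint_set :: "real \<Rightarrow> real \<Rightarrow> (R3 \<Rightarrow> real) set" where
  "constraint_set \<mu> M =
     {\<rho> \<in> Lp 1 \<inter> Lp (expo \<mu>). (AE x in lebesgue. \<rho> x \<ge> 0) \<and> (LINT x|lebesgue. \<rho> x) = M}"

text \<open>The parameter \<open>K\<close> is the constant \<open>K\<^bsub>1,1\<^esub>\<close>.\<close>

definition energy :: "real \<Rightarrow> real \<Rightarrow> real \<Rightarrow> (R3 \<Rightarrow> real) \<Rightarrow> real" where
  "energy K \<mu> J \<rho> =
     K / J powr (2 * (\<mu> + 1) / 3)
       * (LINT x|lebesgue. \<rho> x powr expo \<mu>) powr ((2 * \<mu> + 3) / 3)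
     + E_pot \<rho>"

end

theory Submission
  imports Defs "HOL-Complex_Analysis.Great_Picard"
begin

text \<open>Write \<open>p\<close> for the exponent and \<open>D(f,g) = \<integral>\<integral> f(x) g(y) / |x - y|\<close>. Dilating a density multiplies the two parts of the
  energy by \<open>\<lambda>\<^sup>2\<close> and \<open>\<lambda>\<close>, so minimising the energy amounts to finding the best constant in
  \<open>D(f,f) \<le> C (\<integral>f)\<^sup>\<alpha> (\<integral>f\<^sup>p)\<^sup>\<beta>\<close>, where \<open>\<beta> = 1/(3(p-1))\<close> and \<open>\<alpha> + \<beta> = 5/3\<close>; minimising sequences are exactly the
  maximising sequences of this inequality at one fixed value of \<open>\<integral>f\<^sup>p\<close>. Since \<open>\<alpha> + \<beta> > 1\<close>, a sequence whose mass splits into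
  two distant pieces falls short of the best constant by a fixed factor, so after translation the sequence is tight.

  Compactness needs no weak limits: the potentials for the truncated kernel are equi-Lipschitz, so along a subsequence
  \<open>D(f\<^sub>n,f\<^sub>m)\<close> tends to the maximal value as \<open>n\<close> and \<open>m\<close> tend to infinity independently. Hence the midpoints
  \<open>(f\<^sub>n + f\<^sub>m)/2\<close> are nearly optimal as well, and the uniform convexity of \<open>t\<^sup>p\<close> turns this into the Cauchy property in \<open>L\<^sup>p\<close>.

  Removing a maximiser from a set and comparing gives \<open>c\<^sub>1 + c\<^sub>2 f\<^bsup>p-1\<^esup> \<le> 2V\<close> wherever \<open>f > 0\<close>, \<open>V\<close> being the potential. As \<open>p > 6/5\<close>
  this inequality bootstraps to \<open>f \<in> L\<^sup>2\<close>, so \<open>V\<close> vanishes at infinity and \<open>f\<close> has bounded support. Convergence of the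
  gradients follows from \<open>\<integral> |x - y|\<^sup>-\<^sup>2 |x - z|\<^sup>-\<^sup>2 dx \<le> C / |y - z|\<close>, which bounds \<open>\<parallel>\<nabla>U\<^sub>f - \<nabla>U\<^sub>g\<parallel>\<^sup>2\<close> by \<open>C D(|f-g|,|f-g|)\<close>.\<close>

section \<open>Elementary inequalities and singular integrals\<close>

text \<open>The exponent is p = 1 + 2/(2 \<mu> + 3), so \<mu> < 7/2 says p > 6/5. At exactly this
  threshold Young's inequality starts to control D near the diagonal: 2/p + 1/t = 2 gives t = p/(2(p
  - 1)), and |z|^(-t) is locally integrable in three dimensions only for t < 3. The same threshold
  makes \<alpha> positive. The energy contains the p-integral to the power 2 \<beta>. With s =
  (p-integral)^\<beta> it reads A s^2 - D/2, and D \<le> c s for mass M. Completing the square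
  bounds it below by A (s - c/(4A))^2 - c^2/(16A), and suitable dilations of nearly optimal
  densities show that -c^2/(16A) is the infimum. Along a minimising sequence s must therefore
  converge to c/(4A), and D \<le> c s becomes an equality in the limit. A bound on the p-integral
  does not keep the mass from spreading out or splitting. D is stable only under perturbations of
  small mass, so tightness has to precede every passage to the limit.\<close>

lemma weighted_amgm3:
  fixes x y z :: real
  assumes "0 < x" "0 < y" "0 < z" "0 \<le> a" "0 \<le> b" "0 \<le> c" and s: "a + b + c = 1"
  shows "x powr a * y powr b * z powr c \<le> a * x + b * y + c * z"
proof -
  define u where "u = a * ln x + b * ln y + c * ln z"
  \<comment> \<open>Tangent line of the exponential at \<open>u\<close>, evaluated at
    \<open>ln w\<close>. In the weighted average over \<open>x\<close>, \<open>y\<close>,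
    \<open>z\<close> the linear terms cancel, because \<open>u\<close> is the average of the
    logarithms.\<close>
  have e: "exp u * (1 + (ln w - u)) \<le> w" if "0 < w" for w
  proof -
    have "exp u * (1 + (ln w - u)) \<le> exp u * exp (ln w - u)"
      by (intro mult_left_mono exp_ge_add_one_self) auto
    also have "\<dots> = w" using that by (simp add: exp_add[symmetric])
    finally show ?thesis .
  qed
  have "exp u = a * (exp u * (1 + (ln x - u))) + b * (exp u * (1 + (ln y - u))) + c * (exp u * (1 + (ln z - u)))"
  proof -
    have "a * (exp u * (1 + (ln x - u))) + b * (exp u * (1 + (ln y - u))) + c * (exp u * (1 + (ln z - u)))
       = exp u * ((a + b + c) * (1 - u) + u)" unfolding u_def by (simp add: algebra_simps)
    then show ?thesis using s by simp
  qed
  also have "\<dots> \<le> a * x + b * y + c * z"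
    using assms e by (intro add_mono mult_left_mono) auto
  also have "exp u = x powr a * y powr b * z powr c"
    using assms by (simp add: u_def powr_def exp_add)
  finally show ?thesis .
qed

text \<open>Pointwise core of Young's convolution inequality: the product is a weighted geometric
  mean of the three pair products. The weights \<open>1 - 1 / t\<close>, \<open>1 - 1 / B\<close>,
  \<open>1 - 1 / A\<close> add up to 1 by \<open>s\<close>, and the same relation returns each
  function to its first power.\<close>

lemma trilinear_young:
  fixes f g k :: real
  assumes "0 \<le> f" "0 \<le> g" "0 \<le> k" "1 \<le> A" "1 \<le> B" "1 \<le> t" and s: "1 / A + 1 / B + 1 / t = 2"
  shows "f * g * k \<le> (1 - 1 / t) * (f powr A * g powr B) + (1 - 1 / B) * (f powr A * k powr t)
      + (1 - 1 / A) * (g powr B * k powr t)"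
proof (cases "f = 0 \<or> g = 0 \<or> k = 0")
  case True
  have "0 \<le> (1 - 1 / t) * (f powr A * g powr B) + (1 - 1 / B) * (f powr A * k powr t)
      + (1 - 1 / A) * (g powr B * k powr t)"
    using assms by (intro add_nonneg_nonneg mult_nonneg_nonneg) auto
  with True show ?thesis by auto
next
  case False
  then have pos: "0 < f" "0 < g" "0 < k" using assms by auto
  define w1 w2 w3 where "w1 = 1 - 1 / t" "w2 = 1 - 1 / B" "w3 = 1 - 1 / A"
  have w: "0 \<le> w1" "0 \<le> w2" "0 \<le> w3" "w1 + w2 + w3 = 1" using assms by (auto simp: w1_w2_w3_def)
  have "w1 + w2 = 1 / A" "w1 + w3 = 1 / B" "w2 + w3 = 1 / t" using s by (auto simp: w1_w2_w3_def)
  then have e: "A * (w1 + w2) = 1" "B * (w1 + w3) = 1" "t * (w2 + w3) = 1" using assms by auto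
  have "(f powr A * g powr B) powr w1 * (f powr A * k powr t) powr w2 * (g powr B * k powr t) powr w3
     = f powr (A * (w1 + w2)) * g powr (B * (w1 + w3)) * k powr (t * (w2 + w3))"
    using pos by (simp add: powr_mult powr_powr powr_add distrib_left)
  also have "\<dots> = f * g * k" using e pos by simp
  finally have "f * g * k = (f powr A * g powr B) powr w1 * (f powr A * k powr t) powr w2 * (g powr B * k powr t) powr w3" ..
  also have "\<dots> \<le> w1 * (f powr A * g powr B) + w2 * (f powr A * k powr t) + w3 * (g powr B * k powr t)"
    using pos w by (intro weighted_amgm3) auto
  finally show ?thesis by (simp add: w1_w2_w3_def)
qed

section \<open>Affine changes of variables and integrals of powers of the distance\<close>

lemma ball_borel_sets [measurable]: "ball (a::R3) r \<in> sets borel" "cball (a::R3) r \<in> sets borel"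
  by auto

lemma nn_integral_lborel_affine:
  fixes F :: "R3 \<Rightarrow> ennreal"
  assumes [measurable]: "F \<in> borel_measurable borel" and c: "c \<noteq> 0"
  shows "(\<integral>\<^sup>+y. F y \<partial>lborel) = ennreal (\<bar>c\<bar> ^ 3) * (\<integral>\<^sup>+y. F (a + c *\<^sub>R y) \<partial>lborel)"
proof -
  have "(\<integral>\<^sup>+y. F y \<partial>lborel) = (\<integral>\<^sup>+y. F y \<partial>(density (distr lborel borel (\<lambda>x. a + c *\<^sub>R x)) (\<lambda>_. \<bar>c\<bar> ^ DIM(R3))))"
    using lborel_affine[OF c, of a] by simp
  also have "\<dots> = (\<integral>\<^sup>+y. ennreal (\<bar>c\<bar> ^ 3) * F (a + c *\<^sub>R y) \<partial>lborel)"
    by (subst nn_integral_density) (auto simp: nn_integral_distr)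
  also have "\<dots> = ennreal (\<bar>c\<bar> ^ 3) * (\<integral>\<^sup>+y. F (a + c *\<^sub>R y) \<partial>lborel)"
    by (rule nn_integral_cmult) auto
  finally show ?thesis .
qed

lemma nn_integral_lborel_translate:
  fixes F :: "R3 \<Rightarrow> ennreal"
  assumes [measurable]: "F \<in> borel_measurable borel"
  shows "(\<integral>\<^sup>+y. F (y - a) \<partial>lborel) = (\<integral>\<^sup>+y. F y \<partial>lborel)"
  using nn_integral_lborel_affine[OF assms, of 1 "- a"] by simp

lemma nn_integral_lborel_reflect:
  fixes F :: "R3 \<Rightarrow> ennreal"
  assumes [measurable]: "F \<in> borel_measurable borel"
  shows "(\<integral>\<^sup>+y. F (a - y) \<partial>lborel) = (\<integral>\<^sup>+y. F y \<partial>lborel)"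
  using nn_integral_lborel_affine[OF assms, of "- 1" a] by simp

lemma ennreal_le_suminf: "f k \<le> (\<Sum>i. f i)" for f :: "nat \<Rightarrow> ennreal"
  using sum_le_suminf[of f "{k}"] by simp

text \<open>Replaces polar coordinates: a power of the norm is dominated by a sum of multiples of
  indicators of dyadic balls, so that finiteness of its integral becomes convergence of a geometric
  series. The factor \<open>r k ^ 3\<close> comes from the volume of the ball.\<close>

lemma nn_integral_ball_series_finite:
  fixes c r :: "nat \<Rightarrow> real"
  assumes "\<And>k. 0 \<le> c k" "\<And>k. 0 \<le> r k" and s: "summable (\<lambda>k. c k * r k ^ 3)"
  shows "(\<integral>\<^sup>+(x::R3). (\<Sum>k. ennreal (c k) * indicator (ball 0 (r k)) x) \<partial>lborel) < \<infinity>"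
proof -
  let ?v = "unit_ball_vol (real DIM(R3))"
  have v: "0 \<le> ?v" by simp
  have "(\<integral>\<^sup>+(x::R3). (\<Sum>k. ennreal (c k) * indicator (ball 0 (r k)) x) \<partial>lborel)
      = (\<Sum>k. \<integral>\<^sup>+(x::R3). ennreal (c k) * indicator (ball 0 (r k)) x \<partial>lborel)"
    by (rule nn_integral_suminf) measurable
  also have "\<dots> = (\<Sum>k. ennreal (c k) * ennreal (?v * r k ^ 3))"
    using assms by (intro suminf_cong, subst nn_integral_cmult_indicator) (auto simp: emeasure_ball)
  also have "\<dots> = (\<Sum>k. ennreal (?v * (c k * r k ^ 3)))"
    using assms v by (intro suminf_cong) (auto simp: ennreal_mult[symmetric] mult_ac)
  also have "\<dots> = ennreal (\<Sum>k. ?v * (c k * r k ^ 3))"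
    using assms v by (intro suminf_ennreal2 mult_nonneg_nonneg summable_mult) auto
  finally show ?thesis by simp
qed

lemma nn_integral_singular_unit_ball:
  fixes t :: real
  assumes "0 \<le> t" "t < 3"
  shows "(\<integral>\<^sup>+(x::R3). ennreal (norm x powr - t) * indicator (ball 0 1) x \<partial>lborel) < \<infinity>"
proof -
  \<comment> \<open>\<open>c k\<close> is the value of the power at the inner radius
    \<open>r (Suc k)\<close> of a dyadic shell. Weighted with the volumes it gives a series of ratio
    \<open>2 powr t / 8\<close>, which is below 1 exactly for \<open>t < 3\<close>.\<close>
  define c r :: "nat \<Rightarrow> real" where "c k = (2 powr t) ^ Suc k" and "r k = (1/2) ^ k" for k
  have eq: "c k * r k ^ 3 = 2 powr t * (2 powr t / 8) ^ k" for k
  proof -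
    have "r k ^ 3 = ((1/2) ^ 3) ^ k" unfolding r_def by (simp only: power_mult[symmetric] mult.commute)
    also have "(1/2::real) ^ 3 = 1 / 8" by (simp add: power_divide)
    finally show ?thesis unfolding c_def by (simp add: power_divide)
  qed
  have sm: "summable (\<lambda>k. c k * r k ^ 3)" unfolding eq
  proof (intro summable_mult summable_geometric)
    have "(2::real) powr t < 2 powr 3" using assms by (subst powr_less_cancel_iff) auto
    then show "norm ((2::real) powr t / 8) < 1" by simp
  qed
  have "(\<integral>\<^sup>+(x::R3). ennreal (norm x powr - t) * indicator (ball 0 1) x \<partial>lborel)
      \<le> (\<integral>\<^sup>+(x::R3). (\<Sum>k. ennreal (c k) * indicator (ball 0 (r k)) x) \<partial>lborel)"
  proof (rule nn_integral_mono)
    fix x :: R3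
    show "ennreal (norm x powr - t) * indicator (ball 0 1) x \<le> (\<Sum>k. ennreal (c k) * indicator (ball 0 (r k)) x)"
    proof (cases "x \<noteq> 0 \<and> norm x < 1")
      case True
      \<comment> \<open>With \<open>n = Suc k\<close>, the point lies between the radii
        \<open>(1/2) ^ n\<close> and \<open>(1/2) ^ k\<close>. The origin belongs to the trivial
        case, since \<open>0 powr - t = 0\<close>.\<close>
      define n where "n = (LEAST n. (1/2::real) ^ n \<le> norm x)"
      have ex: "\<exists>n. (1/2::real) ^ n \<le> norm x"
        using True real_arch_pow_inv[of "norm x" "1/2"] by (auto intro: less_imp_le)
      have n1: "(1/2::real) ^ n \<le> norm x" unfolding n_def by (rule LeastI_ex[OF ex])
      then have "n \<noteq> 0" using True by (intro notI) auto
      then obtain k where k: "n = Suc k" by (cases n) auto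
      then have "\<not> (1/2::real) ^ k \<le> norm x" using not_less_Least[of k "\<lambda>n. (1/2::real) ^ n \<le> norm x"] by (auto simp: n_def)
      then have xk: "x \<in> ball 0 (r k)" by (simp add: r_def)
      have "norm x powr - t \<le> ((1/2) ^ n) powr - t" using n1 True assms by (intro powr_mono2') auto
      also have "\<dots> = c k"
      proof -
        have "((1/2::real) ^ n) powr - t = (1/2) powr (- (real n * t))"
          by (subst powr_realpow[symmetric]) (auto simp only: powr_powr, auto)
        also have "\<dots> = 2 powr (real n * t)" by (simp add: powr_minus powr_divide)
        also have "\<dots> = (2 powr t) ^ n" by (simp add: powr_power mult.commute)
        finally show ?thesis by (simp only: c_def k)
      qed
      finally have "ennreal (norm x powr - t) * indicator (ball 0 1) x \<le> ennreal (c k) * indicator (ball 0 (r k)) x"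
        using xk True by (auto intro: ennreal_leI)
      also have "\<dots> \<le> (\<Sum>k. ennreal (c k) * indicator (ball 0 (r k)) x)"
        by (rule ennreal_le_suminf)
      finally show ?thesis .
    qed auto
  qed
  also have "\<dots> < \<infinity>" by (rule nn_integral_ball_series_finite[OF _ _ sm]) (auto simp: c_def r_def)
  finally show ?thesis .
qed

text \<open>Scaling to the unit ball isolates \<open>r powr (3 - t)\<close>. Its positive exponent
  is what makes the part of the kernel near the diagonal small.\<close>

lemma nn_integral_singular_ball:
  fixes t :: real
  assumes "0 \<le> t" "t < 3"
  obtains c where "0 \<le> c"
    "\<And>r. 0 < r \<Longrightarrow> (\<integral>\<^sup>+(x::R3). ennreal (norm x powr - t) * indicator (ball 0 r) x \<partial>lborel) = ennreal (c * r powr (3 - t))"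
proof -
  define I where "I = (\<integral>\<^sup>+(x::R3). ennreal (norm x powr - t) * indicator (ball 0 1) x \<partial>lborel)"
  have I: "I = ennreal (enn2real I)" using nn_integral_singular_unit_ball[OF assms] by (simp add: I_def)
  have "(\<integral>\<^sup>+(x::R3). ennreal (norm x powr - t) * indicator (ball 0 r) x \<partial>lborel) = ennreal (enn2real I * r powr (3 - t))"
    if r: "0 < r" for r
  proof -
    have "(\<integral>\<^sup>+(x::R3). ennreal (norm x powr - t) * indicator (ball 0 r) x \<partial>lborel)
        = ennreal (\<bar>r\<bar> ^ 3) * (\<integral>\<^sup>+(x::R3). ennreal (norm (0 + r *\<^sub>R x) powr - t) * indicator (ball 0 r) (0 + r *\<^sub>R x) \<partial>lborel)"
      by (rule nn_integral_lborel_affine) (measurable, use r in simp)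
    also have "(\<integral>\<^sup>+(x::R3). ennreal (norm (0 + r *\<^sub>R x) powr - t) * indicator (ball 0 r) (0 + r *\<^sub>R x) \<partial>lborel)
       = (\<integral>\<^sup>+(x::R3). ennreal (r powr - t) * (ennreal (norm x powr - t) * indicator (ball 0 1) x) \<partial>lborel)"
      using r by (intro nn_integral_cong) (auto simp: powr_mult ennreal_mult split: split_indicator)
    also have "\<dots> = ennreal (r powr - t) * I" unfolding I_def by (rule nn_integral_cmult) measurable
    also have "ennreal (\<bar>r\<bar> ^ 3) * \<dots> = ennreal (r ^ 3 * r powr - t) * I" using r by (simp add: ennreal_mult mult.assoc)
    also have "r ^ 3 * r powr - t = r powr (3 - t)" using r by (simp add: powr_diff powr_minus divide_inverse)
    also have "ennreal (r powr (3 - t)) * I = ennreal (enn2real I * r powr (3 - t))"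
      by (subst I) (simp add: ennreal_mult[symmetric] mult.commute)
    finally show ?thesis .
  qed
  then show ?thesis using that[of "enn2real I"] by simp
qed

text \<open>The dyadic estimate run outwards: balls of radius \<open>2 ^ Suc k\<close> weighted by
  \<open>(1/16) ^ k\<close> give a series of ratio 8/16. The fourth power arises where two inverse
  squares are both far from their poles.\<close>

lemma nn_integral_inverse_fourth_outside_unit_ball:
  "(\<integral>\<^sup>+(x::R3). ennreal (norm x powr - 4) * indicator (- ball 0 1) x \<partial>lborel) < \<infinity>"
proof -
  define c r :: "nat \<Rightarrow> real" where "c k = (1/16) ^ k" and "r k = 2 ^ Suc k" for k
  have eq: "c k * r k ^ 3 = 8 * (1/2) ^ k" for k
  proof -
    have "r k ^ 3 = 8 * 8 ^ k" unfolding r_def using power_mult[of "2::real" 3 k] by (simp add: power_mult_distrib power_mult[symmetric] mult.commute)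
    then show ?thesis unfolding c_def by (simp add: power_mult_distrib[symmetric])
  qed
  have sm: "summable (\<lambda>k. c k * r k ^ 3)" unfolding eq by (intro summable_mult summable_geometric) auto
  have "(\<integral>\<^sup>+(x::R3). ennreal (norm x powr - 4) * indicator (- ball 0 1) x \<partial>lborel)
      \<le> (\<integral>\<^sup>+(x::R3). (\<Sum>k. ennreal (c k) * indicator (ball 0 (r k)) x) \<partial>lborel)"
  proof (rule nn_integral_mono)
    fix x :: R3
    show "ennreal (norm x powr - 4) * indicator (- ball 0 1) x \<le> (\<Sum>k. ennreal (c k) * indicator (ball 0 (r k)) x)"
    proof (cases "1 \<le> norm x")
      case True
      define n where "n = (LEAST n. norm x < (2::real) ^ n)"
      have ex: "\<exists>n. norm x < (2::real) ^ n" using real_arch_pow[of 2 "norm x"] by auto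
      have n1: "norm x < (2::real) ^ n" unfolding n_def by (rule LeastI_ex[OF ex])
      then have "n \<noteq> 0" using True by (intro notI) auto
      then obtain k where k: "n = Suc k" by (cases n) auto
      then have k2: "(2::real) ^ k \<le> norm x" using not_less_Least[of k "\<lambda>n. norm x < (2::real) ^ n"] by (auto simp: n_def)
      have xk: "x \<in> ball 0 (r k)" using n1 k by (simp add: r_def)
      have "norm x powr - 4 \<le> (2 ^ k) powr - 4" using k2 True by (intro powr_mono2') auto
      also have "\<dots> = 1 / (2 ^ k) ^ 4" by (simp add: powr_minus divide_inverse)
      also have "\<dots> = c k" unfolding c_def
        using power_mult[of "2::real" 4 k] by (simp add: power_mult[symmetric] power_divide mult.commute)
      finally have "ennreal (norm x powr - 4) * indicator (- ball 0 1) x \<le> ennreal (c k) * indicator (ball 0 (r k)) x"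
        using xk True by (auto intro: ennreal_leI)
      also have "\<dots> \<le> (\<Sum>k. ennreal (c k) * indicator (ball 0 (r k)) x)"
        by (rule ennreal_le_suminf)
      finally show ?thesis .
    qed auto
  qed
  also have "\<dots> < \<infinity>" by (rule nn_integral_ball_series_finite[OF _ _ sm]) (auto simp: c_def r_def)
  finally show ?thesis .
qed

lemma nn_integral_inverse_fourth_outside_ball:
  obtains c where "0 \<le> c"
    "\<And>r. 0 < r \<Longrightarrow> (\<integral>\<^sup>+(x::R3). ennreal (norm x powr - 4) * indicator (- ball 0 r) x \<partial>lborel) = ennreal (c / r)"
proof -
  define I where "I = (\<integral>\<^sup>+(x::R3). ennreal (norm x powr - 4) * indicator (- ball 0 1) x \<partial>lborel)"
  have I: "I = ennreal (enn2real I)" using nn_integral_inverse_fourth_outside_unit_ball by (simp add: I_def)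
  have "(\<integral>\<^sup>+(x::R3). ennreal (norm x powr - 4) * indicator (- ball 0 r) x \<partial>lborel) = ennreal (enn2real I / r)"
    if r: "0 < r" for r
  proof -
    have "(\<integral>\<^sup>+(x::R3). ennreal (norm x powr - 4) * indicator (- ball 0 r) x \<partial>lborel)
        = ennreal (\<bar>r\<bar> ^ 3) * (\<integral>\<^sup>+(x::R3). ennreal (norm (0 + r *\<^sub>R x) powr - 4) * indicator (- ball 0 r) (0 + r *\<^sub>R x) \<partial>lborel)"
      by (rule nn_integral_lborel_affine) (measurable, use r in simp)
    also have "(\<integral>\<^sup>+(x::R3). ennreal (norm (0 + r *\<^sub>R x) powr - 4) * indicator (- ball 0 r) (0 + r *\<^sub>R x) \<partial>lborel)
       = (\<integral>\<^sup>+(x::R3). ennreal (r powr - 4) * (ennreal (norm x powr - 4) * indicator (- ball 0 1) x) \<partial>lborel)"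
      using r by (intro nn_integral_cong) (auto simp: powr_mult ennreal_mult split: split_indicator)
    also have "\<dots> = ennreal (r powr - 4) * I" unfolding I_def by (rule nn_integral_cmult) measurable
    also have "ennreal (\<bar>r\<bar> ^ 3) * \<dots> = ennreal (r ^ 3 * r powr - 4) * I" using r by (simp add: ennreal_mult mult.assoc)
    also have "r ^ 3 * r powr - 4 = 1 / r" 
    proof -
      have "r ^ 3 * r powr - 4 = r powr (3 + - 4)" using r unfolding powr_add by simp
      then show ?thesis using r by (simp add: powr_minus_divide)
    qed
    also have "ennreal (1 / r) * I = ennreal (enn2real I / r)"
      using r by (subst I) (simp add: ennreal_mult[symmetric] mult.commute)
    finally show ?thesis .
  qed
  then show ?thesis using that[of "enn2real I"] by simp
qed

text \<open>Let d = |y - z|. Within d/2 of one pole the other factor is at most 4/d^2, and the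
  remaining inverse square integrates to a multiple of d. Away from both poles the product is at
  most the sum of the two inverse fourth powers, whose integrals there are multiples of 1/d. Both
  contributions have order 1/d.\<close>

lemma nn_integral_inverse_square_product:
  obtains C where "0 \<le> C"
    "\<And>y z::R3. y \<noteq> z \<Longrightarrow>
      (\<integral>\<^sup>+x. ennreal (1 / (norm (x - y))\<^sup>2 * (1 / (norm (x - z))\<^sup>2)) \<partial>lborel) \<le> ennreal (C / norm (y - z))"
proof -
  obtain c1 where c1: "0 \<le> c1"
    "\<And>r. 0 < r \<Longrightarrow> (\<integral>\<^sup>+(x::R3). ennreal (norm x powr - 2) * indicator (ball 0 r) x \<partial>lborel) = ennreal (c1 * r powr (3 - 2))"
    using nn_integral_singular_ball[of 2] by auto
  obtain c2 where c2: "0 \<le> c2"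
    "\<And>r. 0 < r \<Longrightarrow> (\<integral>\<^sup>+(x::R3). ennreal (norm x powr - 4) * indicator (- ball 0 r) x \<partial>lborel) = ennreal (c2 / r)"
    using nn_integral_inverse_fourth_outside_ball by auto
  define C where "C = 4 * c1 + 4 * c2"
  have "(\<integral>\<^sup>+x. ennreal (1 / (norm (x - y))\<^sup>2 * (1 / (norm (x - z))\<^sup>2)) \<partial>lborel) \<le> ennreal (C / norm (y - z))"
    if yz: "y \<noteq> z" for y z :: R3
  proof -
    define d where "d = norm (y - z)"
    have d: "0 < d" using yz by (simp add: d_def)
    let ?A = "\<lambda>x::R3. ennreal (norm x powr - 2) * indicator (ball 0 (d/2)) x"
    let ?B = "\<lambda>x::R3. ennreal (norm x powr - 4) * indicator (- ball 0 (d/2)) x"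
    have pt: "ennreal (1 / (norm (x - y))\<^sup>2 * (1 / (norm (x - z))\<^sup>2))
       \<le> ennreal (4 / d\<^sup>2) * (?A (x - y) + ?A (x - z)) + (?B (x - y) + ?B (x - z))" for x
    proof -
      define a b where "a = norm (x - y)" and "b = norm (x - z)"
      have ab: "0 \<le> a" "0 \<le> b" "d \<le> a + b"
        using norm_triangle_ineq4[of "x - z" "x - y"] by (auto simp: a_def b_def d_def norm_minus_commute)
      have p2: "w powr - 2 = 1 / w\<^sup>2" "w powr - 4 = 1 / w ^ 4" if "0 \<le> w" for w :: real
        using that by (cases "w = 0"; simp add: powr_minus divide_inverse)+
      have sq: "1 / w\<^sup>2 \<le> 4 / d\<^sup>2" if "d / 2 \<le> w" for w
      proof -
        have "(d/2)\<^sup>2 \<le> w\<^sup>2" using that d by (intro power_mono) auto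
        then have "1 / w\<^sup>2 \<le> 1 / (d/2)\<^sup>2" using d by (intro divide_left_mono) (auto simp: zero_less_mult_iff intro: less_le_trans)
        then show ?thesis by (simp add: power_divide)
      qed
      consider "a < d/2" | "b < d/2" "d/2 \<le> a" | "d/2 \<le> a" "d/2 \<le> b" by linarith
      then show ?thesis
      proof cases
        case 1
        then have "1 / b\<^sup>2 \<le> 4 / d\<^sup>2" using ab by (intro sq) auto
        then have "1 / a\<^sup>2 * (1 / b\<^sup>2) \<le> 4 / d\<^sup>2 * (1 / a\<^sup>2)" by (subst mult.commute) (intro mult_right_mono, auto)
        then have "ennreal (1 / a\<^sup>2 * (1 / b\<^sup>2)) \<le> ennreal (4 / d\<^sup>2) * ?A (x - y)"
          using 1 ab by (simp add: p2 a_def ennreal_mult[symmetric])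
        also have "\<dots> \<le> ennreal (4 / d\<^sup>2) * (?A (x - y) + ?A (x - z)) + (?B (x - y) + ?B (x - z))"
          by (simp add: distrib_left add.assoc)
        finally show ?thesis by (simp add: a_def b_def)
      next
        case 2
        then have "1 / a\<^sup>2 \<le> 4 / d\<^sup>2" using ab by (intro sq) auto
        then have "1 / a\<^sup>2 * (1 / b\<^sup>2) \<le> 4 / d\<^sup>2 * (1 / b\<^sup>2)" by (intro mult_right_mono, auto)
        then have "ennreal (1 / a\<^sup>2 * (1 / b\<^sup>2)) \<le> ennreal (4 / d\<^sup>2) * ?A (x - z)"
          using 2 ab by (simp add: p2 b_def ennreal_mult[symmetric])
        also have "\<dots> \<le> ennreal (4 / d\<^sup>2) * (?A (x - y) + ?A (x - z)) + (?B (x - y) + ?B (x - z))"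
          by (simp add: distrib_left add.assoc add_increasing add_increasing2)
        finally show ?thesis by (simp add: a_def b_def)
      next
        case 3
        have "0 \<le> (1 / a\<^sup>2 - 1 / b\<^sup>2)\<^sup>2" by simp
        then have "2 * (1 / a\<^sup>2 * (1 / b\<^sup>2)) \<le> 1 / a ^ 4 + 1 / b ^ 4"
          by (simp add: power2_diff power_divide flip: power_mult)
        moreover have "0 \<le> 1 / a\<^sup>2 * (1 / b\<^sup>2)" by simp
        ultimately have "1 / a\<^sup>2 * (1 / b\<^sup>2) \<le> 1 / a ^ 4 + 1 / b ^ 4" by linarith
        then have "ennreal (1 / a\<^sup>2 * (1 / b\<^sup>2)) \<le> ?B (x - y) + ?B (x - z)"
          using 3 ab by (simp add: p2 a_def b_def ennreal_plus[symmetric] del: ennreal_plus)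
        also have "\<dots> \<le> ennreal (4 / d\<^sup>2) * (?A (x - y) + ?A (x - z)) + (?B (x - y) + ?B (x - z))"
          by (simp add: add_increasing)
        finally show ?thesis by (simp add: a_def b_def)
      qed
    qed
    have mA[measurable]: "(\<lambda>x. ?A (x - w)) \<in> borel_measurable borel" "(\<lambda>x. ?B (x - w)) \<in> borel_measurable borel" for w
      by measurable
    have mA0[measurable]: "?A \<in> borel_measurable borel" "?B \<in> borel_measurable borel" by measurable
    have "(\<integral>\<^sup>+x. ennreal (1 / (norm (x - y))\<^sup>2 * (1 / (norm (x - z))\<^sup>2)) \<partial>lborel)
       \<le> (\<integral>\<^sup>+x. ennreal (4 / d\<^sup>2) * (?A (x - y) + ?A (x - z)) + (?B (x - y) + ?B (x - z)) \<partial>lborel)"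
      by (intro nn_integral_mono pt)
    also have "\<dots> = ennreal (4 / d\<^sup>2) * ((\<integral>\<^sup>+x. ?A (x - y) \<partial>lborel) + (\<integral>\<^sup>+x. ?A (x - z) \<partial>lborel))
        + ((\<integral>\<^sup>+x. ?B (x - y) \<partial>lborel) + (\<integral>\<^sup>+x. ?B (x - z) \<partial>lborel))"
    proof -
      have "(\<integral>\<^sup>+x. ennreal (4 / d\<^sup>2) * (?A (x - y) + ?A (x - z)) + (?B (x - y) + ?B (x - z)) \<partial>lborel)
        = (\<integral>\<^sup>+x. ennreal (4 / d\<^sup>2) * (?A (x - y) + ?A (x - z)) \<partial>lborel) + (\<integral>\<^sup>+x. ?B (x - y) + ?B (x - z) \<partial>lborel)"
        by (rule nn_integral_add) (use mA in measurable)
      also have "(\<integral>\<^sup>+x. ennreal (4 / d\<^sup>2) * (?A (x - y) + ?A (x - z)) \<partial>lborel)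
        = ennreal (4 / d\<^sup>2) * (\<integral>\<^sup>+x. ?A (x - y) + ?A (x - z) \<partial>lborel)"
        by (rule nn_integral_cmult) (use mA in measurable)
      also have "(\<integral>\<^sup>+x. ?A (x - y) + ?A (x - z) \<partial>lborel) = (\<integral>\<^sup>+x. ?A (x - y) \<partial>lborel) + (\<integral>\<^sup>+x. ?A (x - z) \<partial>lborel)"
        by (rule nn_integral_add) (use mA in measurable)
      also have "(\<integral>\<^sup>+x. ?B (x - y) + ?B (x - z) \<partial>lborel) = (\<integral>\<^sup>+x. ?B (x - y) \<partial>lborel) + (\<integral>\<^sup>+x. ?B (x - z) \<partial>lborel)"
        by (rule nn_integral_add) (use mA in measurable)
      finally show ?thesis .
    qed
    also have "\<dots> = ennreal (4 / d\<^sup>2) * (ennreal (c1 * (d/2)) + ennreal (c1 * (d/2))) + (ennreal (c2 / (d/2)) + ennreal (c2 / (d/2)))"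
    proof -
      have A: "(\<integral>\<^sup>+x. ?A (x - w) \<partial>lborel) = ennreal (c1 * (d/2))" for w
        using c1(2)[of "d/2"] d nn_integral_lborel_translate[OF mA0(1), of w] by simp
      have B: "(\<integral>\<^sup>+x. ?B (x - w) \<partial>lborel) = ennreal (c2 / (d/2))" for w
        using c2(2)[of "d/2"] d nn_integral_lborel_translate[OF mA0(2), of w] by simp
      show ?thesis by (simp only: A B)
    qed
    also have "\<dots> = ennreal (4 / d\<^sup>2 * (c1 * (d/2) + c1 * (d/2)) + (c2 / (d/2) + c2 / (d/2)))"
    proof -
      have "ennreal k * (ennreal u + ennreal u') + (ennreal v + ennreal v') = ennreal (k * (u + u') + (v + v'))"
        if "0 \<le> k" "0 \<le> u" "0 \<le> u'" "0 \<le> v" "0 \<le> v'" for k u u' v v' :: real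
        using that by (simp add: ennreal_mult)
      note this[of "4 / d\<^sup>2" "c1 * (d/2)" "c1 * (d/2)" "c2 / (d/2)" "c2 / (d/2)"]
      then show ?thesis using c1(1) c2(1) d by (metis (no_types, lifting) divide_nonneg_pos half_gt_zero less_imp_le mult_nonneg_nonneg zero_le_divide_iff zero_le_numeral zero_le_power2)
    qed
    also have "4 / d\<^sup>2 * (c1 * (d/2) + c1 * (d/2)) + (c2 / (d/2) + c2 / (d/2)) = C / d"
      using d by (simp add: C_def field_simps power2_eq_square)
    finally show ?thesis by (simp add: d_def)
  qed
  moreover have "0 \<le> C" using c1 c2 by (simp add: C_def)
  ultimately show ?thesis using that by blast
qed

section \<open>The Coulomb energy of two densities\<close>

text \<open>Densities are nonnegative and Borel at every point, so that Tonelli and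
  \<open>nn_integral\<close> over \<open>lborel\<close> apply without exceptional sets. The Lebesgue
  measurable functions of the theorem are replaced by such representatives at the very end.\<close>

definition nonneg_borel :: "(R3 \<Rightarrow> real) \<Rightarrow> bool" where
  "nonneg_borel f \<longleftrightarrow> f \<in> borel_measurable borel \<and> (\<forall>x. 0 \<le> f x)"

lemma nonneg_borelD: "nonneg_borel f \<Longrightarrow> f \<in> borel_measurable borel" "nonneg_borel f \<Longrightarrow> 0 \<le> f x"
  by (auto simp: nonneg_borel_def)

text \<open>The kernel is a parameter because the Coulomb kernel is repeatedly exchanged for a near
  part, a truncation or an indicator. Values in \<open>ennreal\<close> keep these exchanges free of
  integrability conditions.\<close>

definition pair_energy :: "(R3 \<Rightarrow> real) \<Rightarrow> (R3 \<Rightarrow> real) \<Rightarrow> (R3 \<Rightarrow> real) \<Rightarrow> ennreal" where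
  "pair_energy k f g = (\<integral>\<^sup>+x. (\<integral>\<^sup>+y. ennreal (f x * g y * k (x - y)) \<partial>lborel) \<partial>lborel)"

lemma pair_energy_eq:
  assumes f: "nonneg_borel f" and g: "nonneg_borel g" and k: "nonneg_borel k"
  shows "pair_energy k f g = (\<integral>\<^sup>+x. ennreal (f x) * (\<integral>\<^sup>+y. ennreal (g y * k (x - y)) \<partial>lborel) \<partial>lborel)"
proof -
  note [measurable] = nonneg_borelD(1)[OF f] nonneg_borelD(1)[OF g] nonneg_borelD(1)[OF k]
  show ?thesis unfolding pair_energy_def
    by (intro nn_integral_cong, subst nn_integral_cmult[symmetric])
       (auto intro!: nn_integral_cong simp: ennreal_mult[symmetric] nonneg_borelD(2)[OF f] nonneg_borelD(2)[OF g] nonneg_borelD(2)[OF k] mult.assoc)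
qed

lemma pair_energy_mono:
  assumes "\<And>x. 0 \<le> f x" "\<And>x. 0 \<le> g x" "\<And>x. 0 \<le> k x" "\<And>x. f x \<le> f' x" "\<And>x. g x \<le> g' x" "\<And>x. k x \<le> k' x"
  shows "pair_energy k f g \<le> pair_energy k' f' g'"
proof -
  have "0 \<le> f' x" "0 \<le> g' x" for x using assms order_trans by blast+
  then show ?thesis unfolding pair_energy_def
    using assms by (intro nn_integral_mono ennreal_leI mult_mono mult_nonneg_nonneg) auto
qed

lemma pair_energy_add_left:
  assumes f: "nonneg_borel f" and f': "nonneg_borel f'" and g: "nonneg_borel g" and k: "nonneg_borel k"
  shows "pair_energy k (\<lambda>x. f x + f' x) g = pair_energy k f g + pair_energy k f' g"
proof -
  note [measurable] = f[THEN nonneg_borelD(1)] f'[THEN nonneg_borelD(1)] g[THEN nonneg_borelD(1)] k[THEN nonneg_borelD(1)]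
  note nn = f[THEN nonneg_borelD(2)] f'[THEN nonneg_borelD(2)] g[THEN nonneg_borelD(2)] k[THEN nonneg_borelD(2)]
  have "pair_energy k (\<lambda>x. f x + f' x) g
      = (\<integral>\<^sup>+x. (\<integral>\<^sup>+y. ennreal (f x * g y * k (x - y)) + ennreal (f' x * g y * k (x - y)) \<partial>lborel) \<partial>lborel)"
    unfolding pair_energy_def using nn by (intro nn_integral_cong) (simp add: ennreal_plus[symmetric] distrib_right del: ennreal_plus)
  also have "\<dots> = (\<integral>\<^sup>+x. (\<integral>\<^sup>+y. ennreal (f x * g y * k (x - y)) \<partial>lborel) + (\<integral>\<^sup>+y. ennreal (f' x * g y * k (x - y)) \<partial>lborel) \<partial>lborel)"
    by (intro nn_integral_cong nn_integral_add) measurable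
  also have "\<dots> = pair_energy k f g + pair_energy k f' g"
    unfolding pair_energy_def by (intro nn_integral_add) measurable
  finally show ?thesis .
qed

lemma pair_energy_add_kernel:
  assumes f: "nonneg_borel f" and k': "nonneg_borel k'" and g: "nonneg_borel g" and k: "nonneg_borel k"
  shows "pair_energy (\<lambda>x. k x + k' x) f g = pair_energy k f g + pair_energy k' f g"
proof -
  note [measurable] = f[THEN nonneg_borelD(1)] k'[THEN nonneg_borelD(1)] g[THEN nonneg_borelD(1)] k[THEN nonneg_borelD(1)]
  note nn = f[THEN nonneg_borelD(2)] k'[THEN nonneg_borelD(2)] g[THEN nonneg_borelD(2)] k[THEN nonneg_borelD(2)]
  have "pair_energy (\<lambda>x. k x + k' x) f g
      = (\<integral>\<^sup>+x. (\<integral>\<^sup>+y. ennreal (f x * g y * k (x - y)) + ennreal (f x * g y * k' (x - y)) \<partial>lborel) \<partial>lborel)"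
    unfolding pair_energy_def using nn by (intro nn_integral_cong) (simp add: ennreal_plus[symmetric] distrib_left del: ennreal_plus)
  also have "\<dots> = (\<integral>\<^sup>+x. (\<integral>\<^sup>+y. ennreal (f x * g y * k (x - y)) \<partial>lborel) + (\<integral>\<^sup>+y. ennreal (f x * g y * k' (x - y)) \<partial>lborel) \<partial>lborel)"
    by (intro nn_integral_cong nn_integral_add) measurable
  also have "\<dots> = pair_energy k f g + pair_energy k' f g"
    unfolding pair_energy_def by (intro nn_integral_add) measurable
  finally show ?thesis .
qed

lemma pair_energy_commute:
  assumes f: "nonneg_borel f" and g: "nonneg_borel g" and k: "nonneg_borel k" and e: "\<And>z. k (- z) = k z"
  shows "pair_energy k f g = pair_energy k g f"
proof -
  note [measurable] = f[THEN nonneg_borelD(1)] g[THEN nonneg_borelD(1)] k[THEN nonneg_borelD(1)]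
  have "pair_energy k f g = (\<integral>\<^sup>+y. (\<integral>\<^sup>+x. ennreal (f x * g y * k (x - y)) \<partial>lborel) \<partial>lborel)"
    unfolding pair_energy_def by (rule lborel_pair.Fubini') measurable
  also have "\<dots> = pair_energy k g f"
    unfolding pair_energy_def
  proof (intro nn_integral_cong)
    fix x y
    show "ennreal (f x * g y * k (x - y)) = ennreal (g y * f x * k (y - x))" using e[of "x - y"] by (simp add: mult_ac)
  qed
  finally show ?thesis .
qed

lemma pair_energy_cmult_kernel:
  assumes f: "nonneg_borel f" and g: "nonneg_borel g" and k: "nonneg_borel k" and c: "0 \<le> c"
  shows "pair_energy (\<lambda>x. c * k x) f g = ennreal c * pair_energy k f g"
proof -
  note [measurable] = f[THEN nonneg_borelD(1)] g[THEN nonneg_borelD(1)] k[THEN nonneg_borelD(1)]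
  note nn = f[THEN nonneg_borelD(2)] g[THEN nonneg_borelD(2)] k[THEN nonneg_borelD(2)]
  have "pair_energy (\<lambda>x. c * k x) f g = (\<integral>\<^sup>+x. (\<integral>\<^sup>+y. ennreal c * ennreal (f x * g y * k (x - y)) \<partial>lborel) \<partial>lborel)"
    unfolding pair_energy_def using nn c by (intro nn_integral_cong) (simp add: ennreal_mult[symmetric] mult_ac)
  also have "\<dots> = (\<integral>\<^sup>+x. ennreal c * (\<integral>\<^sup>+y. ennreal (f x * g y * k (x - y)) \<partial>lborel) \<partial>lborel)"
    by (intro nn_integral_cong nn_integral_cmult) measurable
  also have "\<dots> = ennreal c * pair_energy k f g"
    unfolding pair_energy_def by (intro nn_integral_cmult) measurable
  finally show ?thesis .
qed

lemma pair_energy_cmult_left: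
  assumes f: "nonneg_borel f" and g: "nonneg_borel g" and k: "nonneg_borel k" and c: "0 \<le> c"
  shows "pair_energy k (\<lambda>x. c * f x) g = ennreal c * pair_energy k f g"
proof -
  have "pair_energy k (\<lambda>x. c * f x) g = pair_energy (\<lambda>x. c * k x) f g"
    unfolding pair_energy_def by (simp add: mult_ac)
  then show ?thesis using pair_energy_cmult_kernel[OF assms] by simp
qed

lemma pair_energy_bounded_kernel:
  assumes f: "nonneg_borel f" and g: "nonneg_borel g" and k: "\<And>x. k x \<le> c" and c: "0 \<le> c"
  shows "pair_energy k f g \<le> ennreal c * ((\<integral>\<^sup>+x. ennreal (f x) \<partial>lborel) * (\<integral>\<^sup>+x. ennreal (g x) \<partial>lborel))"
proof -
  note [measurable] = f[THEN nonneg_borelD(1)] g[THEN nonneg_borelD(1)]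
  note nn = f[THEN nonneg_borelD(2)] g[THEN nonneg_borelD(2)]
  have "pair_energy k f g \<le> (\<integral>\<^sup>+x. (\<integral>\<^sup>+y. ennreal c * ennreal (f x) * ennreal (g y) \<partial>lborel) \<partial>lborel)"
    unfolding pair_energy_def
  proof (intro nn_integral_mono)
    fix x y
    have "f x * g y * k (x - y) \<le> f x * g y * c" using nn k by (intro mult_left_mono) auto
    then show "ennreal (f x * g y * k (x - y)) \<le> ennreal c * ennreal (f x) * ennreal (g y)"
      using nn c by (simp add: ennreal_mult[symmetric] mult_ac ennreal_leI)
  qed
  also have "\<dots> = (\<integral>\<^sup>+x. ennreal c * ennreal (f x) * (\<integral>\<^sup>+y. ennreal (g y) \<partial>lborel) \<partial>lborel)"
    by (intro nn_integral_cong nn_integral_cmult) measurable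
  also have "\<dots> = (\<integral>\<^sup>+x. ennreal c * ennreal (f x) \<partial>lborel) * (\<integral>\<^sup>+y. ennreal (g y) \<partial>lborel)"
    by (rule nn_integral_multc) measurable
  also have "(\<integral>\<^sup>+x. ennreal c * ennreal (f x) \<partial>lborel) = ennreal c * (\<integral>\<^sup>+x. ennreal (f x) \<partial>lborel)"
    by (rule nn_integral_cmult) measurable
  finally show ?thesis by (simp add: mult.assoc)
qed

text \<open>The trilinear inequality integrated over both variables, its coefficients being at most
  1. A sum of products stands in for the usual product of norms: it yields finiteness directly, and
  smallness after a rescaling of the kernel.\<close>

lemma pair_energy_young:
  fixes A B t :: real
  assumes f: "nonneg_borel f" and g: "nonneg_borel g" and k: "nonneg_borel k"
    and "1 \<le> A" "1 \<le> B" "1 \<le> t" and s: "1 / A + 1 / B + 1 / t = 2"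
  shows "pair_energy k f g \<le> (\<integral>\<^sup>+x. ennreal (f x powr A) \<partial>lborel) * (\<integral>\<^sup>+x. ennreal (g x powr B) \<partial>lborel)
     + (\<integral>\<^sup>+x. ennreal (f x powr A) \<partial>lborel) * (\<integral>\<^sup>+x. ennreal (k x powr t) \<partial>lborel)
     + (\<integral>\<^sup>+x. ennreal (g x powr B) \<partial>lborel) * (\<integral>\<^sup>+x. ennreal (k x powr t) \<partial>lborel)"
proof -
  note [measurable] = f[THEN nonneg_borelD(1)] g[THEN nonneg_borelD(1)] k[THEN nonneg_borelD(1)]
  note nn = f[THEN nonneg_borelD(2)] g[THEN nonneg_borelD(2)] k[THEN nonneg_borelD(2)]
  let ?F = "\<lambda>x. ennreal (f x powr A)" and ?G = "\<lambda>x. ennreal (g x powr B)" and ?K = "\<lambda>x. ennreal (k x powr t)"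
  have le: "f x * g y * k z \<le> f x powr A * g y powr B + f x powr A * k z powr t + g y powr B * k z powr t" for x y z
  proof -
    have *: "(1 - 1 / c) * d \<le> d" if "1 \<le> c" "0 \<le> d" for c d :: real
    proof -
      have "(1 - 1 / c) * d \<le> 1 * d" using that by (intro mult_right_mono) auto
      then show ?thesis by simp
    qed
    have "f x * g y * k z \<le> (1 - 1 / t) * (f x powr A * g y powr B) + (1 - 1 / B) * (f x powr A * k z powr t)
      + (1 - 1 / A) * (g y powr B * k z powr t)"
      using nn assms by (intro trilinear_young) auto
    also have "\<dots> \<le> f x powr A * g y powr B + f x powr A * k z powr t + g y powr B * k z powr t"
      using assms by (intro add_mono *) auto
    finally show ?thesis .
  qed
  have "pair_energy k f g \<le> (\<integral>\<^sup>+x. (\<integral>\<^sup>+y. ?F x * ?G y + ?F x * ?K (x - y) + ?G y * ?K (x - y) \<partial>lborel) \<partial>lborel)"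
    unfolding pair_energy_def
    by (intro nn_integral_mono order_trans[OF ennreal_leI[OF le]]) (simp add: ennreal_mult)
  also have "\<dots> = (\<integral>\<^sup>+x. (\<integral>\<^sup>+y. ?F x * ?G y \<partial>lborel) + (\<integral>\<^sup>+y. ?F x * ?K (x - y) \<partial>lborel) + (\<integral>\<^sup>+y. ?G y * ?K (x - y) \<partial>lborel) \<partial>lborel)"
  proof (rule nn_integral_cong)
    fix x
    have "(\<integral>\<^sup>+y. ?F x * ?G y + ?F x * ?K (x - y) + ?G y * ?K (x - y) \<partial>lborel)
       = (\<integral>\<^sup>+y. ?F x * ?G y + ?F x * ?K (x - y) \<partial>lborel) + (\<integral>\<^sup>+y. ?G y * ?K (x - y) \<partial>lborel)"
      by (rule nn_integral_add) measurable
    also have "(\<integral>\<^sup>+y. ?F x * ?G y + ?F x * ?K (x - y) \<partial>lborel) = (\<integral>\<^sup>+y. ?F x * ?G y \<partial>lborel) + (\<integral>\<^sup>+y. ?F x * ?K (x - y) \<partial>lborel)"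
      by (rule nn_integral_add) measurable
    finally show "(\<integral>\<^sup>+y. ?F x * ?G y + ?F x * ?K (x - y) + ?G y * ?K (x - y) \<partial>lborel)
       = (\<integral>\<^sup>+y. ?F x * ?G y \<partial>lborel) + (\<integral>\<^sup>+y. ?F x * ?K (x - y) \<partial>lborel) + (\<integral>\<^sup>+y. ?G y * ?K (x - y) \<partial>lborel)" .
  qed
  also have "\<dots> = (\<integral>\<^sup>+x. (\<integral>\<^sup>+y. ?F x * ?G y \<partial>lborel) + (\<integral>\<^sup>+y. ?F x * ?K (x - y) \<partial>lborel) \<partial>lborel)
      + (\<integral>\<^sup>+x. (\<integral>\<^sup>+y. ?G y * ?K (x - y) \<partial>lborel) \<partial>lborel)"
    by (rule nn_integral_add) measurable
  also have "(\<integral>\<^sup>+x. (\<integral>\<^sup>+y. ?F x * ?G y \<partial>lborel) + (\<integral>\<^sup>+y. ?F x * ?K (x - y) \<partial>lborel) \<partial>lborel)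
      = (\<integral>\<^sup>+x. (\<integral>\<^sup>+y. ?F x * ?G y \<partial>lborel) \<partial>lborel) + (\<integral>\<^sup>+x. (\<integral>\<^sup>+y. ?F x * ?K (x - y) \<partial>lborel) \<partial>lborel)"
    by (rule nn_integral_add) measurable
  also have "(\<integral>\<^sup>+x. (\<integral>\<^sup>+y. ?F x * ?G y \<partial>lborel) \<partial>lborel) = integral\<^sup>N lborel ?F * integral\<^sup>N lborel ?G"
    by (simp add: nn_integral_cmult nn_integral_multc)
  also have "(\<integral>\<^sup>+x. (\<integral>\<^sup>+y. ?F x * ?K (x - y) \<partial>lborel) \<partial>lborel) = integral\<^sup>N lborel ?F * integral\<^sup>N lborel ?K"
    by (simp add: nn_integral_cmult nn_integral_multc nn_integral_lborel_reflect[where F = ?K])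
  also have "(\<integral>\<^sup>+x. (\<integral>\<^sup>+y. ?G y * ?K (x - y) \<partial>lborel) \<partial>lborel) = (\<integral>\<^sup>+y. (\<integral>\<^sup>+x. ?G y * ?K (x - y) \<partial>lborel) \<partial>lborel)"
    by (rule lborel_pair.Fubini') measurable
  also have "\<dots> = integral\<^sup>N lborel ?G * integral\<^sup>N lborel ?K"
    by (simp add: nn_integral_cmult nn_integral_multc nn_integral_lborel_translate[where F = ?K])
  finally show ?thesis .
qed

text \<open>As \<open>1/0 = 0\<close>, the functions \<open>newton\<close> and \<open>near r\<close> vanish at the origin, so \<open>cutoff r \<le> newton\<close> holds only away from it.\<close>

definition newton :: "R3 \<Rightarrow> real" where "newton z = 1 / norm z"
definition near :: "real \<Rightarrow> R3 \<Rightarrow> real" where "near r z = indicator (ball 0 r) z / norm z"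
definition cutoff :: "real \<Rightarrow> R3 \<Rightarrow> real" where "cutoff r z = 1 / max (norm z) r"

lemma nonneg_borel_newton: "nonneg_borel newton"
  unfolding nonneg_borel_def newton_def by measurable

lemma nonneg_borel_near: "nonneg_borel (near r)"
  unfolding nonneg_borel_def near_def by measurable

lemma nonneg_borel_cutoff: "0 < r \<Longrightarrow> nonneg_borel (cutoff r)"
  unfolding nonneg_borel_def cutoff_def by measurable (auto simp: max_def)

lemma cutoff_le: "0 < r \<Longrightarrow> cutoff r z \<le> 1 / r"
  unfolding cutoff_def by (intro divide_left_mono mult_pos_pos) (auto simp: max_def)

lemma newton_le_near_cutoff: "0 < r \<Longrightarrow> newton z \<le> near r z + cutoff r z"
  by (auto simp: newton_def near_def cutoff_def max_def indicator_def)

text \<open>The kernels compare in the wrong direction only for \<open>x = y\<close>, which is a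
  null set of the inner integral.\<close>

lemma pair_energy_cutoff_le_newton:
  assumes f: "nonneg_borel f" and g: "nonneg_borel g"
  shows "pair_energy (cutoff r) f g \<le> pair_energy newton f g"
  unfolding pair_energy_def
proof (rule nn_integral_mono)
  fix x
  show "(\<integral>\<^sup>+y. ennreal (f x * g y * cutoff r (x - y)) \<partial>lborel) \<le> (\<integral>\<^sup>+y. ennreal (f x * g y * newton (x - y)) \<partial>lborel)"
  proof (rule nn_integral_mono_AE)
    show "AE y in lborel. ennreal (f x * g y * cutoff r (x - y)) \<le> ennreal (f x * g y * newton (x - y))"
      using AE_lborel_singleton[of x]
    proof eventually_elim
      case (elim y)
      then have "cutoff r (x - y) \<le> newton (x - y)" unfolding cutoff_def newton_def
        using elim by (cases "norm (x - y) \<le> r"; intro divide_left_mono mult_pos_pos)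
          (auto simp: max_def intro: less_le_trans[of 0 "norm (x - y)"])
      then show ?case using f g by (intro ennreal_leI mult_left_mono) (auto simp: nonneg_borelD)
    qed
  qed
qed

text \<open>The radius depends on \<open>\<epsilon>\<close> and \<open>B\<close> alone. This makes
  the contribution near the diagonal negligible uniformly along any sequence with bounded
  p-integrals.\<close>

lemma pair_energy_near_small:
  fixes p \<epsilon> B :: real
  assumes p: "6 / 5 < p" "p < 2" and \<epsilon>: "0 < \<epsilon>" and B: "0 \<le> B"
  obtains r where "0 < r"
    "\<And>f g. nonneg_borel f \<Longrightarrow> nonneg_borel g \<Longrightarrow> (\<integral>\<^sup>+x. ennreal (f x powr p) \<partial>lborel) \<le> ennreal B \<Longrightarrow>
      (\<integral>\<^sup>+x. ennreal (g x powr p) \<partial>lborel) \<le> ennreal B \<Longrightarrow> pair_energy (near r) f g \<le> ennreal \<epsilon>"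
proof -
  define t where "t = p / (2 * (p - 1))"
  have t: "1 \<le> t" "t < 3" using p by (auto simp: t_def field_simps)
  have tt: "1 / p + 1 / p + 1 / t = 2" using p by (simp add: t_def field_simps)
  obtain c where c: "0 \<le> c"
    "\<And>r. 0 < r \<Longrightarrow> (\<integral>\<^sup>+(x::R3). ennreal (norm x powr - t) * indicator (ball 0 r) x \<partial>lborel) = ennreal (c * r powr (3 - t))"
    using nn_integral_singular_ball[of t] t by auto
  \<comment> \<open>One term of the Young bound does not contain the kernel and would not shrink
    with \<open>r\<close>. Writing \<open>near r\<close> as \<open>\<theta>\<close> times a rescaled
    kernel turns that term into \<open>\<theta> * (B * B)\<close>, at most
    \<open>\<epsilon> / 2\<close>. Only then is \<open>\<delta> = r powr (3 - t)\<close> chosen so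
    that the two kernel terms contribute at most \<open>\<epsilon> / 2\<close>.\<close>
  define \<theta> where "\<theta> = \<epsilon> / (2 * (B * B + 1))"
  have \<theta>: "0 < \<theta>" using \<epsilon> B by (auto simp: \<theta>_def intro!: divide_pos_pos add_nonneg_pos)
  define \<delta> where "\<delta> = \<epsilon> / (4 * (B + 1) * (c + 1) * (\<theta> * \<theta> powr - t))"
  have \<delta>: "0 < \<delta>" using \<epsilon> B c \<theta> by (auto simp: \<delta>_def intro!: divide_pos_pos mult_pos_pos)
  define r where "r = \<delta> powr (1 / (3 - t))"
  have r: "0 < r" "r powr (3 - t) = \<delta>" using \<delta> t by (auto simp: r_def powr_powr)
  let ?k = "\<lambda>z. (1 / \<theta>) * near r z"
  have kb: "nonneg_borel ?k" using nonneg_borel_near[of r] \<theta> by (auto simp: nonneg_borel_def)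
  have kint: "(\<integral>\<^sup>+x. ennreal (?k x powr t) \<partial>lborel) = ennreal (\<theta> powr - t * c * \<delta>)"
  proof -
    have "(\<integral>\<^sup>+x. ennreal (?k x powr t) \<partial>lborel) = (\<integral>\<^sup>+(x::R3). ennreal (\<theta> powr - t) * (ennreal (norm x powr - t) * indicator (ball 0 r) x) \<partial>lborel)"
      using \<theta> by (intro nn_integral_cong)
        (auto simp: near_def indicator_def powr_mult powr_divide powr_minus divide_inverse ennreal_mult[symmetric] inverse_powr)
    also have "\<dots> = ennreal (\<theta> powr - t) * ennreal (c * \<delta>)"
      using c(2)[OF r(1)] r(2) by (subst nn_integral_cmult) auto
    finally show ?thesis using c \<delta> by (simp add: ennreal_mult[symmetric] mult.assoc)
  qed
  have "pair_energy (near r) f g \<le> ennreal \<epsilon>"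
    if f: "nonneg_borel f" and g: "nonneg_borel g" and F: "(\<integral>\<^sup>+x. ennreal (f x powr p) \<partial>lborel) \<le> ennreal B"
      and G: "(\<integral>\<^sup>+x. ennreal (g x powr p) \<partial>lborel) \<le> ennreal B" for f g
  proof -
    have "pair_energy (near r) f g = pair_energy (\<lambda>z. \<theta> * ?k z) f g" using \<theta> by simp
    also have "\<dots> = ennreal \<theta> * pair_energy ?k f g"
      using \<theta> by (intro pair_energy_cmult_kernel f g kb) auto
    finally have E: "pair_energy (near r) f g = ennreal \<theta> * pair_energy ?k f g" .
    have "pair_energy ?k f g \<le> (\<integral>\<^sup>+x. ennreal (f x powr p) \<partial>lborel) * (\<integral>\<^sup>+x. ennreal (g x powr p) \<partial>lborel)
     + (\<integral>\<^sup>+x. ennreal (f x powr p) \<partial>lborel) * (\<integral>\<^sup>+x. ennreal (?k x powr t) \<partial>lborel)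
     + (\<integral>\<^sup>+x. ennreal (g x powr p) \<partial>lborel) * (\<integral>\<^sup>+x. ennreal (?k x powr t) \<partial>lborel)"
      by (rule pair_energy_young[OF f g kb _ _ t(1) tt]) (use p(1) in linarith)+
    also have "\<dots> \<le> ennreal B * ennreal B + ennreal B * ennreal (\<theta> powr - t * c * \<delta>) + ennreal B * ennreal (\<theta> powr - t * c * \<delta>)"
      unfolding kint by (intro add_mono mult_mono F G) auto
    also have "\<dots> = ennreal (B * B + B * (\<theta> powr - t * c * \<delta>) + B * (\<theta> powr - t * c * \<delta>))"
    proof -
      have "0 \<le> \<theta> powr - t * c * \<delta>" using c \<delta> by simp
      then show ?thesis using B by (metis ennreal_mult ennreal_plus mult_nonneg_nonneg add_nonneg_nonneg)
    qed
    finally have "pair_energy (near r) f g \<le> ennreal \<theta> * ennreal (B * B + B * (\<theta> powr - t * c * \<delta>) + B * (\<theta> powr - t * c * \<delta>))"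
      unfolding E by (rule mult_left_mono) simp
    also have "\<dots> = ennreal (\<theta> * (B * B + B * (\<theta> powr - t * c * \<delta>) + B * (\<theta> powr - t * c * \<delta>)))"
      using \<theta> B c \<delta> by (intro ennreal_mult[symmetric]) (auto intro!: add_nonneg_nonneg mult_nonneg_nonneg)
    also have "\<dots> \<le> ennreal \<epsilon>"
    proof (rule ennreal_leI)
      have 1: "\<theta> * (B * B) \<le> \<epsilon> / 2"
      proof -
        have "\<theta> * (B * B) \<le> \<theta> * (B * B + 1)" using \<theta> by (intro mult_left_mono) auto
        also have "\<dots> = \<epsilon> / 2"
        proof -
          have "B * B + 1 \<noteq> 0" using B by (smt (verit) mult_nonneg_nonneg)
          then show ?thesis unfolding \<theta>_def by (simp add: divide_simps)
        qed
        finally show ?thesis .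
      qed
      have 2: "\<theta> * (2 * B * (\<theta> powr - t * c * \<delta>)) \<le> \<epsilon> / 2"
      proof -
        have "\<theta> * (2 * B * (\<theta> powr - t * c * \<delta>)) = (2 * (\<theta> * \<theta> powr - t) * \<delta>) * (B * c)" by (simp add: mult_ac)
        also have "\<dots> \<le> (2 * (\<theta> * \<theta> powr - t) * \<delta>) * ((B + 1) * (c + 1))"
          using \<theta> \<delta> B c by (intro mult_left_mono mult_mono) auto
        also have "\<dots> = \<epsilon> / 2"
          using \<theta> B c unfolding \<delta>_def by (simp add: divide_simps)
        finally show ?thesis .
      qed
      show "\<theta> * (B * B + B * (\<theta> powr - t * c * \<delta>) + B * (\<theta> powr - t * c * \<delta>)) \<le> \<epsilon>"
        using 1 2 by (simp add: distrib_left mult_ac)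
    qed
    finally show ?thesis .
  qed
  then show ?thesis using that r(1) by blast
qed

section \<open>The best constant\<close>

text \<open>The two bounds are those of the Young exponent \<open>t = p / (2 * (p - 1))\<close>:
  \<open>p < 2\<close> gives \<open>1 \<le> t\<close>, and \<open>6 / 5 < p\<close> gives
  \<open>t < 3\<close>.\<close>

locale polytrope =
  fixes p :: real
  assumes p_gt: "6 / 5 < p" and p_lt: "p < 2"
begin

text \<open>Forced by invariance under dilations: \<open>dilate \<kappa> l\<close> multiplies the
  mass by \<kappa>/l^3, the p-integral by \<kappa>^p/l^3 and D by \<kappa>^2/l^5, hence \<alpha> + p
  \<beta> = 2 and 3 \<alpha> + 3 \<beta> = 5.\<close>

definition \<beta> :: real where "\<beta> = 1 / (3 * (p - 1))"
definition \<alpha> :: real where "\<alpha> = 5 / 3 - \<beta>"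

lemma \<beta>_pos: "0 < \<beta>" using p_gt by (simp add: \<beta>_def)
lemma \<alpha>_pos: "0 < \<alpha>" using p_gt by (simp add: \<alpha>_def \<beta>_def field_simps)
lemma p_\<beta>: "p * \<beta> = \<beta> + 1 / 3" using p_gt by (simp add: \<beta>_def field_simps)
lemma p_\<beta>': "3 * (p - 1) * \<beta> = 1" using p_gt by (simp add: \<beta>_def)

section \<open>Admissible densities and the bilinear form on them\<close>

definition adm :: "(R3 \<Rightarrow> real) \<Rightarrow> bool" where
  "adm f \<longleftrightarrow> nonneg_borel f \<and> integrable lborel f \<and> integrable lborel (\<lambda>x. f x powr p)"

definition mass :: "(R3 \<Rightarrow> real) \<Rightarrow> real" where "mass f = (LINT x|lborel. f x)"
definition pint :: "(R3 \<Rightarrow> real) \<Rightarrow> real" where "pint f = (LINT x|lborel. f x powr p)"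
text \<open>\<open>enn2real\<close> would turn an infinite energy into 0. For admissible densities
  \<open>pair_energy_finite\<close> excludes this, and \<open>ennreal_D\<close> is the way back to
  \<open>pair_energy\<close>.\<close>

definition D :: "(R3 \<Rightarrow> real) \<Rightarrow> (R3 \<Rightarrow> real) \<Rightarrow> real" where "D f g = enn2real (pair_energy newton f g)"

lemma admD: assumes "adm f"
  shows "nonneg_borel f" "f \<in> borel_measurable borel" "0 \<le> f x" "integrable lborel f" "integrable lborel (\<lambda>x. f x powr p)"
  using assms by (auto simp: adm_def nonneg_borel_def)

lemma mass_nonneg: "adm f \<Longrightarrow> 0 \<le> mass f"
  unfolding mass_def by (intro integral_nonneg_AE) (auto simp: admD)

lemma pint_nonneg: "0 \<le> pint f"
  unfolding pint_def by (intro integral_nonneg_AE) auto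

lemma nn_mass: "adm f \<Longrightarrow> (\<integral>\<^sup>+x. ennreal (f x) \<partial>lborel) = ennreal (mass f)"
  unfolding mass_def by (intro nn_integral_eq_integral) (auto simp: admD)

lemma nn_pint: "adm f \<Longrightarrow> (\<integral>\<^sup>+x. ennreal (f x powr p) \<partial>lborel) = ennreal (pint f)"
  unfolding pint_def by (intro nn_integral_eq_integral) (auto simp: admD)

lemma adm_dominated:
  assumes f: "adm f" and g: "g \<in> borel_measurable borel" "\<And>x. 0 \<le> g x" "\<And>x. g x \<le> f x"
  shows "adm g"
proof -
  note [measurable] = g(1)
  have 1: "integrable lborel g"
    by (rule Bochner_Integration.integrable_bound[OF admD(4)[OF f]]) (use g admD(3)[OF f] in \<open>auto simp: abs_of_nonneg\<close>)
  have 2: "integrable lborel (\<lambda>x. g x powr p)"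
    by (rule Bochner_Integration.integrable_bound[OF admD(5)[OF f]]) (use g p_gt in \<open>auto intro!: powr_mono2\<close>)
  show ?thesis using g 1 2 by (auto simp: adm_def nonneg_borel_def)
qed

lemma pint_mono: "adm f \<Longrightarrow> adm g \<Longrightarrow> (\<And>x. g x \<le> f x) \<Longrightarrow> pint g \<le> pint f"
  unfolding pint_def using p_gt by (intro integral_mono) (auto simp: admD intro!: powr_mono2)

lemma mass_mono: "adm f \<Longrightarrow> adm g \<Longrightarrow> (\<And>x. g x \<le> f x) \<Longrightarrow> mass g \<le> mass f"
  unfolding mass_def by (intro integral_mono) (auto simp: admD)

lemma powr_add_le:
  assumes "0 \<le> a" "0 \<le> b" shows "(a + b) powr p \<le> 2 powr p * (a powr p + b powr p)"
proof -
  have "(a + b) powr p \<le> (2 * max a b) powr p" using assms p_gt by (intro powr_mono2) auto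
  also have "\<dots> = 2 powr p * max a b powr p" using assms by (intro powr_mult)
  also have "max a b powr p \<le> a powr p + b powr p" by (auto simp: max_def)
  finally show ?thesis by simp
qed

lemma adm_add:
  assumes f: "adm f" and g: "adm g" shows "adm (\<lambda>x. f x + g x)"
proof -
  note [measurable] = admD(2)[OF f] admD(2)[OF g]
  have "integrable lborel (\<lambda>x. 2 powr p * (f x powr p + g x powr p))"
    using admD(5)[OF f] admD(5)[OF g] by auto
  then have "integrable lborel (\<lambda>x. (f x + g x) powr p)"
    by (rule Bochner_Integration.integrable_bound)
      (use powr_add_le admD(3)[OF f] admD(3)[OF g] in \<open>auto simp: abs_of_nonneg\<close>)
  then show ?thesis using admD[OF f] admD[OF g] by (auto simp: adm_def nonneg_borel_def)
qed

lemma pint_add_le: "adm f \<Longrightarrow> adm g \<Longrightarrow> pint (\<lambda>x. f x + g x) \<le> 2 powr p * (pint f + pint g)"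
proof -
  assume f: "adm f" and g: "adm g"
  have "pint (\<lambda>x. f x + g x) \<le> (LINT x|lborel. 2 powr p * (f x powr p + g x powr p))"
    unfolding pint_def using admD[OF f] admD[OF g] admD(5)[OF adm_add[OF f g]] powr_add_le
    by (intro integral_mono) auto
  also have "\<dots> = 2 powr p * (pint f + pint g)" unfolding pint_def using admD(5)[OF f] admD(5)[OF g] by simp
  finally show ?thesis .
qed

lemma mass_add: "adm f \<Longrightarrow> adm g \<Longrightarrow> mass (\<lambda>x. f x + g x) = mass f + mass g"
  unfolding mass_def by (simp add: admD)

lemma adm_cmult: "adm f \<Longrightarrow> 0 \<le> c \<Longrightarrow> adm (\<lambda>x. c * f x)"
  by (auto simp: adm_def nonneg_borel_def powr_mult)

lemma mass_cmult: "mass (\<lambda>x. c * f x) = c * mass f" by (simp add: mass_def)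

lemma adm_indicator:
  assumes f: "adm f" and S: "S \<in> sets borel" shows "adm (\<lambda>x. f x * indicator S x)"
  by (rule adm_dominated[OF f]) (use admD[OF f] S in \<open>auto simp: indicator_def\<close>)

lemma adm_abs_diff: assumes f: "adm f" and g: "adm g" shows "adm (\<lambda>x. \<bar>f x - g x\<bar>)"
  by (rule adm_dominated[OF adm_add[OF f g]]) (use admD[OF f] admD[OF g] in \<open>auto simp: abs_le_iff\<close>)

lemma pair_energy_newton_le:
  assumes f: "adm f" and g: "adm g" and r: "0 < r"
  shows "pair_energy newton f g \<le> pair_energy (near r) f g + ennreal (mass f * mass g / r)"
proof -
  have "pair_energy newton f g \<le> pair_energy (\<lambda>z. near r z + cutoff r z) f g"
    using r by (intro pair_energy_mono newton_le_near_cutoff admD(3)[OF f] admD(3)[OF g] nonneg_borelD(2)[OF nonneg_borel_newton]) auto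
  also have "\<dots> = pair_energy (near r) f g + pair_energy (cutoff r) f g"
    by (intro pair_energy_add_kernel nonneg_borel_near nonneg_borel_cutoff r admD(1) f g)
  also have "\<dots> \<le> pair_energy (near r) f g + ennreal (1/r) * ((\<integral>\<^sup>+x. ennreal (f x) \<partial>lborel) * (\<integral>\<^sup>+x. ennreal (g x) \<partial>lborel))"
    using r by (intro add_left_mono pair_energy_bounded_kernel admD(1) f g cutoff_le) auto
  also have "ennreal (1/r) * ((\<integral>\<^sup>+x. ennreal (f x) \<partial>lborel) * (\<integral>\<^sup>+x. ennreal (g x) \<partial>lborel)) = ennreal (mass f * mass g / r)"
    using f g r by (simp add: nn_mass ennreal_mult[symmetric] mass_nonneg)
  finally show ?thesis .
qed

lemma pair_energy_finite:
  assumes f: "adm f" and g: "adm g"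
  shows "pair_energy newton f g < \<infinity>"
proof -
  have nn: "0 \<le> max (pint f) (pint g)" using pint_nonneg[of f] by linarith
  obtain r where r: "0 < r"
    "\<And>f' g'. nonneg_borel f' \<Longrightarrow> nonneg_borel g' \<Longrightarrow> (\<integral>\<^sup>+x. ennreal (f' x powr p) \<partial>lborel) \<le> ennreal (max (pint f) (pint g)) \<Longrightarrow>
      (\<integral>\<^sup>+x. ennreal (g' x powr p) \<partial>lborel) \<le> ennreal (max (pint f) (pint g)) \<Longrightarrow> pair_energy (near r) f' g' \<le> ennreal 1"
    using pair_energy_near_small[OF p_gt p_lt zero_less_one nn] by metis
  have "pair_energy (near r) f g \<le> ennreal 1"
    by (intro r(2) admD(1) f g) (auto simp: nn_pint f g intro!: ennreal_leI)
  then have "pair_energy newton f g \<le> ennreal 1 + ennreal (mass f * mass g / r)"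
    using pair_energy_newton_le[OF f g r(1)] add_right_mono order_trans by blast
  also have "\<dots> < \<infinity>" by simp
  finally show ?thesis .
qed

lemma ennreal_D: "adm f \<Longrightarrow> adm g \<Longrightarrow> ennreal (D f g) = pair_energy newton f g"
  unfolding D_def using pair_energy_finite[of f g] by simp

lemma D_nonneg: "0 \<le> D f g" by (simp add: D_def)

lemma newton_minus: "newton (- z) = newton z" by (simp add: newton_def)

lemma D_commute: "adm f \<Longrightarrow> adm g \<Longrightarrow> D f g = D g f"
  unfolding D_def using pair_energy_commute[OF _ _ nonneg_borel_newton newton_minus] admD(1) by metis

lemma D_add_left:
  assumes "adm f" "adm f'" "adm g"
  shows "D (\<lambda>x. f x + f' x) g = D f g + D f' g"
proof -
  have "ennreal (D (\<lambda>x. f x + f' x) g) = ennreal (D f g + D f' g)"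
    using assms adm_add pair_energy_add_left[OF _ _ _ nonneg_borel_newton, of f f' g]
    by (simp add: ennreal_D admD(1) D_nonneg)
  then show ?thesis by (subst (asm) ennreal_inj) (auto simp: D_nonneg)
qed

lemma D_add_right:
  assumes "adm f" "adm f'" "adm g"
  shows "D g (\<lambda>x. f x + f' x) = D g f + D g f'"
  using D_add_left[OF assms] D_commute assms adm_add by metis

lemma D_cmult_left:
  assumes "adm f" "adm g" "0 \<le> c"
  shows "D (\<lambda>x. c * f x) g = c * D f g"
proof -
  have "ennreal (D (\<lambda>x. c * f x) g) = ennreal (c * D f g)"
    using assms adm_cmult pair_energy_cmult_left[OF _ _ nonneg_borel_newton, of f g c]
    by (simp add: ennreal_D admD(1) D_nonneg ennreal_mult)
  then show ?thesis using assms by (simp add: D_nonneg)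
qed

lemma D_cmult_right:
  assumes "adm f" "adm g" "0 \<le> c"
  shows "D g (\<lambda>x. c * f x) = c * D g f"
  using D_cmult_left[OF assms] D_commute assms adm_cmult by metis

lemma D_mono:
  assumes "adm f" "adm g" "adm f'" "adm g'" "\<And>x. f x \<le> f' x" "\<And>x. g x \<le> g' x"
  shows "D f g \<le> D f' g'"
proof -
  have "ennreal (D f g) \<le> ennreal (D f' g')"
    using assms nonneg_borel_newton by (simp add: ennreal_D) (intro pair_energy_mono, auto simp: admD nonneg_borelD)
  then show ?thesis by (simp add: D_nonneg)
qed

lemma D_near_small:
  assumes "0 < \<epsilon>" "0 \<le> B"
  obtains r where "0 < r"
    "\<And>f g. adm f \<Longrightarrow> adm g \<Longrightarrow> pint f \<le> B \<Longrightarrow> pint g \<le> B \<Longrightarrow> pair_energy (near r) f g \<le> ennreal \<epsilon>"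
proof -
  obtain r where r: "0 < r"
    "\<And>f' g'. nonneg_borel f' \<Longrightarrow> nonneg_borel g' \<Longrightarrow> (\<integral>\<^sup>+x. ennreal (f' x powr p) \<partial>lborel) \<le> ennreal B \<Longrightarrow>
      (\<integral>\<^sup>+x. ennreal (g' x powr p) \<partial>lborel) \<le> ennreal B \<Longrightarrow> pair_energy (near r) f' g' \<le> ennreal \<epsilon>"
    using pair_energy_near_small[OF p_gt p_lt assms] by metis
  show ?thesis by (rule that[OF r(1)], rule r(2)) (auto simp: admD nn_pint intro!: ennreal_leI)
qed

lemma D_le_near:
  assumes "0 < \<epsilon>" "0 \<le> B"
  obtains r where "0 < r"
    "\<And>f g. adm f \<Longrightarrow> adm g \<Longrightarrow> pint f \<le> B \<Longrightarrow> pint g \<le> B \<Longrightarrow> D f g \<le> \<epsilon> + mass f * mass g / r"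
proof -
  obtain r where r: "0 < r"
    "\<And>f g. adm f \<Longrightarrow> adm g \<Longrightarrow> pint f \<le> B \<Longrightarrow> pint g \<le> B \<Longrightarrow> pair_energy (near r) f g \<le> ennreal \<epsilon>"
    using D_near_small[OF assms] by metis
  have "D f g \<le> \<epsilon> + mass f * mass g / r" if "adm f" "adm g" "pint f \<le> B" "pint g \<le> B" for f g
  proof -
    have "ennreal (D f g) \<le> pair_energy (near r) f g + ennreal (mass f * mass g / r)"
      using pair_energy_newton_le[OF that(1,2) r(1)] ennreal_D that by simp
    also have "\<dots> \<le> ennreal \<epsilon> + ennreal (mass f * mass g / r)" by (intro add_right_mono r(2) that)
    also have "\<dots> = ennreal (\<epsilon> + mass f * mass g / r)"
      using assms r mass_nonneg that by (intro ennreal_plus[symmetric]) auto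
    finally show ?thesis using assms r mass_nonneg that
      by (subst (asm) ennreal_le_iff) (auto intro!: add_nonneg_nonneg)
  qed
  then show ?thesis using that r(1) by blast
qed

text \<open>The near part is small by the p-integrals alone, whatever the masses. This fixes
  \<open>r\<close>, and the far part is then at most the product of the masses divided by
  \<open>r\<close>. The lemma serves twice: for annuli of small mass, and for passing from L^1
  convergence to convergence of the energy.\<close>

lemma D_small:
  assumes "0 < \<epsilon>" "0 \<le> B"
  obtains \<delta> where "0 < \<delta>"
    "\<And>f g. adm f \<Longrightarrow> adm g \<Longrightarrow> pint f \<le> B \<Longrightarrow> pint g \<le> B \<Longrightarrow> mass f \<le> B \<Longrightarrow> mass g \<le> \<delta> \<Longrightarrow> D f g \<le> \<epsilon>"
proof -
  obtain r where r: "0 < r"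
    "\<And>f g. adm f \<Longrightarrow> adm g \<Longrightarrow> pint f \<le> B \<Longrightarrow> pint g \<le> B \<Longrightarrow> D f g \<le> \<epsilon>/2 + mass f * mass g / r"
    using D_le_near[of "\<epsilon>/2" B] assms by auto
  define \<delta> where "\<delta> = \<epsilon> * r / (2 * (B + 1))"
  have \<delta>: "0 < \<delta>" using assms r by (simp add: \<delta>_def)
  have "D f g \<le> \<epsilon>" if "adm f" "adm g" "pint f \<le> B" "pint g \<le> B" "mass f \<le> B" "mass g \<le> \<delta>" for f g
  proof -
    have "mass f * mass g / r \<le> (B + 1) * \<delta> / r"
      using that r mass_nonneg \<delta> assms by (intro divide_right_mono mult_mono) auto
    also have "\<dots> = \<epsilon> / 2" using r assms unfolding \<delta>_def by (simp add: divide_simps)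
    finally show ?thesis using r(2)[OF that(1-4)] by linarith
  qed
  then show ?thesis using that \<delta> by blast
qed

section \<open>Dilations and the sharp constant\<close>

definition dilate :: "real \<Rightarrow> real \<Rightarrow> (R3 \<Rightarrow> real) \<Rightarrow> R3 \<Rightarrow> real" where
  "dilate \<kappa> l f x = \<kappa> * f (l *\<^sub>R x)"

lemma nn_integral_dilate:
  fixes F :: "R3 \<Rightarrow> ennreal"
  assumes "F \<in> borel_measurable borel" "0 < l"
  shows "(\<integral>\<^sup>+x. F (l *\<^sub>R x) \<partial>lborel) = ennreal (1 / l ^ 3) * (\<integral>\<^sup>+x. F x \<partial>lborel)"
proof -
  have "(\<integral>\<^sup>+x. F x \<partial>lborel) = ennreal (l ^ 3) * (\<integral>\<^sup>+x. F (l *\<^sub>R x) \<partial>lborel)"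
    using nn_integral_lborel_affine[OF assms(1), of l 0] assms by simp
  moreover have "ennreal (1 / l ^ 3) * ennreal (l ^ 3) = 1" using assms by (simp add: ennreal_mult[symmetric])
  ultimately show ?thesis by (simp only: mult.assoc[symmetric] mult_1)
qed

lemma adm_dilate:
  assumes f: "adm f" and \<kappa>: "0 \<le> \<kappa>" and l: "0 < l"
  shows "adm (dilate \<kappa> l f)" "mass (dilate \<kappa> l f) = \<kappa> / l ^ 3 * mass f" "pint (dilate \<kappa> l f) = \<kappa> powr p / l ^ 3 * pint f"
proof -
  note [measurable] = admD(2)[OF f]
  have nb: "nonneg_borel (dilate \<kappa> l f)"
    unfolding nonneg_borel_def dilate_def using admD(3)[OF f] \<kappa> by (auto intro!: mult_nonneg_nonneg)
  note [measurable] = nonneg_borelD(1)[OF nb]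
  have 1: "(\<integral>\<^sup>+x. ennreal (dilate \<kappa> l f x) \<partial>lborel) = ennreal (\<kappa> / l ^ 3 * mass f)"
  proof -
    have "(\<integral>\<^sup>+x. ennreal (dilate \<kappa> l f x) \<partial>lborel) = (\<integral>\<^sup>+x. ennreal \<kappa> * ennreal (f (l *\<^sub>R x)) \<partial>lborel)"
      using \<kappa> admD(3)[OF f] by (simp add: dilate_def ennreal_mult)
    also have "\<dots> = ennreal \<kappa> * (\<integral>\<^sup>+x. ennreal (f (l *\<^sub>R x)) \<partial>lborel)" by (rule nn_integral_cmult) measurable
    also have "(\<integral>\<^sup>+x. ennreal (f (l *\<^sub>R x)) \<partial>lborel) = ennreal (1 / l ^ 3) * ennreal (mass f)"
      using nn_integral_dilate[of "\<lambda>x. ennreal (f x)" l] l nn_mass[OF f] by simp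
    finally show ?thesis using \<kappa> l mass_nonneg[OF f] by (simp add: ennreal_mult[symmetric])
  qed
  have 2: "(\<integral>\<^sup>+x. ennreal (dilate \<kappa> l f x powr p) \<partial>lborel) = ennreal (\<kappa> powr p / l ^ 3 * pint f)"
  proof -
    have "(\<integral>\<^sup>+x. ennreal (dilate \<kappa> l f x powr p) \<partial>lborel) = (\<integral>\<^sup>+x. ennreal (\<kappa> powr p) * ennreal (f (l *\<^sub>R x) powr p) \<partial>lborel)"
      using \<kappa> admD(3)[OF f] by (simp add: dilate_def powr_mult ennreal_mult)
    also have "\<dots> = ennreal (\<kappa> powr p) * (\<integral>\<^sup>+x. ennreal (f (l *\<^sub>R x) powr p) \<partial>lborel)" by (rule nn_integral_cmult) measurable
    also have "(\<integral>\<^sup>+x. ennreal (f (l *\<^sub>R x) powr p) \<partial>lborel) = ennreal (1 / l ^ 3) * ennreal (pint f)"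
      using nn_integral_dilate[of "\<lambda>x. ennreal (f x powr p)" l] l nn_pint[OF f] by simp
    finally show ?thesis using \<kappa> l pint_nonneg by (simp add: ennreal_mult[symmetric])
  qed
  have i1: "integrable lborel (dilate \<kappa> l f)"
    by (rule integrableI_nn_integral_finite[OF _ _ 1]) (use nb \<kappa> l mass_nonneg[OF f] in \<open>auto simp: nonneg_borelD\<close>)
  have i2: "integrable lborel (\<lambda>x. dilate \<kappa> l f x powr p)"
    by (rule integrableI_nn_integral_finite[OF _ _ 2]) (use \<kappa> l pint_nonneg in \<open>auto simp: nonneg_borelD\<close>)
  show a: "adm (dilate \<kappa> l f)" using nb i1 i2 by (simp add: adm_def)
  show "mass (dilate \<kappa> l f) = \<kappa> / l ^ 3 * mass f"
    using 1 nn_mass[OF a] \<kappa> l mass_nonneg[OF f] mass_nonneg[OF a] by simp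
  show "pint (dilate \<kappa> l f) = \<kappa> powr p / l ^ 3 * pint f"
    using 2 nn_pint[OF a] \<kappa> l pint_nonneg[of f] pint_nonneg[of "dilate \<kappa> l f"] by simp
qed

text \<open>The power 5 is 3 + 3 from the two integrations minus 1 from the homogeneity of the
  kernel.\<close>

lemma D_dilate:
  assumes f: "adm f" and \<kappa>: "0 \<le> \<kappa>" and l: "0 < l"
  shows "D (dilate \<kappa> l f) (dilate \<kappa> l f) = \<kappa>\<^sup>2 / l ^ 5 * D f f"
proof -
  note [measurable] = admD(2)[OF f] nonneg_borelD(1)[OF nonneg_borel_newton]
  have nn: "0 \<le> f x" "0 \<le> newton x" for x using admD(3)[OF f] nonneg_borelD(2)[OF nonneg_borel_newton] by auto
  have nl: "newton (x - y) = l * newton (l *\<^sub>R x - l *\<^sub>R y)" for x y :: R3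
    using l by (simp add: newton_def scaleR_diff_right[symmetric])
  have "pair_energy newton (dilate \<kappa> l f) (dilate \<kappa> l f)
      = (\<integral>\<^sup>+x. (\<integral>\<^sup>+y. ennreal (\<kappa>\<^sup>2 * l) * ennreal (f (l *\<^sub>R x) * f (l *\<^sub>R y) * newton (l *\<^sub>R x - l *\<^sub>R y)) \<partial>lborel) \<partial>lborel)"
    unfolding pair_energy_def
  proof (intro nn_integral_cong)
    fix x y
    have "dilate \<kappa> l f x * dilate \<kappa> l f y * newton (x - y)
      = \<kappa>\<^sup>2 * l * (f (l *\<^sub>R x) * f (l *\<^sub>R y) * newton (l *\<^sub>R x - l *\<^sub>R y))"
      unfolding dilate_def nl[of x y] by (simp add: power2_eq_square)
    then show "ennreal (dilate \<kappa> l f x * dilate \<kappa> l f y * newton (x - y))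
      = ennreal (\<kappa>\<^sup>2 * l) * ennreal (f (l *\<^sub>R x) * f (l *\<^sub>R y) * newton (l *\<^sub>R x - l *\<^sub>R y))"
      using \<kappa> l nn by (simp add: ennreal_mult)
  qed
  also have "\<dots> = (\<integral>\<^sup>+x. ennreal (\<kappa>\<^sup>2 * l) * (\<integral>\<^sup>+y. ennreal (f (l *\<^sub>R x) * f (l *\<^sub>R y) * newton (l *\<^sub>R x - l *\<^sub>R y)) \<partial>lborel) \<partial>lborel)"
    by (intro nn_integral_cong nn_integral_cmult) measurable
  also have "\<dots> = (\<integral>\<^sup>+x. ennreal (\<kappa>\<^sup>2 * l) * (ennreal (1 / l ^ 3) * (\<integral>\<^sup>+y. ennreal (f (l *\<^sub>R x) * f y * newton (l *\<^sub>R x - y)) \<partial>lborel)) \<partial>lborel)"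
  proof (rule nn_integral_cong)
    fix x
    show "ennreal (\<kappa>\<^sup>2 * l) * (\<integral>\<^sup>+y. ennreal (f (l *\<^sub>R x) * f (l *\<^sub>R y) * newton (l *\<^sub>R x - l *\<^sub>R y)) \<partial>lborel)
      = ennreal (\<kappa>\<^sup>2 * l) * (ennreal (1 / l ^ 3) * (\<integral>\<^sup>+y. ennreal (f (l *\<^sub>R x) * f y * newton (l *\<^sub>R x - y)) \<partial>lborel))"
      using l by (subst nn_integral_dilate[where F = "\<lambda>y. ennreal (f (l *\<^sub>R x) * f y * newton (l *\<^sub>R x - y))"]) auto
  qed
  also have "\<dots> = (\<integral>\<^sup>+x. ennreal (\<kappa>\<^sup>2 * l / l ^ 3) * (\<integral>\<^sup>+y. ennreal (f (l *\<^sub>R x) * f y * newton (l *\<^sub>R x - y)) \<partial>lborel) \<partial>lborel)"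
    using l by (simp add: mult.assoc[symmetric] ennreal_mult[symmetric])
  also have "\<dots> = ennreal (\<kappa>\<^sup>2 * l / l ^ 3) * (\<integral>\<^sup>+x. (\<integral>\<^sup>+y. ennreal (f (l *\<^sub>R x) * f y * newton (l *\<^sub>R x - y)) \<partial>lborel) \<partial>lborel)"
    by (rule nn_integral_cmult) measurable
  also have "(\<integral>\<^sup>+x. (\<integral>\<^sup>+y. ennreal (f (l *\<^sub>R x) * f y * newton (l *\<^sub>R x - y)) \<partial>lborel) \<partial>lborel)
      = ennreal (1 / l ^ 3) * pair_energy newton f f"
    unfolding pair_energy_def
    using l by (subst nn_integral_dilate[where F = "\<lambda>x. (\<integral>\<^sup>+y. ennreal (f x * f y * newton (x - y)) \<partial>lborel)"]) auto
  finally have "ennreal (D (dilate \<kappa> l f) (dilate \<kappa> l f)) = ennreal (\<kappa>\<^sup>2 * l / l ^ 3 * (1 / l ^ 3) * D f f)"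
    using l f adm_dilate(1)[OF assms] D_nonneg[of f f] by (simp add: ennreal_D[symmetric] ennreal_mult[symmetric] mult.assoc[symmetric])
  also have "\<kappa>\<^sup>2 * l / l ^ 3 * (1 / l ^ 3) = \<kappa>\<^sup>2 / l ^ 5" using l by (simp add: divide_simps) (simp add: eval_nat_numeral)
  finally show ?thesis using l D_nonneg[of f f] D_nonneg[of "dilate \<kappa> l f" "dilate \<kappa> l f"] by simp
qed

lemma pint_pos:
  assumes f: "adm f" and m: "0 < mass f" shows "0 < pint f"
proof (rule ccontr)
  assume "\<not> 0 < pint f"
  then have "pint f = 0" using pint_nonneg[of f] by linarith
  then have "AE x in lborel. f x powr p = 0"
    unfolding pint_def by (subst (asm) integral_nonneg_eq_0_iff_AE) (auto simp: admD f)
  then have "AE x in lborel. f x = 0" by eventually_elim auto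
  then have "mass f = 0" unfolding mass_def by (intro integral_eq_zero_AE)
  with m show False by simp
qed

lemma D_zero_mass: assumes f: "adm f" and m: "mass f = 0" shows "D f g = 0"
proof -
  have "AE x in lborel. f x = 0"
    using m unfolding mass_def by (subst (asm) integral_nonneg_eq_0_iff_AE) (auto simp: admD f)
  then have "AE x in lborel. (\<integral>\<^sup>+y. ennreal (f x * g y * newton (x - y)) \<partial>lborel) = 0"
    by eventually_elim simp
  then have "pair_energy newton f g = (\<integral>\<^sup>+(x::R3). 0 \<partial>lborel)"
    unfolding pair_energy_def by (rule nn_integral_cong_AE)
  then show ?thesis by (simp add: D_def)
qed

text \<open>Two dilation parameters suffice to normalise the mass and the p-integral at once, so a
  supremum over normalised densities is the sharp constant. As \<open>Sup\<close> is taken in the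
  reals, the bound from \<open>D_le_near\<close> is what gives it meaning.\<close>

definition best :: real where "best = Sup {D f f |f. adm f \<and> mass f = 1 \<and> pint f = 1}"

lemma best_upper: assumes "adm f" "mass f = 1" "pint f = 1" shows "D f f \<le> best"
proof -
  obtain r where r: "0 < r"
    "\<And>f g. adm f \<Longrightarrow> adm g \<Longrightarrow> pint f \<le> 1 \<Longrightarrow> pint g \<le> 1 \<Longrightarrow> D f g \<le> 1 + mass f * mass g / r"
    using D_le_near[of 1 1] by auto
  have "bdd_above {D f f |f. adm f \<and> mass f = 1 \<and> pint f = 1}"
    by (rule bdd_aboveI[of _ "1 + 1 / r"]) (use r(2) in fastforce)
  then show ?thesis unfolding best_def using assms by (intro cSup_upper) auto
qed

lemma cube_powr: assumes "0 < l" shows "(l ^ 3) powr p / l ^ 3 = l powr (3 * (p - 1))"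
proof -
  have "(l ^ 3) powr p = (l powr 3) powr p" using assms by simp
  also have "\<dots> = l powr (3 * p)" by (rule powr_powr)
  finally have "(l ^ 3) powr p / l ^ 3 = l powr (3 * p) / l powr 3" using assms by simp
  also have "\<dots> = l powr (3 * p - 3)" by (rule powr_diff[symmetric])
  finally show ?thesis by (simp add: algebra_simps)
qed

lemma normalize:
  assumes f: "adm f" and m: "0 < mass f"
  obtains g where "adm g" "mass g = 1" "pint g = 1" "D f f = D g g * mass f powr \<alpha> * pint f powr \<beta>"
proof -
  have X: "0 < pint f" by (rule pint_pos[OF assms])
  \<comment> \<open>Mass 1 forces \<open>\<kappa> = l ^ 3 / mass f\<close>. The p-integral becomes
    \<open>l powr (3 * (p - 1)) * pint f / mass f powr p\<close>, and setting it to 1 determines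
    \<open>l\<close>, because \<open>\<beta> = 1 / (3 * (p - 1))\<close>.\<close>
  define l where "l = (mass f powr p / pint f) powr \<beta>"
  define \<kappa> where "\<kappa> = l ^ 3 / mass f"
  have l: "0 < l" using m X by (simp add: l_def)
  have \<kappa>: "0 < \<kappa>" using m l by (simp add: \<kappa>_def)
  let ?g = "dilate \<kappa> l f"
  have 1: "mass ?g = 1" using adm_dilate(2)[OF f, of \<kappa> l] l \<kappa> m by (simp add: \<kappa>_def)
  have "\<kappa> powr p / l ^ 3 = l powr (3 * (p - 1)) / mass f powr p"
    unfolding \<kappa>_def cube_powr[OF l, symmetric] using l m by (simp add: powr_divide)
  also have "l powr (3 * (p - 1)) = mass f powr p / pint f"
    unfolding l_def using p_\<beta>' m X by (simp add: powr_powr mult.commute)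
  finally have "\<kappa> powr p / l ^ 3 = 1 / pint f" using m by simp
  then have 2: "pint ?g = 1" using adm_dilate(3)[OF f, of \<kappa> l] l \<kappa> X by simp
  have "D ?g ?g = \<kappa>\<^sup>2 / l ^ 5 * D f f" using D_dilate[OF f, of \<kappa> l] l \<kappa> by simp
  also have "\<kappa>\<^sup>2 / l ^ 5 = l / (mass f)\<^sup>2"
    unfolding \<kappa>_def using l by (simp add: power_divide divide_simps) (simp add: eval_nat_numeral)
  finally have D: "D f f = D ?g ?g * ((mass f)\<^sup>2 / l)" using l m by simp
  have "(mass f)\<^sup>2 / l = mass f powr 2 / (mass f powr (p * \<beta>) / pint f powr \<beta>)"
    unfolding l_def using m X by (simp add: powr_divide powr_powr)
  also have "\<dots> = mass f powr (2 - p * \<beta>) * pint f powr \<beta>" using m X by (simp add: powr_diff)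
  also have "2 - p * \<beta> = \<alpha>" using p_\<beta> by (simp add: \<alpha>_def)
  finally have "D f f = D ?g ?g * mass f powr \<alpha> * pint f powr \<beta>" using D by simp
  then show ?thesis using that adm_dilate(1)[OF f, of \<kappa> l] 1 2 \<kappa> l by auto
qed

lemma D_le_best: assumes f: "adm f" shows "D f f \<le> best * (mass f powr \<alpha> * pint f powr \<beta>)"
proof (cases "mass f = 0")
  case True
  then show ?thesis using D_zero_mass[OF f] by simp
next
  case False
  then have m: "0 < mass f" using mass_nonneg[OF f] by simp
  obtain g where g: "adm g" "mass g = 1" "pint g = 1" "D f f = D g g * mass f powr \<alpha> * pint f powr \<beta>"
    using normalize[OF f m] .
  show ?thesis using best_upper[OF g(1-3)] unfolding g(4) mult.assoc by (intro mult_right_mono) auto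
qed

text \<open>The kernel is positive off the diagonal, so zero energy together with a single typical
  point where \<open>f\<close> is positive would make \<open>f\<close> vanish almost
  everywhere.\<close>

lemma D_pos: assumes f: "adm f" and m: "0 < mass f" shows "0 < D f f"
proof (rule ccontr)
  assume "\<not> 0 < D f f"
  then have "D f f = 0" using D_nonneg[of f f] by linarith
  note [measurable] = admD(2)[OF f] nonneg_borelD(1)[OF nonneg_borel_newton]
  from \<open>D f f = 0\<close> have "pair_energy newton f f = 0" using ennreal_D[OF f f] by simp
  then have "AE x in lborel. (\<integral>\<^sup>+y. ennreal (f x * f y * newton (x - y)) \<partial>lborel) = 0"
    unfolding pair_energy_def by (subst (asm) nn_integral_0_iff_AE) auto
  then have *: "AE x in lborel. AE y in lborel. ennreal (f x * f y * newton (x - y)) = 0"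
    by eventually_elim (subst (asm) nn_integral_0_iff_AE, auto)
  have "AE x in lborel. f x = 0"
    using *
  proof eventually_elim
    case (elim x)
    show "f x = 0"
    proof (rule ccontr)
      assume fx: "f x \<noteq> 0"
      have "AE y in lborel. f y = 0" using elim AE_lborel_singleton[of x]
      proof eventually_elim
        case (elim y)
        have "0 < newton (x - y)" using elim by (simp add: newton_def)
        moreover have "f x * f y * newton (x - y) \<le> 0" using elim by (simp add: ennreal_eq_0_iff)
        ultimately show "f y = 0" using fx admD(3)[OF f, of x] admD(3)[OF f, of y]
          by (auto simp: mult_le_0_iff)
      qed
      then have "mass f = 0" unfolding mass_def by (intro integral_eq_zero_AE)
      with m show False by simp
    qed
  qed
  then have "mass f = 0" unfolding mass_def by (intro integral_eq_zero_AE)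
  with m show False by simp
qed

lemma best_pos: assumes f: "adm f" and m: "0 < mass f" shows "0 < best"
proof -
  have "0 < best * (mass f powr \<alpha> * pint f powr \<beta>)" using D_pos[OF assms] D_le_best[OF f] by linarith
  moreover have "0 < mass f powr \<alpha> * pint f powr \<beta>" using m pint_pos[OF assms] by simp
  ultimately show ?thesis by (simp add: zero_less_mult_iff)
qed

text \<open>Inverse of the normalisation, with the value of \<open>pint f powr \<beta>\<close> at
  free disposal. It supplies the trial densities that identify the infimum of the energy.\<close>

lemma rescale:
  assumes g: "adm g" "mass g = 1" "pint g = 1" and M: "0 < M" and t: "0 < t"
  obtains f where "adm f" "mass f = M" "pint f powr \<beta> = t" "D f f = M powr \<alpha> * t * D g g"
proof -
  \<comment> \<open>The factor \<open>M * l ^ 3\<close> gives mass \<open>M\<close> and multiplies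
    the energy by \<open>M\<^sup>2 * l\<close>. Since \<open>2 - p * \<beta> = \<alpha>\<close>,
    this is \<open>M powr \<alpha> * t\<close> for the present \<open>l\<close>.\<close>
  define l where "l = t / M powr (p * \<beta>)"
  have l: "0 < l" using M t by (simp add: l_def)
  let ?f = "dilate (M * l ^ 3) l g"
  have \<kappa>: "0 \<le> M * l ^ 3" using M l by simp
  have 1: "adm ?f" by (rule adm_dilate(1)[OF g(1) \<kappa> l])
  have 2: "mass ?f = M" using adm_dilate(2)[OF g(1) \<kappa> l] g l by simp
  have "(M * l ^ 3) powr p / l ^ 3 = M powr p * l powr (3 * (p - 1))"
    unfolding cube_powr[OF l, symmetric] using l M by (simp add: powr_mult)
  then have "pint ?f powr \<beta> = (M powr p * l powr (3 * (p - 1))) powr \<beta>"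
    using adm_dilate(3)[OF g(1) \<kappa> l] g by simp
  also have "\<dots> = M powr (p * \<beta>) * l powr (3 * (p - 1) * \<beta>)" by (simp add: powr_mult powr_powr)
  also have "\<dots> = t" using l M t unfolding p_\<beta>' by (simp add: l_def)
  finally have 3: "pint ?f powr \<beta> = t" .
  have "D ?f ?f = (M * l ^ 3)\<^sup>2 / l ^ 5 * D g g" by (rule D_dilate[OF g(1) \<kappa> l])
  also have "(M * l ^ 3)\<^sup>2 / l ^ 5 = M\<^sup>2 * l" using l by (simp add: divide_simps power_mult_distrib) (simp add: eval_nat_numeral)
  also have "M\<^sup>2 * l = M powr (2 - p * \<beta>) * t" using M by (simp add: l_def powr_diff)
  also have "2 - p * \<beta> = \<alpha>" using p_\<beta> by (simp add: \<alpha>_def)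
  finally show ?thesis using that[OF 1 2 3] by simp
qed

end

section \<open>Tightness up to translation\<close>

lemma lborel_translate:
  fixes g :: "R3 \<Rightarrow> 'b::{banach, second_countable_topology}"
  assumes [measurable]: "g \<in> borel_measurable borel"
  shows "integrable lborel (\<lambda>x. g (x - a)) \<longleftrightarrow> integrable lborel g"
    and "(LINT x|lborel. g (x - a)) = (LINT x|lborel. g x)"
proof -
  have d: "distr lborel borel (\<lambda>x. x - a) = (lborel :: R3 measure)"
    using lborel_distr_plus[of "- a"] by (simp add: add.commute[of "- a"] cong: distr_cong)
  have "integrable (distr lborel borel (\<lambda>x. x - a)) g \<longleftrightarrow> integrable lborel (\<lambda>x. g (x - a))"
    by (rule integrable_distr_eq) auto
  then show "integrable lborel (\<lambda>x. g (x - a)) \<longleftrightarrow> integrable lborel g" by (simp add: d)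
  have "(LINT x|distr lborel borel (\<lambda>x. x - a). g x) = (LINT x|lborel. g (x - a))"
    by (rule integral_distr) auto
  then show "(LINT x|lborel. g (x - a)) = (LINT x|lborel. g x)" by (simp add: d)
qed

definition restr :: "R3 set \<Rightarrow> (R3 \<Rightarrow> real) \<Rightarrow> R3 \<Rightarrow> real" where
  "restr S f x = f x * indicator S x"

definition shift :: "R3 \<Rightarrow> (R3 \<Rightarrow> real) \<Rightarrow> R3 \<Rightarrow> real" where
  "shift a f x = f (x - a)"

context polytrope
begin

lemma adm_restr: "adm f \<Longrightarrow> S \<in> sets borel \<Longrightarrow> adm (restr S f)"
  using adm_indicator[of f S] by (simp add: restr_def[abs_def])

lemma mass_restr_le: "adm f \<Longrightarrow> S \<in> sets borel \<Longrightarrow> mass (restr S f) \<le> mass f"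
  by (intro mass_mono adm_restr) (auto simp: restr_def indicator_def admD)

lemma mass_restr_mono:
  "adm f \<Longrightarrow> S \<in> sets borel \<Longrightarrow> T \<in> sets borel \<Longrightarrow> S \<subseteq> T \<Longrightarrow> mass (restr S f) \<le> mass (restr T f)"
  by (intro mass_mono adm_restr) (auto simp: restr_def indicator_def admD)

lemma pint_restr_le: "adm f \<Longrightarrow> S \<in> sets borel \<Longrightarrow> pint (restr S f) \<le> pint f"
  by (intro pint_mono adm_restr) (auto simp: restr_def indicator_def admD)

lemma mass_restr_union:
  assumes "adm f" "S \<in> sets borel" "T \<in> sets borel" "S \<inter> T = {}"
  shows "mass (restr (S \<union> T) f) = mass (restr S f) + mass (restr T f)"
proof -
  have "restr (S \<union> T) f = (\<lambda>x. restr S f x + restr T f x)"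
    using assms(4) by (auto simp: restr_def indicator_def fun_eq_iff)
  then show ?thesis using mass_add adm_restr assms by simp
qed

lemma pint_restr_union:
  assumes "adm f" "S \<in> sets borel" "T \<in> sets borel" "S \<inter> T = {}"
  shows "pint (restr (S \<union> T) f) = pint (restr S f) + pint (restr T f)"
proof -
  have "restr (S \<union> T) f x powr p = restr S f x powr p + restr T f x powr p" for x
    using assms(4) by (auto simp: restr_def indicator_def fun_eq_iff)
  then show ?thesis using adm_restr[OF assms(1)] assms by (simp add: pint_def admD)
qed

lemma restr_UNIV: "restr UNIV f = f" by (simp add: restr_def fun_eq_iff)

lemma mass_restr_compl: "adm f \<Longrightarrow> S \<in> sets borel \<Longrightarrow> mass (restr (- S) f) = mass f - mass (restr S f)"
  using mass_restr_union[of f S "- S"] by (simp add: restr_UNIV)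

lemma pint_restr_compl: "adm f \<Longrightarrow> S \<in> sets borel \<Longrightarrow> pint (restr (- S) f) = pint f - pint (restr S f)"
  using pint_restr_union[of f S "- S"] by (simp add: restr_UNIV)

lemma adm_shift:
  assumes f: "adm f"
  shows "adm (shift a f)" "mass (shift a f) = mass f" "pint (shift a f) = pint f"
proof -
  note [measurable] = admD(2)[OF f]
  have m: "(\<lambda>x. f x powr p) \<in> borel_measurable borel" by measurable
  have nb: "nonneg_borel (shift a f)"
    unfolding nonneg_borel_def shift_def using admD(3)[OF f] by auto
  show "adm (shift a f)"
    using nb lborel_translate(1)[OF admD(2)[OF f], of a] lborel_translate(1)[OF m, of a] admD[OF f]
    by (simp add: adm_def shift_def[abs_def])
  show "mass (shift a f) = mass f" "pint (shift a f) = pint f"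
    using lborel_translate(2)[OF admD(2)[OF f], of a] lborel_translate(2)[OF m, of a]
    by (simp_all add: mass_def pint_def shift_def)
qed

lemma D_shift: assumes f: "adm f" and g: "adm g" shows "D (shift a f) (shift a g) = D f g"
proof -
  note [measurable] = admD(2)[OF f] admD(2)[OF g] nonneg_borelD(1)[OF nonneg_borel_newton]
  have "pair_energy newton (shift a f) (shift a g)
      = (\<integral>\<^sup>+x. (\<integral>\<^sup>+y. ennreal (f (x - a) * g (y - a) * newton ((x - a) - (y - a))) \<partial>lborel) \<partial>lborel)"
    unfolding pair_energy_def shift_def by simp
  also have "\<dots> = (\<integral>\<^sup>+x. (\<integral>\<^sup>+y. ennreal (f (x - a) * g y * newton ((x - a) - y)) \<partial>lborel) \<partial>lborel)"
    by (intro nn_integral_cong nn_integral_lborel_translate[where F = "\<lambda>y. ennreal (f (x - a) * g y * newton ((x - a) - y))" for x]) auto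
  also have "\<dots> = pair_energy newton f g"
    unfolding pair_energy_def
    by (rule nn_integral_lborel_translate[where F = "\<lambda>x. (\<integral>\<^sup>+y. ennreal (f x * g y * newton (x - y)) \<partial>lborel)"]) auto
  finally show ?thesis by (simp add: D_def)
qed

text \<open>With \<open>u = (m\<^sub>1/M)\<^bsup>3\<alpha>/5\<^esup>(x\<^sub>1/X)\<^bsup>3\<beta>/5\<^esup>\<close> and its analogue \<open>v\<close>, Young gives \<open>u + v \<le> 1\<close>, because the two exponents add up to 1;
  the left-hand side is a multiple of \<open>u\<^bsup>5/3\<^esup> + v\<^bsup>5/3\<^esup> \<le> (max u v)\<^bsup>2/3\<^esup>\<close>.\<close>

lemma split_inequality:
  fixes m1 m3 x1 x3 M X \<delta> :: real
  assumes m: "0 \<le> m1" "0 \<le> m3" "m1 + m3 \<le> M" and x: "0 \<le> x1" "0 \<le> x3" "x1 + x3 \<le> X"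
    and pos: "0 < M" "0 < X" and \<delta>: "\<delta> \<le> m1" "m1 \<le> M - \<delta>" "0 < \<delta>"
  shows "m1 powr \<alpha> * x1 powr \<beta> + m3 powr \<alpha> * x3 powr \<beta> \<le> (1 - \<delta> / M) powr (2 * \<alpha> / 5) * (M powr \<alpha> * X powr \<beta>)"
proof -
  define a b where "a = 3 * \<alpha> / 5" and "b = 3 * \<beta> / 5"
  have ab: "0 < a" "0 < b" "a + b = 1" using \<alpha>_pos \<beta>_pos by (auto simp: a_def b_def \<alpha>_def diff_divide_distrib)
  define \<theta> where "\<theta> = (1 - \<delta> / M) powr a"
  define w where "w = (\<lambda>m x. (m / M) powr a * (x / X) powr b)"
  have young: "u powr a * y powr b \<le> a * u + b * y" if "0 \<le> u" "0 \<le> y" for u y :: real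
  proof (cases "u = 0 \<or> y = 0")
    case True
    then show ?thesis using that ab by auto
  next
    case False
    then show ?thesis using that ab by (intro Youngs_inequality_0) auto
  qed
  have sum: "w m1 x1 + w m3 x3 \<le> 1"
  proof -
    have "w m1 x1 + w m3 x3 \<le> (a * (m1/M) + b * (x1/X)) + (a * (m3/M) + b * (x3/X))"
      unfolding w_def using m x pos by (intro add_mono young) auto
    also have "\<dots> = a * ((m1 + m3) / M) + b * ((x1 + x3) / X)" by (simp add: add_divide_distrib distrib_left)
    also have "\<dots> \<le> a * 1 + b * 1" using ab m x pos by (intro add_mono mult_left_mono) auto
    finally show ?thesis using ab by simp
  qed
  have le: "w m y \<le> \<theta>" if "0 \<le> m" "0 \<le> y" "m \<le> M - \<delta>" "y \<le> X" for m y
  proof -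
    have "m / M \<le> 1 - \<delta> / M" using that pos by (simp add: field_simps)
    then have "(m / M) powr a \<le> \<theta>" unfolding \<theta>_def using that pos ab by (intro powr_mono2) auto
    moreover have "(y / X) powr b \<le> 1 powr b" using that pos ab by (intro powr_mono2) auto
    ultimately have "w m y \<le> \<theta> * 1" unfolding w_def by (intro mult_mono) (auto simp: \<theta>_def)
    then show ?thesis by simp
  qed
  have eq: "m powr \<alpha> * y powr \<beta> = M powr \<alpha> * X powr \<beta> * w m y powr (5/3)" if "0 \<le> m" "0 \<le> y" for m y
  proof -
    have "w m y powr (5/3) = (m / M) powr \<alpha> * (y / X) powr \<beta>"
      unfolding w_def using that pos by (simp add: powr_mult powr_powr a_def b_def)
    then show ?thesis using that pos by (simp add: powr_divide)
  qed
  have p53: "v powr (5/3) \<le> \<theta> powr (2/3) * v" if "0 \<le> v" "v \<le> \<theta>" for v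
  proof -
    have "v powr (5/3) = v powr (2/3 + 1)" by simp
    also have "\<dots> = v powr (2/3) * v" using that by (simp only: powr_add) simp
    also have "\<dots> \<le> \<theta> powr (2/3) * v" using that by (intro mult_right_mono powr_mono2) auto
    finally show ?thesis .
  qed
  have wnn: "0 \<le> w m y" for m y by (simp add: w_def)
  have "w m1 x1 powr (5/3) + w m3 x3 powr (5/3) \<le> \<theta> powr (2/3) * w m1 x1 + \<theta> powr (2/3) * w m3 x3"
    using assms by (intro add_mono p53 wnn le) auto
  also have "\<dots> = \<theta> powr (2/3) * (w m1 x1 + w m3 x3)" by (simp add: distrib_left)
  also have "\<dots> \<le> \<theta> powr (2/3) * 1" using sum by (intro mult_left_mono) auto
  also have "\<dots> = (1 - \<delta> / M) powr (2 * \<alpha> / 5)" by (simp add: \<theta>_def powr_powr a_def)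
  finally have "M powr \<alpha> * X powr \<beta> * (w m1 x1 powr (5/3) + w m3 x3 powr (5/3)) \<le> M powr \<alpha> * X powr \<beta> * (1 - \<delta> / M) powr (2 * \<alpha> / 5)"
    by (intro mult_left_mono) auto
  then show ?thesis unfolding eq[OF m(1) x(1)] eq[OF m(2) x(2)] distrib_left[symmetric] by (simp only: mult.commute)
qed

lemma D_separated:
  assumes f: "adm f" and g: "adm g" and d: "0 < d"
    and sep: "\<And>x y. f x \<noteq> 0 \<Longrightarrow> g y \<noteq> 0 \<Longrightarrow> d \<le> norm (x - y)"
  shows "D f g \<le> mass f * mass g / d"
proof -
  have "pair_energy newton f g \<le> pair_energy (cutoff d) f g"
    unfolding pair_energy_def
  proof (intro nn_integral_mono ennreal_leI)
    fix x y
    show "f x * g y * newton (x - y) \<le> f x * g y * cutoff d (x - y)"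
    proof (cases "f x = 0 \<or> g y = 0")
      case False
      then have "newton (x - y) = cutoff d (x - y)" using sep[of x y] by (simp add: newton_def cutoff_def max_def)
      then show ?thesis by simp
    qed auto
  qed
  also have "\<dots> \<le> ennreal (1/d) * ((\<integral>\<^sup>+x. ennreal (f x) \<partial>lborel) * (\<integral>\<^sup>+x. ennreal (g x) \<partial>lborel))"
    using d by (intro pair_energy_bounded_kernel admD(1) f g cutoff_le) auto
  also have "\<dots> = ennreal (mass f * mass g / d)"
    using f g d by (simp add: nn_mass ennreal_mult[symmetric] mass_nonneg)
  finally have "ennreal (D f g) \<le> ennreal (mass f * mass g / d)" using ennreal_D[OF f g] by simp
  then show ?thesis using d mass_nonneg[OF f] mass_nonneg[OF g] by (subst (asm) ennreal_le_iff) auto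
qed

text \<open>The density is cut into an inner ball, an annulus and an exterior part. The
  self-energies of inner and exterior part fall under \<open>split_inequality\<close>, their
  interaction is weak because they are \<open>K2 - K1\<close> apart, and every term containing the
  annulus is absorbed into twice its interaction with \<open>f\<close>.\<close>

lemma D_split:
  fixes K1 K2 :: real
  assumes f: "adm f" and M: "mass f = M" "0 < M" and K: "K1 < K2"
    and \<delta>: "0 < \<delta>" "\<delta> \<le> mass (restr (ball 0 K1) f)" "mass (restr (ball 0 K1) f) \<le> M - \<delta>"
  shows "D f f \<le> best * ((1 - \<delta> / M) powr (2 * \<alpha> / 5) * (M powr \<alpha> * pint f powr \<beta>)) + 2 * M\<^sup>2 / (K2 - K1)
     + 2 * D f (restr (ball 0 K2 - ball 0 K1) f)"
proof -
  let ?f1 = "restr (ball 0 K1) f" and ?f2 = "restr (ball 0 K2 - ball 0 K1) f" and ?f3 = "restr (- ball 0 K2) f"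
  have sub: "ball 0 K1 \<subseteq> ball (0::R3) K2" using K by auto
  have a: "adm ?f1" "adm ?f2" "adm ?f3" by (auto intro!: adm_restr f)
  have a13: "adm (\<lambda>x. ?f1 x + ?f3 x)" by (intro adm_add a)
  have X: "0 < pint f" using pint_pos f M by simp
  have fe: "f = (\<lambda>x. (?f1 x + ?f3 x) + ?f2 x)"
    using sub by (auto simp: restr_def indicator_def fun_eq_iff)
  let ?h = "\<lambda>x. ?f1 x + ?f3 x"
  have le: "?h x \<le> f x" "?f1 x \<le> f x" "?f3 x \<le> f x" for x
    using admD(3)[OF f, of x] sub by (auto simp: restr_def indicator_def)
  have "D f f = D ?h f + D ?f2 f" by (subst (1) fe) (rule D_add_left[OF a13 a(2) f])
  also have "D ?h f = D ?h ?h + D ?h ?f2" by (subst (1) fe) (rule D_add_right[OF a13 a(2) a13])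
  also have "D ?h ?h = D ?f1 ?h + D ?f3 ?h" by (rule D_add_left[OF a(1,3) a13])
  also have "D ?f1 ?h = D ?f1 ?f1 + D ?f1 ?f3" by (rule D_add_right[OF a(1,3) a(1)])
  also have "D ?f3 ?h = D ?f3 ?f1 + D ?f3 ?f3" by (rule D_add_right[OF a(1,3) a(3)])
  finally have e: "D f f = D ?f1 ?f1 + D ?f3 ?f3 + 2 * D ?f1 ?f3 + D ?h ?f2 + D ?f2 f"
    using D_commute[OF a(1,3)] by simp
  have 1: "D ?h ?f2 \<le> D f ?f2" by (intro D_mono a13 a f le) auto
  have 2: "D ?f2 f = D f ?f2" by (rule D_commute[OF a(2) f])
  have 3: "D ?f1 ?f3 \<le> M\<^sup>2 / (K2 - K1)"
  proof -
    have "D ?f1 ?f3 \<le> mass ?f1 * mass ?f3 / (K2 - K1)"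
    proof (rule D_separated[OF a(1,3)])
      fix x y assume "?f1 x \<noteq> 0" "?f3 y \<noteq> 0"
      then have "norm x < K1" "K2 \<le> norm y" by (auto simp: restr_def indicator_def split: if_splits)
      then show "K2 - K1 \<le> norm (x - y)" using norm_triangle_ineq3[of x y] by linarith
    qed (use K in auto)
    also have "\<dots> \<le> M * M / (K2 - K1)"
      using K mass_restr_le[OF f] M mass_nonneg a by (intro divide_right_mono mult_mono) auto
    finally show ?thesis by (simp add: power2_eq_square)
  qed
  have m13: "mass ?f1 + mass ?f3 \<le> M"
    using mass_restr_compl[OF f, of "ball 0 K2"] mass_restr_mono[OF f _ _ sub] M by auto
  have x13: "pint ?f1 + pint ?f3 \<le> pint f"
  proof -
    have "pint ?f1 + pint ?f3 = pint (restr (ball 0 K1 \<union> - ball 0 K2) f)"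
      using sub by (intro pint_restr_union[symmetric] f) auto
    also have "\<dots> \<le> pint f" by (intro pint_restr_le f) auto
    finally show ?thesis .
  qed
  have "D ?f1 ?f1 + D ?f3 ?f3 \<le> best * (mass ?f1 powr \<alpha> * pint ?f1 powr \<beta>) + best * (mass ?f3 powr \<alpha> * pint ?f3 powr \<beta>)"
    by (intro add_mono D_le_best a)
  also have "\<dots> = best * (mass ?f1 powr \<alpha> * pint ?f1 powr \<beta> + mass ?f3 powr \<alpha> * pint ?f3 powr \<beta>)" by (simp add: distrib_left)
  also have "\<dots> \<le> best * ((1 - \<delta> / M) powr (2 * \<alpha> / 5) * (M powr \<alpha> * pint f powr \<beta>))"
    using best_pos[OF f] M X \<delta> mass_nonneg[OF a(1)] mass_nonneg[OF a(3)] pint_nonneg m13 x13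
    by (intro mult_left_mono split_inequality) auto
  finally show ?thesis using e 1 2 3 by linarith
qed

section \<open>Maximising sequences neither vanish nor split\<close>

text \<open>The mass is fixed, but the p-integral only converges: this is all that a minimising
  sequence of the energy provides. The limit of the energies is the largest value compatible with
  \<open>M\<close> and \<open>X\<close>.\<close>

definition maximizing :: "real \<Rightarrow> real \<Rightarrow> (nat \<Rightarrow> R3 \<Rightarrow> real) \<Rightarrow> bool" where
  "maximizing M X f \<longleftrightarrow> 0 < M \<and> 0 < X \<and> (\<forall>n. adm (f n) \<and> mass (f n) = M) \<and> (\<lambda>n. pint (f n)) \<longlonglongrightarrow> X \<and>
     (\<lambda>n. D (f n) (f n)) \<longlonglongrightarrow> best * (M powr \<alpha> * X powr \<beta>)"

lemma maximizingD:
  assumes "maximizing M X f"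
  shows "0 < M" "0 < X" "adm (f n)" "mass (f n) = M" "(\<lambda>n. pint (f n)) \<longlonglongrightarrow> X"
    "(\<lambda>n. D (f n) (f n)) \<longlonglongrightarrow> best * (M powr \<alpha> * X powr \<beta>)"
  using assms by (auto simp: maximizing_def)

lemma maximizing_best_pos: "maximizing M X f \<Longrightarrow> 0 < best * (M powr \<alpha> * X powr \<beta>)"
  using best_pos[of "f 0"] maximizingD[of M X f] by simp

lemma maximizing_subseq: "maximizing M X f \<Longrightarrow> strict_mono s \<Longrightarrow> maximizing M X (\<lambda>n. f (s n))"
  unfolding maximizing_def using LIMSEQ_subseq_LIMSEQ[of _ _ s] by (auto simp: o_def)

lemma maximizing_shift: "maximizing M X f \<Longrightarrow> maximizing M X (\<lambda>n. shift (a n) (f n))"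
  unfolding maximizing_def by (simp add: adm_shift D_shift)

lemma maximizing_bounded: assumes "maximizing M X f" obtains B where "0 \<le> B" "\<And>n. pint (f n) \<le> B" "M \<le> B"
proof -
  obtain K where K: "\<And>n. norm (pint (f n)) \<le> K"
    using convergent_imp_bounded[OF maximizingD(5)[OF assms]] by (auto simp: bounded_iff)
  show ?thesis by (rule that[of "max (max K 0) M"]) (use K in \<open>auto simp: abs_le_iff le_max_iff_disj\<close>)
qed

text \<open>If no ball of radius \<open>R\<close> carried mass \<open>\<delta>\<close>, the
  distances below \<open>r\<close>, between \<open>r\<close> and \<open>R\<close>, and above
  \<open>R\<close> would each contribute at most L/8 to the energy, which is eventually larger than
  L/2.\<close>

lemma nonvanishing:
  assumes f: "maximizing M X f"
  obtains R \<delta> a s where "0 < R" "0 < \<delta>" "strict_mono (s :: nat \<Rightarrow> nat)" "\<And>n. \<delta> \<le> mass (restr (ball (a n) R) (f (s n)))"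
proof -
  define L where "L = best * (M powr \<alpha> * X powr \<beta>)"
  have L: "0 < L" using maximizing_best_pos[OF f] by (simp add: L_def)
  note M = maximizingD(1)[OF f]
  obtain B where B: "0 \<le> B" "\<And>n. pint (f n) \<le> B" using maximizing_bounded[OF f] by metis
  obtain r where r: "0 < r"
    "\<And>f g. adm f \<Longrightarrow> adm g \<Longrightarrow> pint f \<le> B \<Longrightarrow> pint g \<le> B \<Longrightarrow> pair_energy (near r) f g \<le> ennreal (L/8)"
    using D_near_small[of "L/8" B] L B by auto
  \<comment> \<open>Chosen so that the far part, at most \<open>M\<^sup>2 / R\<close>, and the
    middle part, at most \<open>M * \<delta> / r\<close>, both equal \<open>L / 8\<close>.\<close>
  define R where "R = 8 * M\<^sup>2 / L"
  define \<delta> where "\<delta> = r * L / (8 * M)"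
  have R: "0 < R" and \<delta>: "0 < \<delta>" using L M r by (auto simp: R_def \<delta>_def)
  obtain N where N: "\<And>n. n \<ge> N \<Longrightarrow> L / 2 < D (f n) (f n)"
    using order_tendstoD(1)[OF maximizingD(6)[OF f], of "L/2"] L by (auto simp: L_def eventually_sequentially)
  have ex: "\<exists>a. \<delta> \<le> mass (restr (ball a R) (f n))" if n: "n \<ge> N" for n
  proof (rule ccontr)
    assume "\<not> ?thesis"
    then have lt: "mass (restr (ball a R) (f n)) \<le> \<delta>" for a by (auto simp: not_le intro: less_imp_le)
    let ?f = "f n"
    have adm: "adm ?f" by (rule maximizingD(3)[OF f])
    note [measurable] = admD(2)[OF adm]
    let ?k1 = "\<lambda>z. 1 / r * indicator (ball 0 R) z :: real" and ?k2 = "\<lambda>z::R3. 1 / R"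
    have nb: "nonneg_borel ?k1" "nonneg_borel ?k2" "nonneg_borel (\<lambda>z. near r z + ?k1 z)"
      using r R nonneg_borel_near[of r] by (auto simp: nonneg_borel_def)
    have kle: "newton z \<le> (near r z + ?k1 z) + ?k2 z" for z
    proof -
      consider "norm z < r" | "r \<le> norm z" "norm z < R" | "r \<le> norm z" "R \<le> norm z" by linarith
      then show ?thesis
      proof cases
        case 1 then show ?thesis using r R by (auto simp: newton_def near_def indicator_def)
      next
        case 2
        then have "1 / norm z \<le> 1 / r" using r by (intro divide_left_mono mult_pos_pos) auto
        then have "1 / norm z \<le> 1 / r + 1 / R" using R by (simp add: add_increasing2)
        then show ?thesis using 2 by (auto simp: newton_def near_def indicator_def)
      next
        case 3
        then have "1 / norm z \<le> 1 / R" using r R by (intro divide_left_mono mult_pos_pos) auto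
        then show ?thesis using 3 r R by (auto simp: newton_def near_def indicator_def)
      qed
    qed
    have "pair_energy newton ?f ?f \<le> pair_energy (\<lambda>z. (near r z + ?k1 z) + ?k2 z) ?f ?f"
      by (intro pair_energy_mono kle admD(3)[OF adm] nonneg_borelD(2)[OF nonneg_borel_newton]) auto
    also have "\<dots> = pair_energy (\<lambda>z. near r z + ?k1 z) ?f ?f + pair_energy ?k2 ?f ?f"
      by (intro pair_energy_add_kernel nb admD(1) adm)
    also have "pair_energy (\<lambda>z. near r z + ?k1 z) ?f ?f = pair_energy (near r) ?f ?f + pair_energy ?k1 ?f ?f"
      by (intro pair_energy_add_kernel nb nonneg_borel_near admD(1) adm)
    finally have le: "pair_energy newton ?f ?f \<le> pair_energy (near r) ?f ?f + pair_energy ?k1 ?f ?f + pair_energy ?k2 ?f ?f" .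
    have 1: "pair_energy (near r) ?f ?f \<le> ennreal (L/8)" by (intro r(2) adm B)
    have 2: "pair_energy ?k2 ?f ?f \<le> ennreal (L/8)"
    proof -
      have "pair_energy ?k2 ?f ?f \<le> ennreal (1/R) * ((\<integral>\<^sup>+x. ennreal (?f x) \<partial>lborel) * (\<integral>\<^sup>+x. ennreal (?f x) \<partial>lborel))"
        using R by (intro pair_energy_bounded_kernel admD(1) adm) auto
      also have "\<dots> = ennreal (1 / R * (M * M))"
        using nn_mass[OF adm] maximizingD(4)[OF f] R M by (simp add: ennreal_mult[symmetric])
      also have "1 / R * (M * M) = L / 8" using L M by (simp add: R_def power2_eq_square)
      finally show ?thesis .
    qed
    have 3: "pair_energy ?k1 ?f ?f \<le> ennreal (L/8)"
    proof -
      have "pair_energy ?k1 ?f ?f = (\<integral>\<^sup>+x. ennreal (?f x) * (\<integral>\<^sup>+y. ennreal (?f y * ?k1 (x - y)) \<partial>lborel) \<partial>lborel)"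
        by (intro pair_energy_eq nb admD(1) adm)
      also have "\<dots> \<le> (\<integral>\<^sup>+x. ennreal (?f x) * ennreal (\<delta> / r) \<partial>lborel)"
      proof (intro nn_integral_mono mult_left_mono)
        fix x
        have a: "adm (restr (ball x R) ?f)" by (intro adm_restr adm) auto
        have "(\<integral>\<^sup>+y. ennreal (?f y * ?k1 (x - y)) \<partial>lborel) = (\<integral>\<^sup>+y. ennreal (1/r) * ennreal (restr (ball x R) ?f y) \<partial>lborel)"
          using r admD(3)[OF adm] by (intro nn_integral_cong) (auto simp: restr_def indicator_def dist_norm norm_minus_commute ennreal_mult[symmetric])
        also have "\<dots> = ennreal (1/r) * ennreal (mass (restr (ball x R) ?f))"
          using admD(2)[OF a] nn_mass[OF a] by (subst nn_integral_cmult) auto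
        also have "\<dots> = ennreal (mass (restr (ball x R) ?f) / r)"
          using r mass_nonneg[OF a] by (simp add: ennreal_mult[symmetric])
        also have "\<dots> \<le> ennreal (\<delta> / r)" using lt r by (intro ennreal_leI divide_right_mono) auto
        finally show "(\<integral>\<^sup>+y. ennreal (?f y * ?k1 (x - y)) \<partial>lborel) \<le> ennreal (\<delta> / r)" .
      qed auto
      also have "\<dots> = ennreal M * ennreal (\<delta> / r)"
        using nn_mass[OF adm] maximizingD(4)[OF f] by (subst nn_integral_multc) auto
      also have "\<dots> = ennreal (L / 8)" using M r \<delta> by (simp add: ennreal_mult[symmetric]) (simp add: \<delta>_def)
      finally show ?thesis .
    qed
    have "ennreal (D ?f ?f) \<le> ennreal (L/8) + ennreal (L/8) + ennreal (L/8)"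
      unfolding ennreal_D[OF adm adm] by (rule order_trans[OF le add_mono[OF add_mono[OF 1 3] 2]])
    also have "\<dots> = ennreal (L/8 + L/8 + L/8)" using L by (simp only: ennreal_plus)
    finally have "D ?f ?f \<le> L/8 + L/8 + L/8" using L by (subst (asm) ennreal_le_iff) auto
    with N[OF n] L show False by linarith
  qed
  define a where "a n = (SOME a. \<delta> \<le> mass (restr (ball a R) (f (n + N))))" for n
  have "\<delta> \<le> mass (restr (ball (a n) R) (f (n + N)))" for n
    unfolding a_def by (rule someI_ex, rule ex) simp
  then show ?thesis using that[OF R \<delta>, of "\<lambda>n. n + N" a] by (auto simp: strict_mono_def)
qed

definition tight :: "(nat \<Rightarrow> R3 \<Rightarrow> real) \<Rightarrow> bool" where
  "tight f \<longleftrightarrow> (\<forall>\<epsilon>>0. \<exists>R>0. \<exists>N. \<forall>n\<ge>N. mass (restr (- ball 0 R) (f n)) \<le> \<epsilon>)"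

text \<open>Let \<open>L\<close> be the mass that stays in bounded balls in the limit. If
  \<open>L < M\<close>, some annulus of any prescribed width separates a definite mass inside from a
  definite mass outside while itself carrying almost none, and \<open>D_split\<close> keeps the
  energy below its limit by a fixed factor.\<close>

lemma concentrated_imp_tight:
  assumes f: "maximizing M X f" and R: "0 < R" and \<delta>: "0 < \<delta>" "\<And>n. \<delta> \<le> mass (restr (ball 0 R) (f n))"
  obtains s where "strict_mono (s :: nat \<Rightarrow> nat)" "tight (\<lambda>n. f (s n))"
proof -
  define m where "m n k = mass (restr (ball 0 (real k)) (f n))" for n k :: nat
  note M = maximizingD(1)[OF f] and adm = maximizingD(3)[OF f] and mM = maximizingD(4)[OF f]
  have mb: "norm (m n k) \<le> M" for n k
    using mass_restr_le[OF adm, of "ball 0 (real k)" n] mass_nonneg[OF adm_restr[OF adm, of "ball 0 (real k)" n]] mM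
    by (simp add: m_def)
  \<comment> \<open>Diagonal extraction over the integer radii, a discrete form of Helly's selection
    for the radial mass distributions.\<close>
  obtain s where s: "strict_mono s" "\<And>k. k \<in> UNIV \<Longrightarrow> \<exists>l. (\<lambda>n. m (s n) k) \<longlonglongrightarrow> l"
    by (rule function_convergent_subsequence[of UNIV m M]) (use mb in auto)
  then obtain l where l: "\<And>k. (\<lambda>n. m (s n) k) \<longlonglongrightarrow> l k" by (metis UNIV_I)
  have lM: "l k \<le> M" for k using mb by (intro LIMSEQ_le_const2[OF l]) (auto simp: abs_le_iff)
  have "incseq l"
  proof (rule incseq_SucI)
    fix k
    have "m n k \<le> m n (Suc k)" for n unfolding m_def by (intro mass_restr_mono adm) auto
    then show "l k \<le> l (Suc k)" by (intro LIMSEQ_le[OF l l]) auto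
  qed
  then obtain L where L: "l \<longlonglongrightarrow> L" "\<And>k. l k \<le> L" using incseq_convergent[of l M] lM by auto
  have LM: "L \<le> M" using lM by (intro LIMSEQ_le_const2[OF L(1)]) auto
  have "L = M"
  proof (rule ccontr)
    assume "L \<noteq> M"
    then have lt: "L < M" using LM by simp
    \<comment> \<open>The inner ball keeps at least \<open>\<delta>\<close> by concentration;
      outside of it at least \<open>(M - L) / 2\<close> remains, since the mass inside is eventually
      below the mean of \<open>L\<close> and \<open>M\<close>.\<close>
    define \<delta>' where "\<delta>' = min \<delta> ((M - L) / 2)"
    have \<delta>': "0 < \<delta>'" using \<delta> lt by (simp add: \<delta>'_def)
    have "0 \<le> l 0"
      by (rule LIMSEQ_le_const[OF l]) (auto simp: m_def intro!: mass_nonneg adm_restr adm)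
    then have "0 \<le> L" using L(2)[of 0] by linarith
    then have \<delta>'M: "\<delta>' < M" using M lt unfolding \<delta>'_def by (auto simp: min_less_iff_disj)
    define \<theta> where "\<theta> = (1 - \<delta>' / M) powr (2 * \<alpha> / 5)"
    have \<theta>: "0 \<le> \<theta>" "\<theta> < 1"
    proof -
      have "\<theta> < 1 powr (2 * \<alpha> / 5)" unfolding \<theta>_def using \<delta>' \<delta>'M M \<alpha>_pos by (intro powr_less_mono2) (auto simp: field_simps)
      then show "\<theta> < 1" by simp
    qed (simp add: \<theta>_def)
    define S where "S = best * (M powr \<alpha> * X powr \<beta>)"
    have S: "0 < S" using maximizing_best_pos[OF f] by (simp add: S_def)
    \<comment> \<open>The separation error and the annulus error are at most
      \<open>2 * \<epsilon>\<close> each. Their sum \<open>4 * \<epsilon>\<close> is half of the gap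
      \<open>(1 - \<theta>) * S\<close>.\<close>
    define \<epsilon> where "\<epsilon> = (1 - \<theta>) * S / 8"
    have \<epsilon>: "0 < \<epsilon>" using \<theta> S by (simp add: \<epsilon>_def)
    obtain B where B: "0 \<le> B" "\<And>n. pint (f n) \<le> B" "M \<le> B" using maximizing_bounded[OF f] by metis
    obtain \<eta> where \<eta>: "0 < \<eta>"
      "\<And>f g. adm f \<Longrightarrow> adm g \<Longrightarrow> pint f \<le> B \<Longrightarrow> pint g \<le> B \<Longrightarrow> mass f \<le> B \<Longrightarrow> mass g \<le> \<eta> \<Longrightarrow> D f g \<le> \<epsilon>"
      using D_small[OF \<epsilon> B(1)] by metis
    have "eventually (\<lambda>k. L - \<eta> / 4 < l k) sequentially" using order_tendstoD(1)[OF L(1)] \<eta> by simp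
    moreover have "eventually (\<lambda>k. R \<le> real k) sequentially" by real_asymp
    ultimately have "eventually (\<lambda>k. L - \<eta> / 4 < l k \<and> R \<le> real k) sequentially" by eventually_elim auto
    \<comment> \<open>\<open>K1\<close> already captures all but \<open>\<eta> / 4\<close> of the
      limit mass \<open>L\<close>, and no larger ball exceeds \<open>L\<close> in the limit. So the
      annulus up to \<open>K2\<close> stays light however large its width \<open>d\<close> is
      taken.\<close>
    then obtain K1 where K1: "L - \<eta> / 4 < l K1" "R \<le> real K1" by (auto simp: eventually_sequentially)
    obtain d :: nat where d: "M\<^sup>2 / \<epsilon> < real d" using reals_Archimedean2 by blast
    have dpos: "0 < real d" using d M \<epsilon> by (smt (verit) divide_nonneg_pos zero_le_power2)
    define K2 where "K2 = K1 + d"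
    have "eventually (\<lambda>n. L - \<eta> / 4 < m (s n) K1) sequentially" using order_tendstoD(1)[OF l K1(1)] .
    moreover have "eventually (\<lambda>n. m (s n) K1 < L + (M - L) / 2) sequentially"
      using lt L(2)[of K1] by (intro order_tendstoD(2)[OF l]) (auto simp: field_simps)
    moreover have "eventually (\<lambda>n. m (s n) K2 < L + \<eta> / 4) sequentially"
      using \<eta> L(2)[of K2] by (intro order_tendstoD(2)[OF l]) auto
    ultimately have ev: "eventually (\<lambda>n. D (f (s n)) (f (s n)) \<le> best * (\<theta> * (M powr \<alpha> * pint (f (s n)) powr \<beta>)) + 4 * \<epsilon>) sequentially"
    proof eventually_elim
      case (elim n)
      let ?f = "f (s n)"
      have sub: "ball 0 (real K1) \<subseteq> ball (0::R3) (real K2)" by (auto simp: K2_def)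
      have "D ?f ?f \<le> best * ((1 - \<delta>' / M) powr (2 * \<alpha> / 5) * (M powr \<alpha> * pint ?f powr \<beta>)) + 2 * M\<^sup>2 / (real K2 - real K1)
         + 2 * D ?f (restr (ball 0 (real K2) - ball 0 (real K1)) ?f)"
      proof (rule D_split[OF adm mM M _ \<delta>'])
        show "real K1 < real K2" using dpos by (simp add: K2_def)
        have "\<delta> \<le> mass (restr (ball 0 (real K1)) ?f)"
          using \<delta>(2)[of "s n"] mass_restr_mono[OF adm, of "ball 0 R" "ball 0 (real K1)" "s n"] K1 by force
        then show "\<delta>' \<le> mass (restr (ball 0 (real K1)) ?f)" by (simp add: \<delta>'_def)
        show "mass (restr (ball 0 (real K1)) ?f) \<le> M - \<delta>'"
          using elim(2) by (simp add: m_def \<delta>'_def min_def field_simps)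
      qed
      moreover have "2 * M\<^sup>2 / (real K2 - real K1) \<le> 2 * \<epsilon>"
        using d dpos \<epsilon> by (simp add: K2_def field_simps)
      moreover have "D ?f (restr (ball 0 (real K2) - ball 0 (real K1)) ?f) \<le> \<epsilon>"
      proof (rule \<eta>(2))
        have "mass (restr (ball 0 (real K1) \<union> (ball 0 (real K2) - ball 0 (real K1))) ?f)
           = mass (restr (ball 0 (real K1)) ?f) + mass (restr (ball 0 (real K2) - ball 0 (real K1)) ?f)"
          by (intro mass_restr_union adm) auto
        also have "ball 0 (real K1) \<union> (ball 0 (real K2) - ball 0 (real K1)) = ball (0::R3) (real K2)" using sub by blast
        finally show "mass (restr (ball 0 (real K2) - ball 0 (real K1)) ?f) \<le> \<eta>"
          using elim(1,3) \<eta>(1) unfolding m_def by linarith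
      qed (use B mM in \<open>auto intro!: adm adm_restr order_trans[OF pint_restr_le]\<close>)
      ultimately show ?case unfolding \<theta>_def by linarith
    qed
    have sub: "maximizing M X (\<lambda>n. f (s n))" by (rule maximizing_subseq[OF f s(1)])
    have "(\<lambda>n. best * (\<theta> * (M powr \<alpha> * pint (f (s n)) powr \<beta>)) + 4 * \<epsilon>) \<longlonglongrightarrow> best * (\<theta> * (M powr \<alpha> * X powr \<beta>)) + 4 * \<epsilon>"
      using maximizingD(2)[OF f] by (intro tendsto_intros maximizingD(5)[OF sub]) auto
    then have "S \<le> best * (\<theta> * (M powr \<alpha> * X powr \<beta>)) + 4 * \<epsilon>"
      unfolding S_def by (rule tendsto_le[OF sequentially_bot _ maximizingD(6)[OF sub] ev])
    also have "\<dots> = \<theta> * S + (1 - \<theta>) * S / 2" by (simp add: S_def \<epsilon>_def)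
    finally have "(1 - \<theta>) * S \<le> 0" unfolding left_diff_distrib by (simp add: field_simps)
    then show False using \<theta> S by (simp add: mult_le_0_iff)
  qed
  have "tight (\<lambda>n. f (s n))"
    unfolding tight_def
  proof (intro allI impI)
    fix \<epsilon> :: real assume \<epsilon>: "0 < \<epsilon>"
    have "eventually (\<lambda>k. M - \<epsilon> < l k) sequentially" using order_tendstoD(1)[OF L(1)] \<open>L = M\<close> \<epsilon> by simp
    then obtain k0 where k0: "\<And>k. k \<ge> k0 \<Longrightarrow> M - \<epsilon> < l k" by (auto simp: eventually_sequentially)
    define k where "k = Suc k0"
    have "eventually (\<lambda>n. M - \<epsilon> < m (s n) k) sequentially" using order_tendstoD(1)[OF l k0, of k] by (simp add: k_def)
    then obtain N where N: "\<And>n. n \<ge> N \<Longrightarrow> M - \<epsilon> < m (s n) k" by (auto simp: eventually_sequentially)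
    have "mass (restr (- ball 0 (real k)) (f (s n))) \<le> \<epsilon>" if "n \<ge> N" for n
      using N[OF that] mass_restr_compl[OF adm, of "ball 0 (real k)" "s n"] mM by (simp add: m_def)
    then show "\<exists>R>0. \<exists>N. \<forall>n\<ge>N. mass (restr (- ball 0 R) (f (s n))) \<le> \<epsilon>"
      by (intro exI[of _ "real k"]) (auto simp: k_def)
  qed
  with s(1) show ?thesis by (rule that)
qed

lemma restr_shift: "restr (ball 0 R) (shift (- a) f) = shift (- a) (restr (ball a R) f)"
  by (auto simp: restr_def shift_def fun_eq_iff indicator_def dist_norm norm_minus_commute)

lemma tight_translates:
  assumes f: "maximizing M X f"
  obtains s a where "strict_mono (s :: nat \<Rightarrow> nat)" "maximizing M X (\<lambda>n. shift (a n) (f (s n)))" "tight (\<lambda>n. shift (a n) (f (s n)))"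
proof -
  obtain R \<delta> a s where 1: "0 < R" "0 < \<delta>" "strict_mono (s :: nat \<Rightarrow> nat)" "\<And>n. \<delta> \<le> mass (restr (ball (a n) R) (f (s n)))"
    using nonvanishing[OF f] by metis
  let ?g = "\<lambda>n. shift (- a n) (f (s n))"
  have g: "maximizing M X ?g" by (intro maximizing_shift maximizing_subseq[OF f 1(3)])
  have "\<delta> \<le> mass (restr (ball 0 R) (?g n))" for n
    unfolding restr_shift using 1(4)[of n] adm_shift(2)[OF adm_restr[OF maximizingD(3)[OF f]]] by simp
  then obtain s' where s': "strict_mono (s' :: nat \<Rightarrow> nat)" "tight (\<lambda>n. ?g (s' n))"
    using concentrated_imp_tight[OF g 1(1,2)] by metis
  show ?thesis
    by (rule that[of "s \<circ> s'" "\<lambda>n. - a (s' n)"])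
      (use 1(3) s' maximizing_subseq[OF g s'(1)] in \<open>auto simp: o_def intro: strict_mono_o[unfolded o_def]\<close>)
qed

end

section \<open>Compactness of maximising sequences\<close>

lemma cutoff_lipschitz: assumes "0 < r" shows "\<bar>cutoff r z - cutoff r z'\<bar> \<le> norm (z - z') / r\<^sup>2"
proof -
  define u v where "u = max (norm z) r" and "v = max (norm z') r"
  have uv: "r \<le> u" "r \<le> v" "0 < u" "0 < v" using assms by (auto simp: u_def v_def)
  have "\<bar>cutoff r z - cutoff r z'\<bar> = \<bar>v - u\<bar> / (u * v)"
    unfolding cutoff_def u_def[symmetric] v_def[symmetric] using uv by (simp add: diff_frac_eq abs_divide abs_mult)
  also have "\<bar>v - u\<bar> \<le> norm (z - z')"
    using norm_triangle_ineq3[of z z'] unfolding u_def v_def max_def by (auto split: if_splits)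
  then have "\<bar>v - u\<bar> / (u * v) \<le> norm (z - z') / (r * r)"
    using uv assms by (intro frac_le mult_mono mult_pos_pos) auto
  finally show ?thesis by (simp add: power2_eq_square)
qed

text \<open>Derivative-free: \<open>ln (1 / t) < 1 / t - 1\<close> gives
  \<open>t - 1 < t * ln t\<close>, and multiplying by \<open>q - 1\<close> leaves
  \<open>t * (1 + (q - 1) * ln t)\<close>, which is at most
  \<open>t * t powr (q - 1)\<close>.\<close>

lemma bernoulli_powr_strict:
  fixes t q :: real assumes q: "1 < q" and t: "0 \<le> t" "t \<noteq> 1"
  shows "1 + q * (t - 1) < t powr q"
proof (cases "t = 0")
  case True
  then show ?thesis using q by simp
next
  case False
  then have t0: "0 < t" using t by simp
  have "ln (1 / t) < 1 / t - 1"
    using ln_le_minus_one[of "1/t"] ln_eq_minus_one[of "1/t"] t0 t by (cases "ln (1/t) = 1/t - 1") auto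
  then have "t - 1 < t * ln t" using t0 by (simp add: ln_div field_simps)
  then have "(q - 1) * (t - 1) < (q - 1) * (t * ln t)" using q by (intro mult_strict_left_mono) auto
  then have "1 + q * (t - 1) < t * (1 + (q - 1) * ln t)" by (simp add: algebra_simps)
  also have "\<dots> \<le> t * exp ((q - 1) * ln t)" using t0 by (intro mult_left_mono exp_ge_add_one_self) auto
  also have "\<dots> = t powr 1 * t powr (q - 1)" using t0 by (simp add: powr_def)
  also have "\<dots> = t powr q" by (simp only: powr_add[symmetric]) simp
  finally show ?thesis .
qed

text \<open>Strict Bernoulli at \<open>a / m\<close> and \<open>b / m\<close> with \<open>m\<close>
  the midpoint: the two linear terms add up to zero.\<close>

lemma powr_midpoint_strict:
  fixes a b q :: real assumes q: "1 < q" and ab: "0 \<le> a" "0 \<le> b" "a \<noteq> b"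
  shows "((a + b) / 2) powr q < (a powr q + b powr q) / 2"
proof -
  define m where "m = (a + b) / 2"
  have m: "0 < m" using ab by (simp add: m_def)
  have "1 + q * (a / m - 1) < (a / m) powr q" "1 + q * (b / m - 1) < (b / m) powr q"
    using ab m by (intro bernoulli_powr_strict q; auto simp: m_def field_simps)+
  then have "2 + q * ((a + b) / m - 2) < (a / m) powr q + (b / m) powr q" by (simp add: algebra_simps add_divide_distrib)
  moreover have "(a + b) / m = 2" using m by (simp add: m_def field_simps)
  ultimately have "2 < (a powr q + b powr q) / m powr q" using ab m by (simp add: powr_divide add_divide_distrib)
  then show ?thesis using m by (simp add: m_def[symmetric] field_simps)
qed

text \<open>By homogeneity only \<open>a + b = 1\<close> matters, where strict convexity and compactness give the constant.\<close>

lemma powr_uniformly_convex: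
  fixes q \<eta> :: real assumes q: "1 < q" and \<eta>: "0 < \<eta>"
  obtains C where "0 < C"
    "\<And>a b. 0 \<le> a \<Longrightarrow> 0 \<le> b \<Longrightarrow>
      \<bar>a - b\<bar> powr q \<le> C * ((a powr q + b powr q) / 2 - ((a + b) / 2) powr q) + \<eta> * (a powr q + b powr q)"
proof -
  define gap where "gap u = (u powr q + (1 - u) powr q) / 2 - (1 / 2) powr q" for u :: real
  \<comment> \<open>Off \<open>S\<close> the term with \<open>\<eta>\<close> alone suffices.
    \<open>S\<close> is compact and misses \<open>u = 1 / 2\<close>, the only zero of
    \<open>gap\<close>, so \<open>gap\<close> has a positive minimum on it.\<close>
  define S where "S = {0..1} \<inter> {u :: real. \<eta> * (u powr q + (1 - u) powr q) \<le> \<bar>2 * u - 1\<bar> powr q}"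
  have cont: "continuous_on {0..1} (\<lambda>u. u powr q)" "continuous_on {0..1} (\<lambda>u. (1 - u) powr q)"
     "continuous_on {0..1} (\<lambda>u. \<bar>2 * u - 1\<bar> powr q)"
  proof -
    have *: "continuous_on A (\<lambda>u. g u powr q)" if "continuous_on A g" "\<And>u. u \<in> A \<Longrightarrow> 0 \<le> g u" for A :: "real set" and g
      by (rule continuous_on_powr'[OF that(1) continuous_on_const]) (use that q in auto)
    show "continuous_on {0..1} (\<lambda>u. u powr q)" "continuous_on {0..1} (\<lambda>u. (1 - u) powr q)"
     "continuous_on {0..1} (\<lambda>u. \<bar>2 * u - 1\<bar> powr q)" by (rule *, (intro continuous_intros)[1], simp)+
  qed
  have S: "compact S"
  proof -
    have "closed ({0..1} \<inter> {u \<in> {0..1}. \<eta> * (u powr q + (1 - u) powr q) \<le> \<bar>2 * u - 1\<bar> powr q})"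
      by (intro closed_Int continuous_on_closed_Collect_le continuous_on_mult continuous_on_add continuous_on_const cont closed_atLeastAtMost)
    moreover have "S = {0..1} \<inter> {u \<in> {0..1}. \<eta> * (u powr q + (1 - u) powr q) \<le> \<bar>2 * u - 1\<bar> powr q}" by (auto simp: S_def)
    ultimately show ?thesis using compact_Int_closed[of "{0..1::real}" S] by (simp add: S_def)
  qed
  have gnn: "0 \<le> gap u" if "0 \<le> u" "u \<le> 1" for u
  proof (cases "u = 1 - u")
    case True
    then have half: "u = 1 / 2" by simp
    show ?thesis unfolding half gap_def by simp
  next
    case False
    then show ?thesis using powr_midpoint_strict[OF q, of u "1 - u"] that unfolding gap_def by auto
  qed
  obtain c where c: "0 < c" "\<And>u. u \<in> S \<Longrightarrow> c \<le> gap u"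
  proof (cases "S = {}")
    case True
    then show ?thesis using that[of 1] by auto
  next
    case False
    have "continuous_on S gap" unfolding gap_def
      by (intro continuous_intros continuous_on_subset[OF cont(1)] continuous_on_subset[OF cont(2)]) (auto simp: S_def)
    then obtain u where u: "u \<in> S" "\<And>v. v \<in> S \<Longrightarrow> gap u \<le> gap v"
      using continuous_attains_inf[OF S False] by metis
    have "u \<noteq> 1 - u"
    proof
      assume "u = 1 - u"
      then have half: "u = 1 / 2" by simp
      have "\<eta> * ((1 / 2) powr q + (1 / 2) powr q) \<le> 0"
        using u(1) unfolding S_def half by simp
      moreover have "0 < \<eta> * ((1 / 2) powr q + (1 / 2) powr q)" using \<eta> by (intro mult_pos_pos add_pos_pos) auto
      ultimately show False by linarith
    qed
    then have "0 < gap u" using powr_midpoint_strict[OF q, of u "1 - u"] u(1) by (auto simp: gap_def S_def)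
    then show ?thesis using that u(2) by blast
  qed
  have unit: "\<bar>2 * u - 1\<bar> powr q \<le> 1 / c * gap u + \<eta> * (u powr q + (1 - u) powr q)" if u: "0 \<le> u" "u \<le> 1" for u
  proof (cases "u \<in> S")
    case True
    have "\<bar>2 * u - 1\<bar> powr q \<le> 1 powr q" using u q by (intro powr_mono2) auto
    also have "\<dots> \<le> 1 / c * gap u" using c(2)[OF True] c(1) by simp
    also have "\<dots> \<le> 1 / c * gap u + \<eta> * (u powr q + (1 - u) powr q)" using \<eta> by simp
    finally show ?thesis .
  next
    case False
    then have "\<bar>2 * u - 1\<bar> powr q \<le> \<eta> * (u powr q + (1 - u) powr q)" using u by (auto simp: S_def)
    moreover have "0 \<le> 1 / c * gap u" using c(1) gnn[OF u] by simp
    ultimately show ?thesis by linarith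
  qed
  have main: "\<bar>a - b\<bar> powr q \<le> 1 / c * ((a powr q + b powr q) / 2 - ((a + b) / 2) powr q) + \<eta> * (a powr q + b powr q)"
    if ab: "0 \<le> a" "0 \<le> b" for a b
  proof (cases "a + b = 0")
    case True
    then have "a = 0" "b = 0" using ab by auto
    then show ?thesis by simp
  next
    case False
    define s u where "s = a + b" and "u = a / s"
    have s: "0 < s" using False ab by (simp add: s_def)
    have u: "0 \<le> u" "u \<le> 1" using ab s by (auto simp: u_def s_def field_simps)
    have a: "a = s * u" using s by (simp add: u_def)
    have b: "b = s * (1 - u)" using s by (simp add: u_def right_diff_distrib) (simp add: s_def)
    have 1: "\<bar>a - b\<bar> powr q = s powr q * \<bar>2 * u - 1\<bar> powr q"
    proof -
      have "a - b = s * (2 * u - 1)" unfolding a b by (simp add: algebra_simps)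
      then show ?thesis using s by (simp add: abs_mult powr_mult)
    qed
    have 2: "a powr q = s powr q * u powr q" "b powr q = s powr q * (1 - u) powr q"
      unfolding a b using s u by (auto simp: powr_mult)
    have 3: "((a + b) / 2) powr q = s powr q * (1 / 2) powr q"
      unfolding s_def[symmetric] using powr_mult[of s "1/2" q] s by simp
    have "s powr q * \<bar>2 * u - 1\<bar> powr q \<le> s powr q * (1 / c * gap u + \<eta> * (u powr q + (1 - u) powr q))"
      by (intro mult_left_mono unit u) auto
    then show ?thesis unfolding 1 2 3 gap_def by (simp add: algebra_simps add_divide_distrib)
  qed
  show ?thesis by (rule that[of "1 / c"]) (use c(1) main in auto)
qed

text \<open>Fatou's lemma, in the form that carries Cauchy bounds over to an almost everywhere
  limit.\<close>

lemma nn_integral_AE_limit_le: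
  fixes h :: "R3 \<Rightarrow> real"
  assumes [measurable]: "\<And>m. g m \<in> borel_measurable borel"
    and lim: "AE x in lborel. (\<lambda>m. g m x) \<longlonglongrightarrow> h x"
    and le: "eventually (\<lambda>m. (\<integral>\<^sup>+x. ennreal (g m x) \<partial>lborel) \<le> c) sequentially"
  shows "(\<integral>\<^sup>+x. ennreal (h x) \<partial>lborel) \<le> c"
proof -
  have "(\<integral>\<^sup>+x. ennreal (h x) \<partial>lborel) = (\<integral>\<^sup>+x. liminf (\<lambda>m. ennreal (g m x)) \<partial>lborel)"
  proof (rule nn_integral_cong_AE, use lim in eventually_elim)
    fix x assume "(\<lambda>m. g m x) \<longlonglongrightarrow> h x"
    then have "(\<lambda>m. ennreal (g m x)) \<longlonglongrightarrow> ennreal (h x)" by (rule tendsto_ennrealI)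
    then show "ennreal (h x) = liminf (\<lambda>m. ennreal (g m x))" by (simp add: lim_imp_Liminf)
  qed
  also have "\<dots> \<le> liminf (\<lambda>m. \<integral>\<^sup>+x. ennreal (g m x) \<partial>lborel)" by (rule nn_integral_liminf) auto
  also have "\<dots> \<le> c"
    using le by (intro order_trans[OF Liminf_mono[OF le]]) (simp add: Liminf_const)
  finally show ?thesis .
qed

context polytrope
begin

section \<open>Potentials of the truncated kernel\<close>

text \<open>Of opposite sign to \<open>grav_potential\<close>. Truncation makes the potential
  bounded and Lipschitz with constants depending only on the mass and \<open>r\<close>.\<close>

definition pot :: "real \<Rightarrow> (R3 \<Rightarrow> real) \<Rightarrow> R3 \<Rightarrow> real" where
  "pot r f x = (LINT y|lborel. f y * cutoff r (x - y))"

lemma pot_integrable: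
  assumes f: "adm f" and r: "0 < r" shows "integrable lborel (\<lambda>y. f y * cutoff r (x - y))"
proof -
  note [measurable] = admD(2)[OF f] nonneg_borelD(1)[OF nonneg_borel_cutoff[OF r]]
  have "integrable lborel (\<lambda>y. 1 / r * f y)" using admD(4)[OF f] by simp
  then show ?thesis
  proof (rule Bochner_Integration.integrable_bound)
    show "AE y in lborel. norm (f y * cutoff r (x - y)) \<le> norm (1 / r * f y)"
    proof (rule AE_I2)
      fix y
      have "f y * cutoff r (x - y) \<le> f y * (1 / r)" by (intro mult_left_mono cutoff_le r admD(3)[OF f])
      then show "norm (f y * cutoff r (x - y)) \<le> norm (1 / r * f y)"
        using nonneg_borelD(2)[OF nonneg_borel_cutoff[OF r], of "x - y"] admD(3)[OF f, of y] r by (simp add: abs_mult)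
    qed
  qed measurable
qed

lemma pot_bounds: assumes f: "adm f" and r: "0 < r" shows "0 \<le> pot r f x" "pot r f x \<le> mass f / r"
proof -
  note nn = nonneg_borelD(2)[OF nonneg_borel_cutoff[OF r]] admD(3)[OF f]
  show "0 \<le> pot r f x" unfolding pot_def using nn by (intro integral_nonneg_AE) auto
  have "pot r f x \<le> (LINT y|lborel. f y * (1 / r))" unfolding pot_def
    using nn admD(4)[OF f] by (intro integral_mono pot_integrable f r mult_left_mono cutoff_le) auto
  then show "pot r f x \<le> mass f / r" by (simp add: mass_def)
qed

lemma pot_measurable: assumes f: "adm f" and r: "0 < r" shows "pot r f \<in> borel_measurable borel"
proof -
  note [measurable] = admD(2)[OF f] nonneg_borelD(1)[OF nonneg_borel_cutoff[OF r]]
  show ?thesis unfolding pot_def by measurable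
qed

lemma pot_lipschitz: assumes f: "adm f" and r: "0 < r" shows "\<bar>pot r f x - pot r f x'\<bar> \<le> mass f * (norm (x - x') / r\<^sup>2)"
proof -
  have "pot r f x - pot r f x' = (LINT y|lborel. f y * cutoff r (x - y) - f y * cutoff r (x' - y))"
    unfolding pot_def by (intro Bochner_Integration.integral_diff[symmetric] pot_integrable f r)
  also have "\<bar>\<dots>\<bar> \<le> (LINT y|lborel. \<bar>f y * cutoff r (x - y) - f y * cutoff r (x' - y)\<bar>)"
    by (rule integral_abs_bound)
  also have "\<dots> \<le> (LINT y|lborel. f y * (norm (x - x') / r\<^sup>2))"
  proof (rule integral_mono)
    fix y
    have "\<bar>f y * cutoff r (x - y) - f y * cutoff r (x' - y)\<bar> = f y * \<bar>cutoff r (x - y) - cutoff r (x' - y)\<bar>"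
      using admD(3)[OF f, of y] by (simp add: right_diff_distrib[symmetric] abs_mult)
    also have "\<dots> \<le> f y * (norm ((x - y) - (x' - y)) / r\<^sup>2)"
      by (intro mult_left_mono cutoff_lipschitz r admD(3)[OF f])
    finally show "\<bar>f y * cutoff r (x - y) - f y * cutoff r (x' - y)\<bar> \<le> f y * (norm (x - x') / r\<^sup>2)" by simp
  qed (use admD(4)[OF f] pot_integrable[OF f r] in auto)
  finally show ?thesis by (simp add: mass_def)
qed

text \<open>The truncated energy with its inner integral carried out, so that locally uniform
  closeness of potentials can be tested against a tight density.\<close>

definition cross :: "real \<Rightarrow> (R3 \<Rightarrow> real) \<Rightarrow> (R3 \<Rightarrow> real) \<Rightarrow> real" where
  "cross r f g = (LINT x|lborel. f x * pot r g x)"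

lemma cross_integrable: assumes f: "adm f" and g: "adm g" and r: "0 < r" shows "integrable lborel (\<lambda>x. f x * pot r g x)"
proof -
  note [measurable] = admD(2)[OF f] pot_measurable[OF g r]
  have "integrable lborel (\<lambda>x. mass g / r * f x)" using admD(4)[OF f] by simp
  then show ?thesis
    by (rule Bochner_Integration.integrable_bound)
      (use mult_left_mono[OF pot_bounds(2)[OF g r] admD(3)[OF f]] pot_bounds(1)[OF g r] admD(3)[OF f] mass_nonneg[OF g] r in \<open>auto simp: abs_mult mult.commute\<close>)
qed

lemma pair_energy_cutoff:
  assumes f: "adm f" and g: "adm g" and r: "0 < r"
  shows "pair_energy (cutoff r) f g = ennreal (cross r f g)"
proof -
  have "pair_energy (cutoff r) f g = (\<integral>\<^sup>+x. ennreal (f x) * (\<integral>\<^sup>+y. ennreal (g y * cutoff r (x - y)) \<partial>lborel) \<partial>lborel)"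
    by (intro pair_energy_eq admD(1) f g nonneg_borel_cutoff r)
  also have "\<dots> = (\<integral>\<^sup>+x. ennreal (f x * pot r g x) \<partial>lborel)"
  proof (rule nn_integral_cong)
    fix x
    have "(\<integral>\<^sup>+y. ennreal (g y * cutoff r (x - y)) \<partial>lborel) = ennreal (pot r g x)"
      unfolding pot_def using nonneg_borelD(2)[OF nonneg_borel_cutoff[OF r]] admD(3)[OF g]
      by (intro nn_integral_eq_integral pot_integrable g r) auto
    then show "ennreal (f x) * (\<integral>\<^sup>+y. ennreal (g y * cutoff r (x - y)) \<partial>lborel) = ennreal (f x * pot r g x)"
      using admD(3)[OF f] pot_bounds[OF g r] by (simp add: ennreal_mult)
  qed
  also have "\<dots> = ennreal (cross r f g)" unfolding cross_def
    using admD(3)[OF f] pot_bounds[OF g r] by (intro nn_integral_eq_integral cross_integrable f g r) auto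
  finally show ?thesis .
qed

lemma cross_nonneg: "adm f \<Longrightarrow> adm g \<Longrightarrow> 0 < r \<Longrightarrow> 0 \<le> cross r f g"
  unfolding cross_def using pot_bounds(1)[of g r] by (intro integral_nonneg_AE) (auto simp: admD)

lemma cross_le_D: assumes "adm f" "adm g" "0 < r" shows "cross r f g \<le> D f g"
proof -
  have "ennreal (cross r f g) \<le> ennreal (D f g)"
    using pair_energy_cutoff_le_newton[OF admD(1) admD(1)] assms by (simp add: pair_energy_cutoff[symmetric] ennreal_D)
  then show ?thesis by (simp add: D_nonneg)
qed

lemma near_mono: "r \<le> r' \<Longrightarrow> near r z \<le> near r' z"
  by (auto simp: near_def indicator_def)

text \<open>Inside the ball the potentials are close; outside, their difference is at most
  \<open>M / r\<close> while \<open>f\<close> has little mass there.\<close>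

lemma cross_diff_le:
  assumes f: "adm f" and g: "adm g" and h: "adm h" and r: "0 < r" and R: "0 < R" and \<eta>: "0 \<le> \<eta>" and m: "mass g \<le> M" "mass h \<le> M"
    and close: "\<And>x. norm x \<le> R \<Longrightarrow> \<bar>pot r g x - pot r h x\<bar> \<le> \<eta>"
  shows "cross r f g - cross r f h \<le> mass f * \<eta> + M / r * mass (restr (- ball 0 R) f)"
proof -
  have a: "adm (restr (- ball 0 R) f)" by (intro adm_restr f) auto
  have "cross r f g - cross r f h = (LINT x|lborel. f x * pot r g x - f x * pot r h x)"
    unfolding cross_def by (intro Bochner_Integration.integral_diff[symmetric] cross_integrable f g h r)
  also have "\<dots> \<le> (LINT x|lborel. f x * \<eta> + M / r * restr (- ball 0 R) f x)"
  proof (rule integral_mono)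
    fix x
    show "f x * pot r g x - f x * pot r h x \<le> f x * \<eta> + M / r * restr (- ball 0 R) f x"
    proof (cases "norm x < R")
      case True
      then have "f x * (pot r g x - pot r h x) \<le> f x * \<eta>"
        using close[of x] by (intro mult_left_mono admD(3)[OF f]) auto
      then show ?thesis using True by (simp add: restr_def right_diff_distrib)
    next
      case False
      have "pot r g x - pot r h x \<le> M / r"
        using pot_bounds(2)[OF g r, of x] pot_bounds(1)[OF h r, of x] divide_right_mono[OF m(1), of r] r by linarith
      then have "f x * (pot r g x - pot r h x) \<le> f x * (M / r)" by (intro mult_left_mono admD(3)[OF f])
      moreover have "0 \<le> f x * \<eta>" using admD(3)[OF f] \<eta> by simp
      moreover have "M / r * restr (- ball 0 R) f x = f x * (M / r)" using False by (simp add: restr_def mult.commute)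
      ultimately show ?thesis unfolding right_diff_distrib by linarith
    qed
  qed (use admD(4)[OF f] admD(4)[OF a] cross_integrable[OF f _ r] g h in auto)
  also have "\<dots> = mass f * \<eta> + M / r * mass (restr (- ball 0 R) f)"
    using admD(4)[OF f] admD(4)[OF a] by (simp add: mass_def)
  finally show ?thesis .
qed

text \<open>An Arzela-Ascoli argument: convergence on a countable dense set, extended by the common
  Lipschitz constant. A single subsequence serves all truncation radii
  \<open>1 / real (Suc k)\<close>, since the radius is chosen only later, depending on the
  accuracy.\<close>

lemma potentials_uniformly_cauchy:
  assumes f: "\<And>n. adm (f n)" "\<And>n. mass (f n) = M" and M: "0 < M"
  obtains s where "strict_mono (s :: nat \<Rightarrow> nat)"
    "\<And>k R \<eta>. 0 < \<eta> \<Longrightarrow> \<exists>N. \<forall>n\<ge>N. \<forall>m\<ge>N. \<forall>x. norm x \<le> R \<longrightarrow>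
      \<bar>pot (1 / real (Suc k)) (f (s n)) x - pot (1 / real (Suc k)) (f (s m)) x\<bar> \<le> \<eta>"
proof -
  obtain Q :: "R3 set" where Q: "countable Q" "\<And>X. open X \<Longrightarrow> X \<noteq> {} \<Longrightarrow> \<exists>q\<in>Q. q \<in> X"
    using countable_dense_setE by metis
  define rr where "rr k = 1 / real (Suc k)" for k
  have rr: "0 < rr k" for k by (simp add: rr_def)
  \<comment> \<open>The potentials are bounded by \<open>M / rr k\<close>, which grows with
    \<open>k\<close>. The factor \<open>rr k\<close> restores the uniform bound \<open>M\<close>
    that the diagonal extraction requires.\<close>
  define v where "v n = (\<lambda>(x, k). rr k * pot (rr k) (f n) x)" for n
  have vb: "norm (v n z) \<le> M" for n z
  proof -
    obtain x k where z: "z = (x, k)" by force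
    have "rr k * pot (rr k) (f n) x \<le> rr k * (M / rr k)"
      using pot_bounds(2)[OF f(1)[of n] rr[of k], of x] rr[of k] f(2)[of n] by (intro mult_left_mono) auto
    then show ?thesis using pot_bounds(1)[OF f(1)[of n] rr[of k], of x] rr[of k] by (simp add: v_def z)
  qed
  obtain s where s: "strict_mono s" "\<And>z. z \<in> Q \<times> UNIV \<Longrightarrow> \<exists>l. (\<lambda>n. v (s n) z) \<longlonglongrightarrow> l"
    by (rule function_convergent_subsequence[of "Q \<times> UNIV" v M]) (use vb Q(1) in auto)
  have main: "\<exists>N. \<forall>n\<ge>N. \<forall>m\<ge>N. \<forall>x. norm x \<le> R \<longrightarrow> \<bar>pot (rr k) (f (s n)) x - pot (rr k) (f (s m)) x\<bar> \<le> \<eta>"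
    if \<eta>: "0 < \<eta>" for k R \<eta>
  proof -
    let ?r = "rr k"
    \<comment> \<open>With Lipschitz constant \<open>M / ?r\<^sup>2\<close>, moving to a net point
      costs \<open>\<eta> / 4\<close> for each of the two potentials; the remaining
      \<open>\<eta> / 2\<close> is for the difference at the net point.\<close>
    define d where "d = \<eta> * ?r\<^sup>2 / (4 * M)"
    have d: "0 < d" using \<eta> rr[of k] M by (simp add: d_def)
    have "cball (0::R3) R \<subseteq> (\<Union>q\<in>Q. ball q d)"
    proof
      fix x :: R3
      obtain q where "q \<in> Q" "q \<in> ball x d" using Q(2)[of "ball x d"] d by auto
      then show "x \<in> (\<Union>q\<in>Q. ball q d)" by (auto simp: dist_commute)
    qed
    then obtain C where C: "C \<subseteq> Q" "finite C" "cball (0::R3) R \<subseteq> (\<Union>q\<in>C. ball q d)"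
      using compactE_image[of "cball (0::R3) R" Q "\<lambda>q. ball q d"] by auto
    have "\<forall>q\<in>C. \<exists>N. \<forall>n\<ge>N. \<forall>m\<ge>N. \<bar>pot ?r (f (s n)) q - pot ?r (f (s m)) q\<bar> < \<eta> / 2"
    proof
      fix q assume "q \<in> C"
      then obtain l where "(\<lambda>n. v (s n) (q, k)) \<longlonglongrightarrow> l" using s(2)[of "(q, k)"] C by auto
      then have "(\<lambda>n. 1 / ?r * v (s n) (q, k)) \<longlonglongrightarrow> 1 / ?r * l" by (intro tendsto_intros)
      then have "(\<lambda>n. pot ?r (f (s n)) q) \<longlonglongrightarrow> 1 / ?r * l" using rr[of k] by (simp add: v_def)
      then have "Cauchy (\<lambda>n. pot ?r (f (s n)) q)" by (rule LIMSEQ_imp_Cauchy)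
      then show "\<exists>N. \<forall>n\<ge>N. \<forall>m\<ge>N. \<bar>pot ?r (f (s n)) q - pot ?r (f (s m)) q\<bar> < \<eta> / 2"
        using \<eta> unfolding Cauchy_def dist_real_def by (meson half_gt_zero)
    qed
    then obtain N where N: "\<And>q n m. q \<in> C \<Longrightarrow> n \<ge> N q \<Longrightarrow> m \<ge> N q \<Longrightarrow> \<bar>pot ?r (f (s n)) q - pot ?r (f (s m)) q\<bar> < \<eta> / 2"
      by metis
    have "\<bar>pot ?r (f (s n)) x - pot ?r (f (s m)) x\<bar> \<le> \<eta>"
      if "n \<ge> Max (insert 0 (N ` C))" "m \<ge> Max (insert 0 (N ` C))" "norm x \<le> R" for n m x
    proof -
      obtain q where q: "q \<in> C" "x \<in> ball q d" using C(3) \<open>norm x \<le> R\<close> by auto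
      have "n \<ge> N q" "m \<ge> N q" using that q C by auto
      then have 1: "\<bar>pot ?r (f (s n)) q - pot ?r (f (s m)) q\<bar> < \<eta> / 2" using N q by blast
      have 2: "\<bar>pot ?r (f j) x - pot ?r (f j) q\<bar> \<le> \<eta> / 4" for j
      proof -
        have "\<bar>pot ?r (f j) x - pot ?r (f j) q\<bar> \<le> M * (norm (x - q) / ?r\<^sup>2)"
          using pot_lipschitz[OF f(1) rr] f(2) by simp
        also have "\<dots> \<le> M * (d / ?r\<^sup>2)"
          using q M by (intro mult_left_mono divide_right_mono) (auto simp: dist_norm norm_minus_commute)
        also have "\<dots> = \<eta> / 4" using M rr[of k] by (simp add: d_def)
        finally show ?thesis .
      qed
      show ?thesis using 1 2[of "s n"] 2[of "s m"] by linarith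
    qed
    then show ?thesis by blast
  qed
  show ?thesis by (rule that[OF s(1)]) (use main in \<open>auto simp: rr_def\<close>)
qed

text \<open>The chain D(f_n, f_n) \<le> near part + truncated(f_n, f_n), truncated(f_n, f_n) \<le>
  truncated(f_n, f_m) + error, truncated(f_n, f_m) \<le> D(f_n, f_m). The near part, the core error,
  the tail error and the distance of D(f_n, f_n) from its limit take \<open>\<epsilon> / 4\<close>
  each.\<close>

lemma D_cross_cauchy:
  assumes f: "maximizing M X f" and t: "tight f"
  obtains s where "strict_mono (s :: nat \<Rightarrow> nat)"
    "\<And>\<epsilon>. 0 < \<epsilon> \<Longrightarrow> \<exists>N. \<forall>n\<ge>N. \<forall>m\<ge>N. best * (M powr \<alpha> * X powr \<beta>) - \<epsilon> \<le> D (f (s n)) (f (s m))"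
proof -
  note M = maximizingD(1)[OF f] and adm = maximizingD(3)[OF f] and mM = maximizingD(4)[OF f]
  obtain s where s: "strict_mono (s :: nat \<Rightarrow> nat)"
    "\<And>k R \<eta>. 0 < \<eta> \<Longrightarrow> \<exists>N. \<forall>n\<ge>N. \<forall>m\<ge>N. \<forall>x. norm x \<le> R \<longrightarrow>
      \<bar>pot (1 / real (Suc k)) (f (s n)) x - pot (1 / real (Suc k)) (f (s m)) x\<bar> \<le> \<eta>"
    by (rule potentials_uniformly_cauchy[of f M, OF adm mM M]) (rule that)
  define L where "L = best * (M powr \<alpha> * X powr \<beta>)"
  obtain B where B: "0 \<le> B" "\<And>n. pint (f n) \<le> B" "M \<le> B" using maximizing_bounded[OF f] by metis
  have "\<exists>N. \<forall>n\<ge>N. \<forall>m\<ge>N. L - \<epsilon> \<le> D (f (s n)) (f (s m))" if \<epsilon>: "0 < \<epsilon>" for \<epsilon>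
  proof -
    obtain r where r: "0 < r"
      "\<And>f g. adm f \<Longrightarrow> adm g \<Longrightarrow> pint f \<le> B \<Longrightarrow> pint g \<le> B \<Longrightarrow> pair_energy (near r) f g \<le> ennreal (\<epsilon>/4)"
      using D_near_small[of "\<epsilon>/4" B] \<epsilon> B by auto
    \<comment> \<open>The radius \<open>r\<close> is lowered to one of those for which the
      subsequence was prepared; the near part only decreases.\<close>
    obtain k where k: "1 / real (Suc k) < r" using r(1) nat_approx_posE[of r] by auto
    define \<rho> where "\<rho> = 1 / real (Suc k)"
    have \<rho>: "0 < \<rho>" "\<rho> \<le> r" using k by (auto simp: \<rho>_def)
    have Dnn: "D (f n) (f n) \<le> \<epsilon>/4 + cross \<rho> (f n) (f n)" for n
    proof -
      have "pair_energy newton (f n) (f n) \<le> pair_energy (\<lambda>z. near \<rho> z + cutoff \<rho> z) (f n) (f n)"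
        by (intro pair_energy_mono newton_le_near_cutoff \<rho> admD(3)[OF adm] nonneg_borelD(2)[OF nonneg_borel_newton]) auto
      also have "\<dots> = pair_energy (near \<rho>) (f n) (f n) + pair_energy (cutoff \<rho>) (f n) (f n)"
        by (intro pair_energy_add_kernel nonneg_borel_near nonneg_borel_cutoff \<rho> admD(1) adm)
      finally have 1: "pair_energy newton (f n) (f n) \<le> pair_energy (near \<rho>) (f n) (f n) + pair_energy (cutoff \<rho>) (f n) (f n)" .
      have "pair_energy (near \<rho>) (f n) (f n) \<le> pair_energy (near r) (f n) (f n)"
        by (intro pair_energy_mono near_mono \<rho> admD(3)[OF adm] nonneg_borelD(2)[OF nonneg_borel_near]) auto
      also have "\<dots> \<le> ennreal (\<epsilon>/4)" by (intro r(2) adm B)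
      finally have "pair_energy newton (f n) (f n) \<le> ennreal (\<epsilon>/4) + ennreal (cross \<rho> (f n) (f n))"
        using 1 unfolding pair_energy_cutoff[OF adm adm \<rho>(1)] by (meson add_right_mono order_trans)
      then have "ennreal (D (f n) (f n)) \<le> ennreal (\<epsilon>/4 + cross \<rho> (f n) (f n))"
        using \<epsilon> cross_nonneg[OF adm adm \<rho>(1)] by (simp add: ennreal_D[OF adm adm])
      then show ?thesis using \<epsilon> cross_nonneg[OF adm adm \<rho>(1), of n n] by (subst (asm) ennreal_le_iff) auto
    qed
    define \<tau> where "\<tau> = \<epsilon> * \<rho> / (4 * M)"
    have \<tau>: "0 < \<tau>" using \<epsilon> \<rho> M by (simp add: \<tau>_def)
    obtain R N1 where R: "0 < R" "\<And>n. n \<ge> N1 \<Longrightarrow> mass (restr (- ball 0 R) (f n)) \<le> \<tau>"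
      using t \<tau> unfolding tight_def by metis
    define \<eta> where "\<eta> = \<epsilon> / (4 * M)"
    have \<eta>: "0 < \<eta>" using \<epsilon> M by (simp add: \<eta>_def)
    obtain N2 where N2: "\<And>n m x. n \<ge> N2 \<Longrightarrow> m \<ge> N2 \<Longrightarrow> norm x \<le> R \<Longrightarrow> \<bar>pot \<rho> (f (s n)) x - pot \<rho> (f (s m)) x\<bar> \<le> \<eta>"
      using s(2)[OF \<eta>, of R k] unfolding \<rho>_def by metis
    obtain N3 where N3: "\<And>n. n \<ge> N3 \<Longrightarrow> L - \<epsilon>/4 < D (f n) (f n)"
      using order_tendstoD(1)[OF maximizingD(6)[OF f], of "L - \<epsilon>/4"] \<epsilon> by (auto simp: L_def eventually_sequentially)
    have "L - \<epsilon> \<le> D (f (s n)) (f (s m))" if n: "n \<ge> max N1 (max N2 N3)" and m: "m \<ge> max N1 (max N2 N3)" for n m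
    proof -
      have sn: "n \<le> s n" by (rule seq_suble[OF s(1)])
      have "cross \<rho> (f (s n)) (f (s n)) - cross \<rho> (f (s n)) (f (s m))
         \<le> mass (f (s n)) * \<eta> + M / \<rho> * mass (restr (- ball 0 R) (f (s n)))"
        by (rule cross_diff_le) (use adm \<rho> R \<eta> mM N2 n m in auto)
      also have "\<dots> \<le> M * \<eta> + M / \<rho> * \<tau>"
        using R(2)[of "s n"] sn n M \<rho> mM by (intro add_mono mult_left_mono) auto
      also have "\<dots> = \<epsilon> / 4 + \<epsilon> / 4" using M \<rho> by (simp add: \<eta>_def \<tau>_def)
      finally have "cross \<rho> (f (s n)) (f (s n)) \<le> cross \<rho> (f (s n)) (f (s m)) + \<epsilon> / 2" by simp
      moreover have "cross \<rho> (f (s n)) (f (s m)) \<le> D (f (s n)) (f (s m))" by (intro cross_le_D adm \<rho>)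
      moreover have "L - \<epsilon>/4 < D (f (s n)) (f (s n))" using N3[of "s n"] sn n by simp
      ultimately show ?thesis using Dnn[of "s n"] by linarith
    qed
    then show ?thesis by blast
  qed
  then show ?thesis using that s(1) unfolding L_def by blast
qed

section \<open>From nearly optimal midpoints to strong convergence\<close>

lemma D_midpoint:
  assumes f: "adm f" and g: "adm g"
  shows "D (\<lambda>x. (1/2) * (f x + g x)) (\<lambda>x. (1/2) * (f x + g x)) = (D f f + D g g + 2 * D f g) / 4"
proof -
  let ?h = "\<lambda>x. f x + g x"
  have h: "adm ?h" by (intro adm_add f g)
  have hh: "adm (\<lambda>x. (1/2) * ?h x)" by (intro adm_cmult h) auto
  have "D (\<lambda>x. (1/2) * ?h x) (\<lambda>x. (1/2) * ?h x) = (1/2) * ((1/2) * D ?h ?h)"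
    by (subst D_cmult_left[OF h hh], simp, subst D_cmult_right[OF h h], auto)
  also have "D ?h ?h = (D f f + D f g) + (D g f + D g g)"
    by (simp only: D_add_left[OF f g h] D_add_right[OF f g f] D_add_right[OF f g g])
  finally show ?thesis using D_commute[OF f g] by simp
qed

text \<open>The midpoint of two members has mass \<open>M\<close> and almost maximal energy, so by
  the sharp inequality its p-integral cannot be much below \<open>X\<close>. The members have
  p-integrals hardly above \<open>X\<close>; the convexity defect is thus small, and it controls the
  p-integral of the difference.\<close>

lemma Lp_cauchy:
  assumes f: "maximizing M X f"
    and c: "\<And>\<epsilon>. 0 < \<epsilon> \<Longrightarrow> \<exists>N. \<forall>n\<ge>N. \<forall>m\<ge>N. best * (M powr \<alpha> * X powr \<beta>) - \<epsilon> \<le> D (f n) (f m)"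
    and \<epsilon>: "0 < \<epsilon>"
  shows "\<exists>N. \<forall>n\<ge>N. \<forall>m\<ge>N. pint (\<lambda>x. \<bar>f n x - f m x\<bar>) \<le> \<epsilon>"
proof -
  note M = maximizingD(1)[OF f] and X = maximizingD(2)[OF f] and adm = maximizingD(3)[OF f] and mM = maximizingD(4)[OF f]
  define L where "L = best * (M powr \<alpha> * X powr \<beta>)"
  have L: "0 < L" using maximizing_best_pos[OF f] by (simp add: L_def)
  \<comment> \<open>The two p-integrals add up to at most \<open>4 * X\<close>, so this term takes
    \<open>\<epsilon> / 2\<close>. The defect is at most \<open>\<delta> + \<epsilon>'\<close>, and
    \<open>C\<close> times each of these is at most \<open>\<epsilon> / 4\<close>.\<close>
  define \<eta> where "\<eta> = \<epsilon> / (8 * X)"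
  have \<eta>: "0 < \<eta>" using \<epsilon> X by (simp add: \<eta>_def)
  obtain C where C: "0 < C" "\<And>a b. 0 \<le> a \<Longrightarrow> 0 \<le> b \<Longrightarrow>
      \<bar>a - b\<bar> powr p \<le> C * ((a powr p + b powr p) / 2 - ((a + b) / 2) powr p) + \<eta> * (a powr p + b powr p)"
    using powr_uniformly_convex[of p \<eta>] p_gt \<eta> by auto
  define \<epsilon>' where "\<epsilon>' = min (\<epsilon> / (4 * C)) (X / 2)"
  have \<epsilon>': "0 < \<epsilon>'" "\<epsilon>' < X" "C * \<epsilon>' \<le> \<epsilon> / 4" using \<epsilon> C(1) X by (auto simp: \<epsilon>'_def min_def field_simps)
  \<comment> \<open>The sharp bound on the energy for mass \<open>M\<close> and p-integral
    \<open>X - \<epsilon>'\<close>. A midpoint with energy above \<open>L'\<close> must have a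
    p-integral of at least \<open>X - \<epsilon>'\<close>.\<close>
  define L' where "L' = best * (M powr \<alpha> * (X - \<epsilon>') powr \<beta>)"
  have "L' < L"
  proof -
    have "(X - \<epsilon>') powr \<beta> < X powr \<beta>" using \<epsilon>' \<beta>_pos by (intro powr_less_mono2) auto
    moreover have "0 < best * M powr \<alpha>" using best_pos[OF adm] mM M by simp
    ultimately show ?thesis unfolding L_def L'_def mult.assoc[symmetric] by (intro mult_strict_left_mono)
  qed
  then have g: "0 < (L - L') / 2" by simp
  obtain N1 where N1: "\<And>n m. n \<ge> N1 \<Longrightarrow> m \<ge> N1 \<Longrightarrow> L - (L - L') / 2 \<le> D (f n) (f m)"
    using c[OF g] unfolding L_def by metis
  define \<delta> where "\<delta> = min X (\<epsilon> / (4 * C))"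
  have \<delta>: "0 < \<delta>" "\<delta> \<le> X" "C * \<delta> \<le> \<epsilon> / 4" using X \<epsilon> C(1) by (auto simp: \<delta>_def min_def field_simps)
  obtain N2 where N2: "\<And>n. n \<ge> N2 \<Longrightarrow> pint (f n) < X + \<delta>"
    using order_tendstoD(2)[OF maximizingD(5)[OF f], of "X + \<delta>"] \<delta> by (auto simp: eventually_sequentially)
  have "pint (\<lambda>x. \<bar>f n x - f m x\<bar>) \<le> \<epsilon>" if n: "n \<ge> max N1 N2" and m: "m \<ge> max N1 N2" for n m
  proof -
    let ?g = "\<lambda>x. (1/2) * (f n x + f m x)"
    have ga: "adm ?g" by (intro adm_cmult adm_add adm) auto
    have gm: "mass ?g = M" unfolding mass_cmult mass_add[OF adm adm] mM by simp
    have "L' < D ?g ?g"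
    proof -
      have "D ?g ?g \<ge> L - (L - L') / 2" unfolding D_midpoint[OF adm adm]
      proof -
        have "L - (L - L') / 2 \<le> D (f n) (f n)" "L - (L - L') / 2 \<le> D (f m) (f m)" "L - (L - L') / 2 \<le> D (f n) (f m)"
          using N1 n m by auto
        moreover have "q \<le> (a + b + 2 * c) / 4" if "q \<le> a" "q \<le> b" "q \<le> c" for q a b c :: real
          using that by (simp add: field_simps)
        ultimately show "L - (L - L') / 2 \<le> (D (f n) (f n) + D (f m) (f m) + 2 * D (f n) (f m)) / 4" by blast
      qed
      moreover have "L' < L - (L - L') / 2" using \<open>L' < L\<close> by (simp add: field_simps)
      ultimately show ?thesis by linarith
    qed
    have gX: "X - \<epsilon>' \<le> pint ?g"
    proof (rule ccontr)
      assume "\<not> ?thesis"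
      then have "pint ?g powr \<beta> \<le> (X - \<epsilon>') powr \<beta>" using pint_nonneg[of ?g] \<beta>_pos by (intro powr_mono2) auto
      then have "best * (M powr \<alpha> * pint ?g powr \<beta>) \<le> L'"
        unfolding L'_def using best_pos[OF adm] mM M by (intro mult_left_mono) (auto intro: less_imp_le)
      then show False using D_le_best[OF ga] \<open>L' < D ?g ?g\<close> gm by simp
    qed
    have "pint (\<lambda>x. \<bar>f n x - f m x\<bar>)
        \<le> (LINT x|lborel. C * ((f n x powr p + f m x powr p) / 2 - ?g x powr p) + \<eta> * (f n x powr p + f m x powr p))"
      unfolding pint_def
    proof (rule integral_mono)
      show "integrable lborel (\<lambda>x. \<bar>f n x - f m x\<bar> powr p)" by (rule admD(5)[OF adm_abs_diff[OF adm adm]])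
      show "integrable lborel (\<lambda>x. C * ((f n x powr p + f m x powr p) / 2 - ?g x powr p) + \<eta> * (f n x powr p + f m x powr p))"
        using admD(5)[OF adm] admD(5)[OF ga] by auto
      show "\<bar>f n x - f m x\<bar> powr p \<le> C * ((f n x powr p + f m x powr p) / 2 - ?g x powr p) + \<eta> * (f n x powr p + f m x powr p)" for x
        using C(2)[OF admD(3)[OF adm] admD(3)[OF adm], of n x m x] by (simp add: mult.commute)
    qed
    also have "\<dots> = C * ((pint (f n) + pint (f m)) / 2 - pint ?g) + \<eta> * (pint (f n) + pint (f m))"
      unfolding pint_def using admD(5)[OF adm] admD(5)[OF ga] by simp
    also have "\<dots> \<le> C * (\<delta> + \<epsilon>') + \<eta> * (4 * X)"
    proof -
      have "pint (f n) < X + \<delta>" "pint (f m) < X + \<delta>" using N2 n m by auto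
      moreover have "(a + b) / 2 - c \<le> \<delta> + \<epsilon>'" "a + b \<le> 4 * X"
        if "a < X + \<delta>" "b < X + \<delta>" "X - \<epsilon>' \<le> c" for a b c :: real
        using that \<delta>(2) by (simp_all add: field_simps)
      ultimately have "(pint (f n) + pint (f m)) / 2 - pint ?g \<le> \<delta> + \<epsilon>'" "pint (f n) + pint (f m) \<le> 4 * X"
        using gX by blast+
      then show ?thesis using C(1) \<eta> by (intro add_mono mult_left_mono) auto
    qed
    also have "\<dots> \<le> \<epsilon>" using \<delta>(3) \<epsilon>'(3) X by (simp add: \<eta>_def distrib_left)
    finally show ?thesis .
  qed
  then show ?thesis by blast
qed

text \<open>Split at the level \<open>\<delta>\<close>: below it the volume of the ball decides,
  above it \<open>f x \<le> \<delta> powr (1 - p) * f x powr p\<close>. With \<open>\<delta>\<close>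
  fixed first, a small p-integral then forces a small mass.\<close>

lemma mass_le_pint_on_ball:
  assumes f: "adm f" and \<delta>: "0 < \<delta>" and R: "0 < R"
  shows "mass (restr (ball 0 R) f) \<le> \<delta> * measure lborel (ball (0::R3) R) + \<delta> powr (1 - p) * pint f"
proof -
  have a: "adm (restr (ball 0 R) f)" by (intro adm_restr f) auto
  have fin: "emeasure lborel (ball (0::R3) R) < \<infinity>" by (rule emeasure_lborel_ball_finite)
  have "mass (restr (ball 0 R) f) \<le> (LINT x|lborel. \<delta> * indicator (ball 0 R) x + \<delta> powr (1 - p) * f x powr p)"
    unfolding mass_def
  proof (rule integral_mono)
    fix x
    show "restr (ball 0 R) f x \<le> \<delta> * indicator (ball 0 R) x + \<delta> powr (1 - p) * f x powr p"
    proof (cases "f x \<le> \<delta>")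
      case True
      then show ?thesis using \<delta> by (auto simp: restr_def indicator_def add_increasing2)
    next
      case False
      then have "f x = f x powr (1 - p) * f x powr p" using \<delta> by (simp add: powr_add[symmetric])
      also have "\<dots> \<le> \<delta> powr (1 - p) * f x powr p" using False \<delta> p_gt by (intro mult_right_mono powr_mono2') auto
      finally show ?thesis using \<delta> admD(3)[OF f, of x] by (auto simp: restr_def indicator_def)
    qed
  qed (use admD(4)[OF a] admD(5)[OF f] fin in auto)
  also have "\<dots> = \<delta> * measure lborel (ball (0::R3) R) + \<delta> powr (1 - p) * pint f"
    unfolding pint_def using admD(5)[OF f] fin by simp
  finally show ?thesis .
qed

text \<open>On a large ball the L^p Cauchy property yields small mass through the level splitting;
  outside, tightness bounds the mass of each density separately. The four contributions are at most
  \<open>e / 8\<close> each.\<close>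

lemma L1_cauchy:
  assumes f: "\<And>n. adm (f n)" and t: "tight f"
    and c: "\<And>\<epsilon>. 0 < \<epsilon> \<Longrightarrow> \<exists>N. \<forall>n\<ge>N. \<forall>m\<ge>N. pint (\<lambda>x. \<bar>f n x - f m x\<bar>) \<le> \<epsilon>" and e: "0 < e"
  shows "\<exists>N. \<forall>n\<ge>N. \<forall>m\<ge>N. mass (\<lambda>x. \<bar>f n x - f m x\<bar>) < e"
proof -
  have "0 < e / 8" using e by simp
  then obtain R N1 where R: "0 < R" "\<And>n. n \<ge> N1 \<Longrightarrow> mass (restr (- ball 0 R) (f n)) \<le> e / 8"
    using t unfolding tight_def by metis
  define V where "V = measure lborel (ball (0::R3) R)"
  have V: "0 \<le> V" by (simp add: V_def)
  define \<delta> where "\<delta> = e / (8 * (V + 1))"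
  have \<delta>: "0 < \<delta>" using e V by (simp add: \<delta>_def)
  have \<delta>V: "\<delta> * V \<le> e / 8"
  proof -
    have "\<delta> * V \<le> \<delta> * (V + 1)" using \<delta> by simp
    also have "\<dots> = e / 8" using V unfolding \<delta>_def by (simp add: divide_simps)
    finally show ?thesis .
  qed
  define \<epsilon> where "\<epsilon> = e / (8 * \<delta> powr (1 - p))"
  have \<epsilon>: "0 < \<epsilon>" using e \<delta> by (simp add: \<epsilon>_def)
  obtain N2 where N2: "\<And>n m. n \<ge> N2 \<Longrightarrow> m \<ge> N2 \<Longrightarrow> pint (\<lambda>x. \<bar>f n x - f m x\<bar>) \<le> \<epsilon>"
    using c[OF \<epsilon>] by metis
  have "mass (\<lambda>x. \<bar>f n x - f m x\<bar>) < e" if n: "n \<ge> max N1 N2" and m: "m \<ge> max N1 N2" for n m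
  proof -
    let ?h = "\<lambda>x. \<bar>f n x - f m x\<bar>"
    have h: "adm ?h" by (intro adm_abs_diff f)
    have "mass ?h = mass (restr (ball 0 R) ?h) + mass (restr (- ball 0 R) ?h)"
      using mass_restr_compl[OF h, of "ball 0 R"] by simp
    moreover have "mass (restr (ball 0 R) ?h) \<le> \<delta> * V + \<delta> powr (1 - p) * \<epsilon>"
    proof -
      have "mass (restr (ball 0 R) ?h) \<le> \<delta> * V + \<delta> powr (1 - p) * pint ?h"
        unfolding V_def by (rule mass_le_pint_on_ball[OF h \<delta> R(1)])
      also have "\<dots> \<le> \<delta> * V + \<delta> powr (1 - p) * \<epsilon>" using N2[of n m] n m by (intro add_left_mono mult_left_mono) auto
      finally show ?thesis .
    qed
    moreover have "\<delta> powr (1 - p) * \<epsilon> = e / 8" using \<delta> by (simp add: \<epsilon>_def)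
    moreover have "mass (restr (- ball 0 R) ?h) \<le> e / 8 + e / 8"
    proof -
      have "mass (restr (- ball 0 R) ?h) \<le> mass (\<lambda>x. restr (- ball 0 R) (f n) x + restr (- ball 0 R) (f m) x)"
        using admD(3)[OF f]
        by (intro mass_mono adm_add adm_restr f h) (auto simp: restr_def indicator_def abs_le_iff add_increasing add_increasing2)
      also have "\<dots> = mass (restr (- ball 0 R) (f n)) + mass (restr (- ball 0 R) (f m))"
        by (intro mass_add adm_restr f) auto
      also have "\<dots> \<le> e / 8 + e / 8" using n m by (intro add_mono R(2)) auto
      finally show ?thesis .
    qed
    ultimately show ?thesis using \<delta>V e by linarith
  qed
  then show ?thesis by blast
qed

text \<open>An L^1 Cauchy sequence has a subsequence converging almost everywhere. With
  \<open>n\<close> fixed, Fatou in \<open>m\<close> transfers both Cauchy bounds to the distance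
  from the limit.\<close>

lemma L1_Lp_limit:
  assumes f: "\<And>n. adm (f n)"
    and c: "\<And>\<epsilon>. 0 < \<epsilon> \<Longrightarrow> \<exists>N. \<forall>n\<ge>N. \<forall>m\<ge>N. pint (\<lambda>x. \<bar>f n x - f m x\<bar>) \<le> \<epsilon>"
    and c1: "\<And>e. 0 < e \<Longrightarrow> \<exists>N. \<forall>n\<ge>N. \<forall>m\<ge>N. mass (\<lambda>x. \<bar>f n x - f m x\<bar>) < e"
  obtains s f0 where "strict_mono (s :: nat \<Rightarrow> nat)" "adm f0" "AE x in lborel. (\<lambda>n. f (s n) x) \<longlonglongrightarrow> f0 x"
    "(\<lambda>n. mass (\<lambda>x. \<bar>f (s n) x - f0 x\<bar>)) \<longlonglongrightarrow> 0" "(\<lambda>n. pint (\<lambda>x. \<bar>f (s n) x - f0 x\<bar>)) \<longlonglongrightarrow> 0"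
proof -
  have fm[measurable]: "f n \<in> borel_measurable borel" for n by (rule admD(2)[OF f])
  obtain s where s: "strict_mono s" "AE x in lborel. Cauchy (\<lambda>i. f (s i) x)"
    by (rule cauchy_L1_AE_cauchy_subseq[of lborel f]) (use admD(4)[OF f] c1 in \<open>auto simp: mass_def\<close>)
  \<comment> \<open>The maximum makes \<open>f0\<close> nonnegative also at the points without a
    limit, as \<open>adm\<close> demands.\<close>
  define f0 where "f0 x = max 0 (lim (\<lambda>i. f (s i) x))" for x
  have f0m[measurable]: "f0 \<in> borel_measurable borel" unfolding f0_def[abs_def] by measurable
  have lim: "AE x in lborel. (\<lambda>n. f (s n) x) \<longlonglongrightarrow> f0 x" using s(2)
  proof eventually_elim
    case (elim x)
    then obtain l where l: "(\<lambda>n. f (s n) x) \<longlonglongrightarrow> l" using Cauchy_convergent_iff convergent_def by metis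
    then have "0 \<le> l" using admD(3)[OF f] by (intro LIMSEQ_le_const[OF l]) auto
    then show ?case using l limI[OF l] by (simp add: f0_def)
  qed
  have sn: "n \<le> s n" for n by (rule seq_suble[OF s(1)])
  have d: "adm (\<lambda>x. \<bar>f n x - f m x\<bar>)" for n m by (intro adm_abs_diff f)
  have lp: "\<exists>N. \<forall>n\<ge>N. (\<integral>\<^sup>+x. ennreal (\<bar>f (s n) x - f0 x\<bar> powr p) \<partial>lborel) \<le> ennreal \<epsilon>" if \<epsilon>: "0 < \<epsilon>" for \<epsilon>
  proof -
    obtain N where N: "\<And>n m. n \<ge> N \<Longrightarrow> m \<ge> N \<Longrightarrow> pint (\<lambda>x. \<bar>f n x - f m x\<bar>) \<le> \<epsilon>" using c[OF \<epsilon>] by metis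
    have "(\<integral>\<^sup>+x. ennreal (\<bar>f (s n) x - f0 x\<bar> powr p) \<partial>lborel) \<le> ennreal \<epsilon>" if n: "n \<ge> N" for n
    proof (rule nn_integral_AE_limit_le[where g = "\<lambda>m x. \<bar>f (s n) x - f (s m) x\<bar> powr p"])
      show "AE x in lborel. (\<lambda>m. \<bar>f (s n) x - f (s m) x\<bar> powr p) \<longlonglongrightarrow> \<bar>f (s n) x - f0 x\<bar> powr p"
        using lim
      proof eventually_elim
        case (elim x)
        show ?case using p_gt by (intro tendsto_powr' tendsto_intros elim) auto
      qed
      show "\<forall>\<^sub>F m in sequentially. (\<integral>\<^sup>+x. ennreal (\<bar>f (s n) x - f (s m) x\<bar> powr p) \<partial>lborel) \<le> ennreal \<epsilon>"
        unfolding eventually_sequentially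
      proof (intro exI allI impI)
        fix m assume "m \<ge> N"
        then have "pint (\<lambda>x. \<bar>f (s n) x - f (s m) x\<bar>) \<le> \<epsilon>" using N[of "s n" "s m"] sn[of n] sn[of m] n by simp
        then show "(\<integral>\<^sup>+x. ennreal (\<bar>f (s n) x - f (s m) x\<bar> powr p) \<partial>lborel) \<le> ennreal \<epsilon>"
          using nn_pint[OF d] by (simp add: ennreal_leI)
      qed
    qed measurable
    then show ?thesis by blast
  qed
  have l1: "\<exists>N. \<forall>n\<ge>N. (\<integral>\<^sup>+x. ennreal \<bar>f (s n) x - f0 x\<bar> \<partial>lborel) \<le> ennreal \<epsilon>" if \<epsilon>: "0 < \<epsilon>" for \<epsilon>
  proof -
    obtain N where N: "\<And>n m. n \<ge> N \<Longrightarrow> m \<ge> N \<Longrightarrow> mass (\<lambda>x. \<bar>f n x - f m x\<bar>) < \<epsilon>" using c1[OF \<epsilon>] by metis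
    have "(\<integral>\<^sup>+x. ennreal \<bar>f (s n) x - f0 x\<bar> \<partial>lborel) \<le> ennreal \<epsilon>" if n: "n \<ge> N" for n
    proof (rule nn_integral_AE_limit_le[where g = "\<lambda>m x. \<bar>f (s n) x - f (s m) x\<bar>"])
      show "AE x in lborel. (\<lambda>m. \<bar>f (s n) x - f (s m) x\<bar>) \<longlonglongrightarrow> \<bar>f (s n) x - f0 x\<bar>"
        using lim
      proof eventually_elim
        case (elim x)
        show ?case by (intro tendsto_intros elim)
      qed
      show "\<forall>\<^sub>F m in sequentially. (\<integral>\<^sup>+x. ennreal \<bar>f (s n) x - f (s m) x\<bar> \<partial>lborel) \<le> ennreal \<epsilon>"
        unfolding eventually_sequentially
      proof (intro exI allI impI)
        fix m assume "m \<ge> N"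
        then have "mass (\<lambda>x. \<bar>f (s n) x - f (s m) x\<bar>) \<le> \<epsilon>" using N[of "s n" "s m"] sn[of n] sn[of m] n by simp
        then show "(\<integral>\<^sup>+x. ennreal \<bar>f (s n) x - f (s m) x\<bar> \<partial>lborel) \<le> ennreal \<epsilon>"
          using nn_mass[OF d] by (simp add: ennreal_leI)
      qed
    qed measurable
    then show ?thesis by blast
  qed
  have f0: "adm f0"
  proof -
    obtain n1 where n1: "(\<integral>\<^sup>+x. ennreal (\<bar>f (s n1) x - f0 x\<bar> powr p) \<partial>lborel) \<le> ennreal 1" using lp[of 1] by auto
    obtain n2 where n2: "(\<integral>\<^sup>+x. ennreal \<bar>f (s n2) x - f0 x\<bar> \<partial>lborel) \<le> ennreal 1" using l1[of 1] by auto
    have i1: "integrable lborel (\<lambda>x. \<bar>f (s n1) x - f0 x\<bar> powr p)"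
      by (rule integrableI_bounded) (use n1 in \<open>auto intro: le_less_trans\<close>)
    have i2: "integrable lborel (\<lambda>x. \<bar>f (s n2) x - f0 x\<bar>)"
      by (rule integrableI_bounded) (use n2 in \<open>auto intro: le_less_trans\<close>)
    have nn: "0 \<le> f0 x" for x by (simp add: f0_def)
    have "integrable lborel (\<lambda>x. f (s n2) x + \<bar>f (s n2) x - f0 x\<bar>)" using i2 admD(4)[OF f] by auto
    then have j1: "integrable lborel f0"
      by (rule Bochner_Integration.integrable_bound) (measurable, rule AE_I2, use nn admD(3)[OF f] in \<open>simp add: abs_of_nonneg add_nonneg_nonneg\<close>)
    have "integrable lborel (\<lambda>x. 2 powr p * (f (s n1) x powr p + \<bar>f (s n1) x - f0 x\<bar> powr p))" using i1 admD(5)[OF f] by auto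
    then have j2: "integrable lborel (\<lambda>x. f0 x powr p)"
    proof (rule Bochner_Integration.integrable_bound)
      show "AE x in lborel. norm (f0 x powr p) \<le> norm (2 powr p * (f (s n1) x powr p + \<bar>f (s n1) x - f0 x\<bar> powr p))"
      proof (rule AE_I2)
        fix x
        have "f0 x powr p \<le> (f (s n1) x + \<bar>f (s n1) x - f0 x\<bar>) powr p"
          using nn[of x] admD(3)[OF f, of "s n1" x] p_gt by (intro powr_mono2) auto
        also have "\<dots> \<le> 2 powr p * (f (s n1) x powr p + \<bar>f (s n1) x - f0 x\<bar> powr p)"
          by (intro powr_add_le admD(3)[OF f]) auto
        finally show "norm (f0 x powr p) \<le> norm (2 powr p * (f (s n1) x powr p + \<bar>f (s n1) x - f0 x\<bar> powr p))" by simp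
      qed
    qed measurable
    show ?thesis using j1 j2 nn by (auto simp: adm_def nonneg_borel_def)
  qed
  have d0: "adm (\<lambda>x. \<bar>f n x - f0 x\<bar>)" for n by (intro adm_abs_diff f f0)
  have lim1: "(\<lambda>n. mass (\<lambda>x. \<bar>f (s n) x - f0 x\<bar>)) \<longlonglongrightarrow> 0"
  proof (rule LIMSEQ_I)
    fix e :: real assume "0 < e"
    then obtain N where "\<And>n. n \<ge> N \<Longrightarrow> (\<integral>\<^sup>+x. ennreal \<bar>f (s n) x - f0 x\<bar> \<partial>lborel) \<le> ennreal (e/2)" using l1[of "e/2"] by auto
    then have "\<And>n. n \<ge> N \<Longrightarrow> mass (\<lambda>x. \<bar>f (s n) x - f0 x\<bar>) \<le> e / 2"
      using nn_mass[OF d0] \<open>0 < e\<close> by (simp add: mass_nonneg[OF d0])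
    then show "\<exists>N. \<forall>n\<ge>N. norm (mass (\<lambda>x. \<bar>f (s n) x - f0 x\<bar>) - 0) < e"
      using mass_nonneg[OF d0] \<open>0 < e\<close> by (intro exI[of _ N]) (force intro: le_less_trans)
  qed
  have lim2: "(\<lambda>n. pint (\<lambda>x. \<bar>f (s n) x - f0 x\<bar>)) \<longlonglongrightarrow> 0"
  proof (rule LIMSEQ_I)
    fix e :: real assume "0 < e"
    then obtain N where "\<And>n. n \<ge> N \<Longrightarrow> (\<integral>\<^sup>+x. ennreal (\<bar>f (s n) x - f0 x\<bar> powr p) \<partial>lborel) \<le> ennreal (e/2)" using lp[of "e/2"] by auto
    then have "\<And>n. n \<ge> N \<Longrightarrow> pint (\<lambda>x. \<bar>f (s n) x - f0 x\<bar>) \<le> e / 2"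
      using nn_pint[OF d0] \<open>0 < e\<close> by (simp add: pint_nonneg)
    then show "\<exists>N. \<forall>n\<ge>N. norm (pint (\<lambda>x. \<bar>f (s n) x - f0 x\<bar>) - 0) < e"
      using pint_nonneg \<open>0 < e\<close> by (intro exI[of _ N]) (force intro: le_less_trans)
  qed
  show ?thesis by (rule that[OF s(1) f0 lim lim1 lim2])
qed

text \<open>One bound \<open>B'\<close> covers \<open>f n\<close>, \<open>f0\<close> and their
  absolute differences, so \<open>D_small\<close> gives a single mass threshold for all interactions
  with the difference.\<close>

lemma D_diff_small:
  assumes f: "\<And>n. adm (f n)" and bd: "\<And>n. pint (f n) \<le> B" "\<And>n. mass (f n) \<le> B" and f0: "adm f0"
    and lim: "(\<lambda>n. mass (\<lambda>x. \<bar>f n x - f0 x\<bar>)) \<longlonglongrightarrow> 0"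
  shows "(\<lambda>n. D (\<lambda>x. \<bar>f n x - f0 x\<bar>) (\<lambda>x. \<bar>f n x - f0 x\<bar>)) \<longlonglongrightarrow> 0"
    and "(\<lambda>n. D (f n) (f n)) \<longlonglongrightarrow> D f0 f0"
proof -
  let ?d = "\<lambda>n x. \<bar>f n x - f0 x\<bar>"
  have d: "adm (?d n)" for n by (intro adm_abs_diff f f0)
  define B' where "B' = max (2 powr p * (B + pint f0)) (max (B + mass f0) (max B (max (pint f0) (mass f0))))"
  have B'nn: "0 \<le> B'" using pint_nonneg[of f0] unfolding B'_def by (simp add: le_max_iff_disj)
  have dle: "?d n x \<le> f n x + f0 x" for n x using admD(3)[OF f, of n x] admD(3)[OF f0, of x] by (simp add: abs_le_iff)
  have dp: "pint (?d n) \<le> B'" for n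
  proof -
    have "pint (?d n) \<le> pint (\<lambda>x. f n x + f0 x)" by (intro pint_mono adm_add f f0 d dle)
    also have "\<dots> \<le> 2 powr p * (pint (f n) + pint f0)" by (rule pint_add_le[OF f f0])
    also have "\<dots> \<le> 2 powr p * (B + pint f0)" using bd(1)[of n] by (intro mult_left_mono) auto
    finally show ?thesis by (simp add: B'_def)
  qed
  have dm: "mass (?d n) \<le> B'" for n
  proof -
    have "mass (?d n) \<le> mass (\<lambda>x. f n x + f0 x)" by (intro mass_mono adm_add f f0 d dle)
    also have "\<dots> = mass (f n) + mass f0" by (rule mass_add[OF f f0])
    finally show ?thesis using bd(2)[of n] by (simp add: B'_def)
  qed
  have fb: "pint (f n) \<le> B'" "mass (f n) \<le> B'" "pint f0 \<le> B'" "mass f0 \<le> B'" for n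
    using bd[of n] by (auto simp: B'_def le_max_iff_disj)
  have small: "\<exists>N. \<forall>n\<ge>N. \<forall>g. adm g \<and> pint g \<le> B' \<and> mass g \<le> B' \<longrightarrow> D g (?d n) \<le> e" if e: "0 < e" for e
  proof -
    obtain \<delta> where \<delta>: "0 < \<delta>"
      "\<And>f g. adm f \<Longrightarrow> adm g \<Longrightarrow> pint f \<le> B' \<Longrightarrow> pint g \<le> B' \<Longrightarrow> mass f \<le> B' \<Longrightarrow> mass g \<le> \<delta> \<Longrightarrow> D f g \<le> e"
      using D_small[OF e B'nn] by metis
    obtain N where "\<And>n. n \<ge> N \<Longrightarrow> mass (?d n) < \<delta>" using order_tendstoD(2)[OF lim \<delta>(1)] by (auto simp: eventually_sequentially)
    then show ?thesis using \<delta>(2) d dp by (meson less_imp_le)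
  qed
  show "(\<lambda>n. D (?d n) (?d n)) \<longlonglongrightarrow> 0"
  proof (rule LIMSEQ_I)
    fix e :: real assume e: "0 < e"
    then obtain N where "\<forall>n\<ge>N. \<forall>g. adm g \<and> pint g \<le> B' \<and> mass g \<le> B' \<longrightarrow> D g (?d n) \<le> e/2" using small[of "e/2"] by auto
    then have "\<And>n. n \<ge> N \<Longrightarrow> D (?d n) (?d n) \<le> e/2" using d dp dm by blast
    then show "\<exists>N. \<forall>n\<ge>N. norm (D (?d n) (?d n) - 0) < e" using D_nonneg e by (intro exI[of _ N]) (force intro: le_less_trans)
  qed
  show "(\<lambda>n. D (f n) (f n)) \<longlonglongrightarrow> D f0 f0"
  proof (rule LIMSEQ_I)
    fix e :: real assume e: "0 < e"
    then obtain N where N: "\<forall>n\<ge>N. \<forall>g. adm g \<and> pint g \<le> B' \<and> mass g \<le> B' \<longrightarrow> D g (?d n) \<le> e/4" using small[of "e/4"] by auto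
    have "norm (D (f n) (f n) - D f0 f0) < e" if n: "n \<ge> N" for n
    proof -
      have s: "D (f n) (?d n) \<le> e / 4" "D f0 (?d n) \<le> e / 4" using N n f f0 fb by blast+
      have 1: "D f g \<le> D h g + D (?d n) g" if "adm f" "adm h" "adm g" "\<And>x. f x \<le> h x + ?d n x" for f h g
      proof -
        have "D f g \<le> D (\<lambda>x. h x + ?d n x) g" by (intro D_mono adm_add d that) auto
        then show ?thesis using D_add_left[OF that(2) d that(3)] by simp
      qed
      \<comment> \<open>The two arguments are exchanged one at a time, in both directions; each
        exchange costs an interaction with the difference, at most \<open>e / 4\<close>.\<close>
      have "D (f n) (f n) \<le> D f0 (f n) + D (?d n) (f n)" by (intro 1 f f0) auto
      moreover have "D (f n) f0 \<le> D f0 f0 + D (?d n) f0" by (intro 1 f f0) auto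
      moreover have "D f0 f0 \<le> D (f n) f0 + D (?d n) f0" by (intro 1 f f0) auto
      moreover have "D f0 (f n) \<le> D (f n) (f n) + D (?d n) (f n)" by (intro 1 f f0) auto
      ultimately show ?thesis
        using s e D_commute[OF f f0] D_commute[OF d f] D_commute[OF d f0] by (auto simp: abs_less_iff)
    qed
    then show "\<exists>N. \<forall>n\<ge>N. norm (D (f n) (f n) - D f0 f0) < e" by blast
  qed
qed

theorem maximizing_compact:
  assumes f: "maximizing M X f"
  obtains s a f0 where "strict_mono (s :: nat \<Rightarrow> nat)" "adm f0" "mass f0 = M" "pint f0 = X"
    "D f0 f0 = best * (M powr \<alpha> * X powr \<beta>)"
    "(\<lambda>n. mass (\<lambda>x. \<bar>shift (a n) (f (s n)) x - f0 x\<bar>)) \<longlonglongrightarrow> 0"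
    "(\<lambda>n. pint (\<lambda>x. \<bar>shift (a n) (f (s n)) x - f0 x\<bar>)) \<longlonglongrightarrow> 0"
    "(\<lambda>n. D (\<lambda>x. \<bar>shift (a n) (f (s n)) x - f0 x\<bar>) (\<lambda>x. \<bar>shift (a n) (f (s n)) x - f0 x\<bar>)) \<longlonglongrightarrow> 0"
proof -
  obtain s1 a1 where 1: "strict_mono (s1 :: nat \<Rightarrow> nat)" "maximizing M X (\<lambda>n. shift (a1 n) (f (s1 n)))"
    "tight (\<lambda>n. shift (a1 n) (f (s1 n)))"
    using tight_translates[OF f] by metis
  let ?g = "\<lambda>n. shift (a1 n) (f (s1 n))"
  obtain s2 where 2: "strict_mono (s2 :: nat \<Rightarrow> nat)"
    "\<And>\<epsilon>. 0 < \<epsilon> \<Longrightarrow> \<exists>N. \<forall>n\<ge>N. \<forall>m\<ge>N. best * (M powr \<alpha> * X powr \<beta>) - \<epsilon> \<le> D (?g (s2 n)) (?g (s2 m))"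
    using D_cross_cauchy[OF 1(2,3)] by metis
  let ?h = "\<lambda>n. ?g (s2 n)"
  have h: "maximizing M X ?h" by (rule maximizing_subseq[OF 1(2) 2(1)])
  have ht: "tight ?h" unfolding tight_def
  proof (intro allI impI)
    fix \<epsilon> :: real assume "0 < \<epsilon>"
    then obtain R N where "0 < R" "\<forall>n\<ge>N. mass (restr (- ball 0 R) (?g n)) \<le> \<epsilon>" using 1(3) unfolding tight_def by blast
    then show "\<exists>R>0. \<exists>N. \<forall>n\<ge>N. mass (restr (- ball 0 R) (?h n)) \<le> \<epsilon>"
      using seq_suble[OF 2(1)] by (intro exI[of _ R] conjI exI[of _ N]) (auto intro: le_trans)
  qed
  note ha = maximizingD(3)[OF h]
  have lp: "\<And>\<epsilon>. 0 < \<epsilon> \<Longrightarrow> \<exists>N. \<forall>n\<ge>N. \<forall>m\<ge>N. pint (\<lambda>x. \<bar>?h n x - ?h m x\<bar>) \<le> \<epsilon>"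
    by (rule Lp_cauchy[OF h 2(2)])
  have l1: "\<And>e. 0 < e \<Longrightarrow> \<exists>N. \<forall>n\<ge>N. \<forall>m\<ge>N. mass (\<lambda>x. \<bar>?h n x - ?h m x\<bar>) < e"
    by (rule L1_cauchy[OF ha ht lp])
  obtain s3 f0 where 3: "strict_mono (s3 :: nat \<Rightarrow> nat)" "adm f0" "AE x in lborel. (\<lambda>n. ?h (s3 n) x) \<longlonglongrightarrow> f0 x"
    "(\<lambda>n. mass (\<lambda>x. \<bar>?h (s3 n) x - f0 x\<bar>)) \<longlonglongrightarrow> 0" "(\<lambda>n. pint (\<lambda>x. \<bar>?h (s3 n) x - f0 x\<bar>)) \<longlonglongrightarrow> 0"
    by (rule L1_Lp_limit[of ?h, OF ha lp l1])
  let ?k = "\<lambda>n. ?h (s3 n)"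
  have k: "maximizing M X ?k" by (rule maximizing_subseq[OF h 3(1)])
  note ka = maximizingD(3)[OF k]
  obtain B where B: "\<And>n. pint (?k n) \<le> B" "M \<le> B" using maximizing_bounded[OF k] by metis
  have mB: "mass (?k n) \<le> B" for n using maximizingD(4)[OF k] B by simp
  note D = D_diff_small[of ?k B f0, OF ka B(1) mB 3(2) 3(4)]
  have D0: "D f0 f0 = best * (M powr \<alpha> * X powr \<beta>)" by (rule LIMSEQ_unique[OF D(2) maximizingD(6)[OF k]])
  have m0: "mass f0 = M"
  proof -
    have "\<bar>M - mass f0\<bar> \<le> mass (\<lambda>x. \<bar>?k n x - f0 x\<bar>)" for n
    proof -
      have "M - mass f0 = (LINT x|lborel. ?k n x - f0 x)"
        using maximizingD(4)[OF k, of n] admD(4)[OF ka] admD(4)[OF 3(2)] by (simp add: mass_def)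
      then show ?thesis unfolding mass_def by simp
    qed
    then have "\<bar>M - mass f0\<bar> \<le> 0" by (intro LIMSEQ_le_const[OF 3(4)]) auto
    then show ?thesis by simp
  qed
  \<comment> \<open>Fatou gives the upper bound. A strictly smaller p-integral is impossible, since
    \<open>f0\<close> has the energy that is sharp for \<open>X\<close>.\<close>
  have X0: "pint f0 = X"
  proof (rule antisym)
    have "pint f0 \<le> X + e" if e: "0 < e" for e
    proof -
      have "(\<integral>\<^sup>+x. ennreal (f0 x powr p) \<partial>lborel) \<le> ennreal (X + e)"
      proof (rule nn_integral_AE_limit_le[where g = "\<lambda>n x. ?k n x powr p"])
        show "AE x in lborel. (\<lambda>n. ?k n x powr p) \<longlonglongrightarrow> f0 x powr p" using 3(3)
        proof eventually_elim
          case (elim x)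
          show ?case using p_gt admD(3)[OF ka] by (intro tendsto_powr' tendsto_intros elim) auto
        qed
        have "\<forall>\<^sub>F n in sequentially. pint (?k n) < X + e" using order_tendstoD(2)[OF maximizingD(5)[OF k]] e by simp
        then show "\<forall>\<^sub>F n in sequentially. (\<integral>\<^sup>+x. ennreal (?k n x powr p) \<partial>lborel) \<le> ennreal (X + e)"
        proof eventually_elim
          case (elim n)
          then show ?case using nn_pint[OF ka[of n]] by (simp add: ennreal_leI)
        qed
        show "(\<lambda>x. ?k n x powr p) \<in> borel_measurable borel" for n using admD(2)[OF ka] by measurable
      qed
      then have "ennreal (pint f0) \<le> ennreal (X + e)" unfolding nn_pint[OF 3(2)] .
      then show ?thesis using e maximizingD(2)[OF f] by (subst (asm) ennreal_le_iff) auto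
    qed
    then show "pint f0 \<le> X" by (rule field_le_epsilon)
    show "X \<le> pint f0"
    proof (rule ccontr)
      assume "\<not> X \<le> pint f0"
      then have "pint f0 powr \<beta> < X powr \<beta>" using pint_nonneg \<beta>_pos by (intro powr_less_mono2) auto
      moreover have "0 < best * M powr \<alpha>" using best_pos[OF 3(2)] m0 maximizingD(1)[OF f] by simp
      ultimately have "best * M powr \<alpha> * pint f0 powr \<beta> < best * M powr \<alpha> * X powr \<beta>" by (intro mult_strict_left_mono)
      then show False using D_le_best[OF 3(2)] D0 m0 by (simp add: mult.assoc)
    qed
  qed
  show ?thesis
    by (rule that[of "\<lambda>n. s1 (s2 (s3 n))" f0 "\<lambda>n. a1 (s2 (s3 n))"])
      (use 1(1) 2(1) 3 D0 m0 X0 D(1) in \<open>auto simp: strict_mono_def\<close>)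
qed

end

section \<open>Compact support of maximisers\<close>

text \<open>By weighted arithmetic-geometric means for \<open>q \<le> 1\<close>, and from
  \<open>(1 - u) powr q \<le> 1 - u\<close> above. Both cases occur, as \<alpha> and \<beta> can lie
  on either side of 1.\<close>

lemma powr_one_minus_le:
  fixes u q :: real assumes u: "0 \<le> u" "u \<le> 1" and q: "0 < q"
  shows "(1 - u) powr q \<le> 1 - min q 1 * u"
proof (cases "u = 1")
  case True
  then show ?thesis by simp
next
  case False
  then have u1: "0 < 1 - u" using u by simp
  show ?thesis
  proof (cases "q \<le> 1")
    case True
    have "(1 - u) powr q * 1 powr (1 - q) \<le> q * (1 - u) + (1 - q) * 1"
      using True q u1 by (intro Youngs_inequality_0) auto
    then show ?thesis using True by (simp add: algebra_simps)
  next
    case False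
    then have "(1 - u) powr q \<le> (1 - u) powr 1" using u u1 by (intro powr_mono') auto
    then show ?thesis using False u1 by simp
  qed
qed

lemma integrable_tail_small:
  fixes g :: "R3 \<Rightarrow> real"
  assumes g: "integrable lborel g" and \<epsilon>: "0 < \<epsilon>" and nn: "\<And>x. 0 \<le> g x"
  obtains R where "0 < R" "(\<integral>\<^sup>+x. ennreal (g x * indicator (- ball 0 R) x) \<partial>lborel) \<le> ennreal \<epsilon>"
proof -
  have [measurable]: "g \<in> borel_measurable borel" using g by auto
  have "(\<lambda>n. LINT x|lborel. g x * indicator (- ball 0 (real n)) x) \<longlonglongrightarrow> integral\<^sup>L (lborel :: R3 measure) (\<lambda>x. 0)"
  proof (rule integral_dominated_convergence[where w = g])
    show "AE x in lborel. (\<lambda>n. g x * indicator (- ball 0 (real n)) x) \<longlonglongrightarrow> 0"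
    proof (rule AE_I2)
      fix x :: R3
      obtain N :: nat where N: "norm x < real N" using reals_Archimedean2 by blast
      have "eventually (\<lambda>n. g x * indicator (- ball 0 (real n)) x = 0) sequentially"
        unfolding eventually_sequentially using N by (intro exI[of _ N]) (auto simp: indicator_def)
      then show "(\<lambda>n. g x * indicator (- ball 0 (real n)) x) \<longlonglongrightarrow> 0" by (rule tendsto_eventually)
    qed
    show "AE x in lborel. norm (g x * indicator (- ball 0 (real n)) x) \<le> g x" for n
      using nn by (intro AE_I2) (auto simp: indicator_def)
  qed (use g in measurable)
  then have "\<forall>\<^sub>F n in sequentially. (LINT x|lborel. g x * indicator (- ball 0 (real n)) x) < \<epsilon>"
    using \<epsilon> by (intro order_tendstoD(2)) auto
  then obtain N where N: "\<And>n. n \<ge> N \<Longrightarrow> (LINT x|lborel. g x * indicator (- ball 0 (real n)) x) < \<epsilon>"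
    by (auto simp: eventually_sequentially)
  have i: "integrable lborel (\<lambda>x. g x * indicator (- ball 0 (real (Suc N))) x)"
    by (rule Bochner_Integration.integrable_bound[OF g]) (use nn in \<open>auto simp: indicator_def\<close>)
  have "(\<integral>\<^sup>+x. ennreal (g x * indicator (- ball 0 (real (Suc N))) x) \<partial>lborel)
      = ennreal (LINT x|lborel. g x * indicator (- ball 0 (real (Suc N))) x)"
    using nn by (intro nn_integral_eq_integral i) auto
  also have "\<dots> \<le> ennreal \<epsilon>" using N[of "Suc N"] by (intro ennreal_leI) auto
  finally show ?thesis by (intro that[of "real (Suc N)"]) auto
qed

context polytrope
begin

section \<open>An Euler-Lagrange inequality for maximisers\<close>

text \<open>The full potential up to sign, in \<open>ennreal\<close> because it may be infinite at
  single points before any regularity is known.\<close>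

definition potn :: "(R3 \<Rightarrow> real) \<Rightarrow> R3 \<Rightarrow> ennreal" where
  "potn f x = (\<integral>\<^sup>+y. ennreal (f y * newton (x - y)) \<partial>lborel)"

lemma potn_measurable: assumes "adm f" shows "potn f \<in> borel_measurable borel"
proof -
  note [measurable] = admD(2)[OF assms] nonneg_borelD(1)[OF nonneg_borel_newton]
  show ?thesis unfolding potn_def by measurable
qed

lemma pair_energy_potn:
  assumes "adm f" "nonneg_borel g"
  shows "pair_energy newton g f = (\<integral>\<^sup>+x. ennreal (g x) * potn f x \<partial>lborel)"
  unfolding potn_def by (intro pair_energy_eq assms admD(1) nonneg_borel_newton)

definition maximizer :: "(R3 \<Rightarrow> real) \<Rightarrow> bool" where
  "maximizer f \<longleftrightarrow> adm f \<and> 0 < mass f \<and> D f f = best * (mass f powr \<alpha> * pint f powr \<beta>)"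

text \<open>Restricting a density to the complement of a set keeps it admissible, so no
  differentiation is involved. With f = r + s, D(f,f) \<le> D(r,r) + 2 D(s,f), while the sharp
  inequality bounds D(r,r) by D(f,f) times (1 - u)^\<alpha> (1 - v)^\<beta>, where u and v are the
  fractions of mass and p-integral removed.\<close>

lemma removal_inequality:
  assumes f: "maximizer f"
  obtains c1 c2 where "0 < c1" "0 < c2"
    "\<And>S. S \<in> sets borel \<Longrightarrow> c1 * mass (restr S f) + c2 * pint (restr S f) \<le> 2 * D (restr S f) f"
proof -
  have a: "adm f" and M: "0 < mass f" and Df: "D f f = best * (mass f powr \<alpha> * pint f powr \<beta>)"
    using f by (auto simp: maximizer_def)
  have X: "0 < pint f" by (rule pint_pos[OF a M])
  define L where "L = D f f"
  have L: "0 < L" unfolding L_def by (rule D_pos[OF a M])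
  define a0 b0 where "a0 = min \<alpha> 1" and "b0 = min \<beta> 1"
  have ab: "0 < a0" "0 < b0" using \<alpha>_pos \<beta>_pos by (auto simp: a0_def b0_def)
  \<comment> \<open>The product of the two factors is bounded once by the factor in \<open>u\<close>
    and once by the factor in \<open>v\<close>; averaging both bounds produces the 2 in the
    denominators.\<close>
  define c1 c2 where "c1 = L * a0 / (2 * mass f)" and "c2 = L * b0 / (2 * pint f)"
  have "c1 * mass (restr S f) + c2 * pint (restr S f) \<le> 2 * D (restr S f) f" if S: "S \<in> sets borel" for S
  proof -
    let ?s = "restr S f" and ?r = "restr (- S) f"
    have S': "- S \<in> sets borel" using S by auto
    have as: "adm ?s" and ar: "adm ?r" by (intro adm_restr a S S')+
    have fe: "f = (\<lambda>x. ?r x + ?s x)" by (auto simp: restr_def indicator_def fun_eq_iff)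
    have "D f f = D ?r f + D ?s f" by (subst (1) fe) (rule D_add_left[OF ar as a])
    also have "D ?r f = D ?r ?r + D ?r ?s" using D_add_right[OF ar as ar] by (simp only: fe[symmetric])
    finally have 1: "D f f = D ?r ?r + D ?r ?s + D ?s f" .
    have 2: "D ?r ?s \<le> D f ?s" using admD(3)[OF a] by (intro D_mono ar as a) (auto simp: restr_def indicator_def)
    have 3: "D f ?s = D ?s f" by (rule D_commute[OF a as])
    define u v where "u = mass ?s / mass f" and "v = pint ?s / pint f"
    have u: "0 \<le> u" "u \<le> 1" using mass_nonneg[OF as] mass_restr_le[OF a S] M by (auto simp: u_def)
    have v: "0 \<le> v" "v \<le> 1" using pint_nonneg[of ?s] pint_restr_le[OF a S] X by (auto simp: v_def)
    have mr: "mass ?r = mass f * (1 - u)" using mass_restr_compl[OF a S] M by (simp add: u_def right_diff_distrib)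
    have pr: "pint ?r = pint f * (1 - v)" using pint_restr_compl[OF a S] X by (simp add: v_def right_diff_distrib)
    have "D ?r ?r \<le> best * (mass ?r powr \<alpha> * pint ?r powr \<beta>)" by (rule D_le_best[OF ar])
    also have "\<dots> = L * ((1 - u) powr \<alpha> * (1 - v) powr \<beta>)"
      unfolding L_def Df mr pr using u v M X by (simp add: powr_mult)
    finally have 4: "D ?r ?r \<le> L * ((1 - u) powr \<alpha> * (1 - v) powr \<beta>)" .
    have A: "(1 - u) powr \<alpha> \<le> 1 - a0 * u" unfolding a0_def by (rule powr_one_minus_le[OF u \<alpha>_pos])
    have B: "(1 - v) powr \<beta> \<le> 1 - b0 * v" unfolding b0_def by (rule powr_one_minus_le[OF v \<beta>_pos])
    have A1: "0 \<le> 1 - a0 * u" "0 \<le> 1 - b0 * v" using order_trans[OF powr_ge_zero A] order_trans[OF powr_ge_zero B] .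
    have A0: "1 - a0 * u \<le> 1" "1 - b0 * v \<le> 1" using ab u v by auto
    have "(1 - u) powr \<alpha> * (1 - v) powr \<beta> \<le> (1 - a0 * u) * 1"
      using A B A0 A1 by (intro mult_mono) auto
    moreover have "(1 - u) powr \<alpha> * (1 - v) powr \<beta> \<le> 1 * (1 - b0 * v)"
      using A B A0 A1 by (intro mult_mono) auto
    ultimately have "(1 - u) powr \<alpha> * (1 - v) powr \<beta> \<le> 1 - (a0 * u + b0 * v) / 2" by (simp add: field_simps)
    then have "L * ((1 - u) powr \<alpha> * (1 - v) powr \<beta>) \<le> L * (1 - (a0 * u + b0 * v) / 2)" using L by (intro mult_left_mono) auto
    then have "L * (a0 * u + b0 * v) / 2 \<le> L - L * ((1 - u) powr \<alpha> * (1 - v) powr \<beta>)" by (simp add: field_simps)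
    also have "\<dots> \<le> 2 * D ?s f" using 1 2 3 4 unfolding L_def by linarith
    also have "L * (a0 * u + b0 * v) / 2 = c1 * mass ?s + c2 * pint ?s"
      by (simp add: c1_def c2_def u_def v_def add_divide_distrib distrib_left)
    finally show ?thesis .
  qed
  then show ?thesis using that[of c1 c2] L ab M X by (auto simp: c1_def c2_def)
qed

text \<open>Removal is tested on the set \<open>S\<close> where the pointwise inequality fails. The
  integrals over \<open>S\<close> compare in the opposite direction, and as the right-hand one is
  finite, \<open>S\<close> must be null.\<close>

lemma euler_lagrange:
  assumes f: "maximizer f"
  obtains c1 c2 where "0 < c1" "0 < c2"
    "AE x in lborel. ennreal (c1 * f x + c2 * f x powr p) \<le> 2 * (ennreal (f x) * potn f x)"
proof -
  obtain c1 c2 where c: "0 < c1" "0 < c2"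
    "\<And>S. S \<in> sets borel \<Longrightarrow> c1 * mass (restr S f) + c2 * pint (restr S f) \<le> 2 * D (restr S f) f"
    using removal_inequality[OF f] by metis
  have a: "adm f" using f by (simp add: maximizer_def)
  note [measurable] = admD(2)[OF a] potn_measurable[OF a]
  define g where "g x = ennreal (c1 * f x + c2 * f x powr p)" for x
  define h where "h x = 2 * (ennreal (f x) * potn f x)" for x
  have [measurable]: "g \<in> borel_measurable borel" "h \<in> borel_measurable borel" unfolding g_def[abs_def] h_def[abs_def] by measurable
  define S where "S = {x. h x < g x}"
  have S[measurable]: "S \<in> sets borel" unfolding S_def by measurable
  have as: "adm (restr S f)" by (intro adm_restr a S)
  note [measurable] = admD(2)[OF as]
  have G: "(\<integral>\<^sup>+x. g x * indicator S x \<partial>lborel) = ennreal (c1 * mass (restr S f) + c2 * pint (restr S f))"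
  proof -
    have "(\<integral>\<^sup>+x. g x * indicator S x \<partial>lborel) = (\<integral>\<^sup>+x. ennreal (c1 * restr S f x + c2 * restr S f x powr p) \<partial>lborel)"
      using c p_gt by (intro nn_integral_cong) (auto simp: g_def restr_def indicator_def)
    also have "\<dots> = ennreal (LINT x|lborel. c1 * restr S f x + c2 * restr S f x powr p)"
      using c admD[OF as] by (intro nn_integral_eq_integral) auto
    also have "(LINT x|lborel. c1 * restr S f x + c2 * restr S f x powr p) = c1 * mass (restr S f) + c2 * pint (restr S f)"
      unfolding mass_def pint_def using admD(4,5)[OF as] by simp
    finally show ?thesis .
  qed
  have H: "(\<integral>\<^sup>+x. h x * indicator S x \<partial>lborel) = ennreal (2 * D (restr S f) f)"
  proof -
    have "(\<integral>\<^sup>+x. h x * indicator S x \<partial>lborel) = (\<integral>\<^sup>+x. 2 * (ennreal (restr S f x) * potn f x) \<partial>lborel)"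
      by (intro nn_integral_cong) (auto simp: h_def restr_def indicator_def)
    also have "\<dots> = 2 * (\<integral>\<^sup>+x. ennreal (restr S f x) * potn f x \<partial>lborel)" by (rule nn_integral_cmult) measurable
    also have "(\<integral>\<^sup>+x. ennreal (restr S f x) * potn f x \<partial>lborel) = ennreal (D (restr S f) f)"
      using pair_energy_potn[OF a admD(1)[OF as]] ennreal_D[OF as a] by simp
    finally show ?thesis by (simp add: ennreal_mult D_nonneg)
  qed
  have le: "(\<integral>\<^sup>+x. g x * indicator S x \<partial>lborel) \<le> (\<integral>\<^sup>+x. h x * indicator S x \<partial>lborel)"
    unfolding G H by (intro ennreal_leI c(3) S)
  have "AE x in lborel. g x * indicator S x \<le> h x * indicator S x"
  proof (rule ccontr)
    assume "\<not> ?thesis"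
    then have "(\<integral>\<^sup>+x. h x * indicator S x \<partial>lborel) < (\<integral>\<^sup>+x. g x * indicator S x \<partial>lborel)"
    proof (intro nn_integral_less)
      show "(\<integral>\<^sup>+x. h x * indicator S x \<partial>lborel) \<noteq> \<infinity>" unfolding H by simp
      show "AE x in lborel. h x * indicator S x \<le> g x * indicator S x" by (auto simp: S_def indicator_def)
    qed auto
    with le show False by simp
  qed
  then have "AE x in lborel. g x \<le> h x"
  proof eventually_elim
    case (elim x)
    show ?case
    proof (cases "x \<in> S")
      case True
      then show ?thesis using elim by simp
    next
      case False
      then show ?thesis by (simp add: S_def)
    qed
  qed
  then show ?thesis using that[OF c(1,2)] by (simp add: g_def h_def)
qed

section \<open>Higher integrability and decay of the potential\<close>

definition memL :: "real \<Rightarrow> (R3 \<Rightarrow> real) \<Rightarrow> bool" where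
  "memL s f \<longleftrightarrow> (\<integral>\<^sup>+x. ennreal (f x powr s) \<partial>lborel) < \<infinity>"

lemma memL_interpolate:
  assumes f: "adm f" and s: "memL s f" and j: "1 \<le> j" "j \<le> s" shows "memL j f"
proof -
  note [measurable] = admD(2)[OF f]
  have le: "f x powr j \<le> f x + f x powr s" for x
  proof (cases "f x \<le> 1")
    case True
    then have "f x powr j \<le> f x powr 1" using j admD(3)[OF f, of x] True by (intro powr_mono') auto
    also have "\<dots> = f x" using admD(3)[OF f] by simp
    finally have "f x powr j \<le> f x" .
    then show ?thesis by (simp add: add_increasing2)
  next
    case False
    then have "f x powr j \<le> f x powr s" using j by (intro powr_mono) auto
    then show ?thesis using admD(3)[OF f, of x] by simp
  qed
  have "(\<integral>\<^sup>+x. ennreal (f x powr j) \<partial>lborel) \<le> (\<integral>\<^sup>+x. ennreal (f x) + ennreal (f x powr s) \<partial>lborel)"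
    using le admD(3)[OF f] by (intro nn_integral_mono) (simp add: ennreal_plus[symmetric] ennreal_leI del: ennreal_plus)
  also have "\<dots> = (\<integral>\<^sup>+x. ennreal (f x) \<partial>lborel) + (\<integral>\<^sup>+x. ennreal (f x powr s) \<partial>lborel)" by (rule nn_integral_add) measurable
  also have "\<dots> < \<infinity>" using s nn_mass[OF f] by (simp add: memL_def)
  finally show ?thesis by (simp add: memL_def)
qed

lemma near_kernel_finite:
  assumes "0 \<le> t" "t < 3" shows "(\<integral>\<^sup>+x. ennreal (near 1 x powr t) \<partial>lborel) < \<infinity>"
proof -
  have "(\<integral>\<^sup>+x. ennreal (near 1 x powr t) \<partial>lborel) \<le> (\<integral>\<^sup>+(x::R3). ennreal (norm x powr - t) * indicator (ball 0 1) x \<partial>lborel)"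
  proof (rule nn_integral_mono)
    fix x :: R3
    show "ennreal (near 1 x powr t) \<le> ennreal (norm x powr - t) * indicator (ball 0 1) x"
    proof (cases "norm x < 1")
      case True
      then have "near 1 x powr t = norm x powr - t" by (simp add: near_def powr_divide powr_minus_divide)
      then show ?thesis using True by simp
    qed (simp add: near_def)
  qed
  also have "\<dots> < \<infinity>" by (rule nn_integral_singular_unit_ball[OF assms])
  finally show ?thesis .
qed

text \<open>Multiplying the Euler--Lagrange inequality by a power of the density and estimating the right-hand side by the
  trilinear Young inequality improves the integrability exponent by a fixed amount, since \<open>p > 6/5\<close>.\<close>

lemma bootstrap:
  assumes f: "maximizer f" and s: "p \<le> s" "memL s f"
  shows "memL (s + (5 * p / 6 - 1)) f"
proof -
  have a: "adm f" using f by (simp add: maximizer_def)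
  note [measurable] = admD(2)[OF a] potn_measurable[OF a]
  obtain c1 c2 where c: "0 < c1" "0 < c2"
    "AE x in lborel. ennreal (c1 * f x + c2 * f x powr p) \<le> 2 * (ennreal (f x) * potn f x)"
    by (rule euler_lagrange[OF f]) (rule that)
  \<comment> \<open>The inequality is multiplied by \<open>f x powr (j - 1)\<close>, so the new
    exponent is \<open>j - 1 + p\<close>, a gain of \<open>5 * p / 6 - 1\<close>. The same shift
    gives \<open>(j + 1) / s < 5 / 3\<close>, that is \<open>t < 3\<close>; both conclusions rest on
    \<open>p > 6 / 5\<close>.\<close>
  define j where "j = s - p / 6"
  have j: "1 \<le> j" "j \<le> s" "0 < j" using s p_gt by (auto simp: j_def)
  have s1: "1 < s" using s p_gt by simp
  have s0: "0 < s" using s1 by simp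
  define t where "t = 1 / (2 - (j + 1) / s)"
  have q: "1 / 3 < 2 - (j + 1) / s" "2 - (j + 1) / s \<le> 1"
  proof -
    have "j + 1 < 5 / 3 * s" using s p_gt by (simp add: j_def)
    then have "(j + 1) / s < 5 / 3" using s0 by (simp add: divide_less_eq)
    then show "1 / 3 < 2 - (j + 1) / s" by simp
    have "s \<le> j + 1" using p_lt by (simp add: j_def)
    then have "1 \<le> (j + 1) / s" using s0 by (simp add: le_divide_eq)
    then show "2 - (j + 1) / s \<le> 1" by simp
  qed
  have t: "1 \<le> t" "t < 3" using q by (auto simp: t_def divide_simps)
  have tt: "1 / (s / j) + 1 / s + 1 / t = 2" using s0 j by (simp add: t_def add_divide_distrib)
  let ?fj = "\<lambda>x. f x powr j"
  have fj: "nonneg_borel ?fj" using admD(2)[OF a] by (auto simp: nonneg_borel_def)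
  have "pair_energy newton ?fj f < \<infinity>"
  proof -
    have "pair_energy newton ?fj f \<le> pair_energy (\<lambda>z. near 1 z + cutoff 1 z) ?fj f"
      by (intro pair_energy_mono newton_le_near_cutoff admD(3)[OF a] nonneg_borelD(2)[OF fj] nonneg_borelD(2)[OF nonneg_borel_newton]) auto
    also have "\<dots> = pair_energy (near 1) ?fj f + pair_energy (cutoff 1) ?fj f"
      by (intro pair_energy_add_kernel nonneg_borel_near nonneg_borel_cutoff admD(1) a fj) auto
    finally have 1: "pair_energy newton ?fj f \<le> pair_energy (near 1) ?fj f + pair_energy (cutoff 1) ?fj f" .
    have "pair_energy (cutoff 1) ?fj f \<le> ennreal 1 * ((\<integral>\<^sup>+x. ennreal (?fj x) \<partial>lborel) * (\<integral>\<^sup>+x. ennreal (f x) \<partial>lborel))"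
      by (intro pair_energy_bounded_kernel admD(1) a fj) (use cutoff_le[of 1] in auto)
    also have "\<dots> < \<infinity>"
      using memL_interpolate[OF a s(2) j(1,2)] nn_mass[OF a] by (simp add: memL_def ennreal_mult_less_top)
    finally have 2: "pair_energy (cutoff 1) ?fj f < \<infinity>" .
    have e: "?fj x powr (s / j) = f x powr s" for x using j by (simp add: powr_powr)
    have "pair_energy (near 1) ?fj f \<le> (\<integral>\<^sup>+x. ennreal (?fj x powr (s / j)) \<partial>lborel) * (\<integral>\<^sup>+x. ennreal (f x powr s) \<partial>lborel)
       + (\<integral>\<^sup>+x. ennreal (?fj x powr (s / j)) \<partial>lborel) * (\<integral>\<^sup>+x. ennreal (near 1 x powr t) \<partial>lborel)
       + (\<integral>\<^sup>+x. ennreal (f x powr s) \<partial>lborel) * (\<integral>\<^sup>+x. ennreal (near 1 x powr t) \<partial>lborel)"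
      by (rule pair_energy_young[OF fj admD(1)[OF a] nonneg_borel_near _ _ t(1) tt]) (use j s1 in auto)
    also have "\<dots> < \<infinity>"
      unfolding e using s(2) near_kernel_finite[of t] t by (simp add: memL_def ennreal_mult_less_top)
    finally have 3: "pair_energy (near 1) ?fj f < \<infinity>" .
    show ?thesis using 1 2 3 by (simp add: le_less_trans[OF 1])
  qed
  then have fin: "(\<integral>\<^sup>+x. ennreal (?fj x) * potn f x \<partial>lborel) < \<infinity>" using pair_energy_potn[OF a fj] by simp
  have "(\<integral>\<^sup>+x. ennreal (f x powr (s + (5 * p / 6 - 1))) \<partial>lborel) \<le> (\<integral>\<^sup>+x. ennreal (2 / c2) * (ennreal (?fj x) * potn f x) \<partial>lborel)"
  proof (rule nn_integral_mono_AE)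
    show "AE x in lborel. ennreal (f x powr (s + (5 * p / 6 - 1))) \<le> ennreal (2 / c2) * (ennreal (?fj x) * potn f x)"
      using c(3)
    proof eventually_elim
      case (elim x)
      show ?case
      proof (cases "f x = 0")
        case True then show ?thesis by simp
      next
        case False
        then have fx: "0 < f x" using admD(3)[OF a, of x] by simp
        have e: "s + (5 * p / 6 - 1) = (j - 1) + p" by (simp add: j_def)
        have "ennreal (c2 * f x powr p) \<le> 2 * (ennreal (f x) * potn f x)"
          using c fx by (intro order_trans[OF ennreal_leI elim]) auto
        then have "ennreal (f x powr (j - 1) / c2) * ennreal (c2 * f x powr p) \<le> ennreal (f x powr (j - 1) / c2) * (2 * (ennreal (f x) * potn f x))"
          by (intro mult_left_mono) auto
        also have "ennreal (f x powr (j - 1) / c2) * ennreal (c2 * f x powr p) = ennreal (f x powr (s + (5 * p / 6 - 1)))"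
          unfolding e powr_add using c by (simp add: ennreal_mult[symmetric])
        also have "ennreal (f x powr (j - 1) / c2) * (2 * (ennreal (f x) * potn f x)) = ennreal (2 / c2) * (ennreal (?fj x) * potn f x)"
        proof -
          have e1: "?fj x = f x powr (j - 1) * f x" using fx powr_add[of "f x" "j - 1" 1] by simp
          have m: "ennreal a * (ennreal 2 * ennreal b) = ennreal (a * (2 * b))" if "0 \<le> a" "0 \<le> b" for a b
            using that ennreal_mult[of a "2 * b"] ennreal_mult[of 2 b] by simp
          have m': "ennreal a * ennreal b = ennreal (a * b)" if "0 \<le> a" "0 \<le> b" for a b
            using ennreal_mult[OF that] by simp
          have "ennreal (f x powr (j - 1) / c2) * (2 * (ennreal (f x) * potn f x))
             = ennreal (f x powr (j - 1) / c2) * (ennreal 2 * ennreal (f x)) * potn f x" by (simp add: mult.assoc)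
          also have "\<dots> = ennreal (f x powr (j - 1) / c2 * (2 * f x)) * potn f x" using c fx by (subst m) auto
          also have "f x powr (j - 1) / c2 * (2 * f x) = 2 / c2 * ?fj x" unfolding e1 by simp
          also have "ennreal (2 / c2 * ?fj x) = ennreal (2 / c2) * ennreal (?fj x)" using c by (subst m') auto
          finally show ?thesis by (simp only: mult.assoc)
        qed
        finally show ?thesis .
      qed
    qed
  qed
  also have "\<dots> = ennreal (2 / c2) * (\<integral>\<^sup>+x. ennreal (?fj x) * potn f x \<partial>lborel)" by (rule nn_integral_cmult) measurable
  also have "\<dots> < \<infinity>" using fin by (simp add: ennreal_mult_less_top)
  finally show ?thesis by (simp add: memL_def)
qed

text \<open>Each bootstrap step adds the same positive amount, so finitely many steps pass the
  exponent 2, and interpolation with L^1 comes back to it. The exponent 2 is the right partner for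
  the kernel, whose square is locally integrable.\<close>

lemma maximizer_square_integrable:
  assumes f: "maximizer f" shows "integrable lborel (\<lambda>x. (f x)\<^sup>2)"
proof -
  have a: "adm f" using f by (simp add: maximizer_def)
  note [measurable] = admD(2)[OF a]
  define \<eta> where "\<eta> = 5 * p / 6 - 1"
  have \<eta>: "0 < \<eta>" using p_gt by (simp add: \<eta>_def)
  have step: "memL (p + real k * \<eta>) f" for k
  proof (induction k)
    case 0
    show ?case using nn_pint[OF a] by (simp add: memL_def)
  next
    case (Suc k)
    have "memL (p + real k * \<eta> + \<eta>) f"
      unfolding \<eta>_def by (rule bootstrap[OF f]) (use Suc \<eta> in \<open>auto simp: \<eta>_def\<close>)
    then show ?case by (simp add: algebra_simps)
  qed
  obtain k :: nat where "2 / \<eta> < real k" using reals_Archimedean2 by blast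
  then have "2 < real k * \<eta>" using \<eta> by (simp add: divide_less_eq)
  then have "memL 2 f" using memL_interpolate[OF a step[of k], of 2] p_gt by simp
  moreover have "f x powr 2 = (f x)\<^sup>2" for x using admD(3)[OF a, of x] by simp
  ultimately have "(\<integral>\<^sup>+x. ennreal ((f x)\<^sup>2) \<partial>lborel) < \<infinity>" by (simp add: memL_def)
  then show ?thesis by (intro integrableI_bounded) auto
qed

text \<open>For |x - y| < 1 the product is split by 2 f k \<le> l k^2 + f^2 / l: the first part
  integrates to a multiple of l, the second is a tail of the integral of f^2. For 1 \<le> |x - y| <
  K the kernel is at most 1 and a tail of the mass remains; beyond K the bound is mass / K.\<close>

lemma potn_vanishes_at_infinity:
  assumes a: "adm f" and sq: "integrable lborel (\<lambda>x. (f x)\<^sup>2)" and \<epsilon>: "0 < \<epsilon>"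
  obtains R where "0 < R" "\<And>x. R \<le> norm x \<Longrightarrow> potn f x \<le> ennreal \<epsilon>"
proof -
  note [measurable] = admD(2)[OF a] nonneg_borelD(1)[OF nonneg_borel_newton] nonneg_borelD(1)[OF nonneg_borel_near]
  define I where "I = (\<integral>\<^sup>+x. ennreal (near 1 x powr 2) \<partial>lborel)"
  define c where "c = enn2real I"
  have Ic: "I = ennreal c" and c: "0 \<le> c" using near_kernel_finite[of 2] by (auto simp: I_def c_def)
  define l where "l = \<epsilon> / (4 * (c + 1))"
  have l: "0 < l" using \<epsilon> c by (simp add: l_def)
  have lc: "l * c \<le> \<epsilon> / 4"
  proof -
    have "l * c \<le> l * (c + 1)" using l by simp
    also have "\<dots> = \<epsilon> / 4" using c unfolding l_def by (simp add: divide_simps)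
    finally show ?thesis .
  qed
  define K where "K = max 1 (4 * mass f / \<epsilon>)"
  have K: "1 \<le> K" "mass f / K \<le> \<epsilon> / 4"
  proof -
    show "1 \<le> K" by (simp add: K_def)
    have "4 * mass f / \<epsilon> \<le> K" by (simp add: K_def)
    then show "mass f / K \<le> \<epsilon> / 4" using \<epsilon> \<open>1 \<le> K\<close> by (simp add: field_simps)
  qed
  have l4: "0 < l * (\<epsilon> / 4)" using l \<epsilon> by simp
  obtain R1 where R1: "0 < R1" "(\<integral>\<^sup>+x. ennreal ((f x)\<^sup>2 * indicator (- ball 0 R1) x) \<partial>lborel) \<le> ennreal (l * (\<epsilon> / 4))"
    by (rule integrable_tail_small[OF sq l4 zero_le_power2]) (rule that)
  have e4: "0 < \<epsilon> / 4" using \<epsilon> by simp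
  obtain R2 where R2: "0 < R2" "(\<integral>\<^sup>+x. ennreal (f x * indicator (- ball 0 R2) x) \<partial>lborel) \<le> ennreal (\<epsilon> / 4)"
    by (rule integrable_tail_small[OF admD(4)[OF a] e4 admD(3)[OF a]]) (rule that)
  \<comment> \<open>For \<open>norm x \<ge> R\<close>, every \<open>y\<close> within distance 1 of
    \<open>x\<close> lies outside \<open>ball 0 R1\<close>, and every \<open>y\<close> within
    distance \<open>K\<close> lies outside \<open>ball 0 R2\<close>.\<close>
  define R where "R = max (R1 + 1) (R2 + K)"
  have "potn f x \<le> ennreal \<epsilon>" if x: "R \<le> norm x" for x
  proof -
    let ?A = "\<lambda>y. ennreal l * ennreal (near 1 (x - y) powr 2)"
    let ?B = "\<lambda>y. ennreal (1 / l) * ennreal ((f y)\<^sup>2 * indicator (- ball 0 R1) y)"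
    let ?C = "\<lambda>y. ennreal (f y * indicator (- ball 0 R2) y)"
    let ?E = "\<lambda>y. ennreal (1 / K) * ennreal (f y)"
    have pt: "ennreal (f y * newton (x - y)) \<le> ?A y + ?B y + ?C y + ?E y" for y
    proof -
      have fy: "0 \<le> f y" by (rule admD(3)[OF a])
      consider "norm (x - y) < 1" | "1 \<le> norm (x - y)" "norm (x - y) < K" | "K \<le> norm (x - y)" by linarith
      then show ?thesis
      proof cases
        case 1
        then have "R1 \<le> norm y" using x norm_triangle_ineq2[of x y] by (simp add: R_def)
        define k where "k = newton (x - y)"
        have kn: "near 1 (x - y) = k" using 1 by (simp add: near_def newton_def k_def)
        have k0: "0 \<le> k" using nonneg_borelD(2)[OF nonneg_borel_newton] by (simp add: k_def)
        have "0 \<le> (l * k - f y)\<^sup>2 / l" using l by simp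
        also have "(l * k - f y)\<^sup>2 / l = (l * (l * k\<^sup>2) - 2 * (l * k) * f y + (f y)\<^sup>2) / l"
          by (rule arg_cong[where f = "\<lambda>z. z / l"]) (simp add: power2_eq_square algebra_simps)
        also have "\<dots> = l * k\<^sup>2 - 2 * (f y * k) + 1 / l * (f y)\<^sup>2"
          using l by (simp add: add_divide_distrib diff_divide_distrib)
        finally have "f y * k \<le> l * k\<^sup>2 + 1 / l * (f y)\<^sup>2" using mult_nonneg_nonneg[OF fy k0] by linarith
        then have "ennreal (f y * k) \<le> ennreal (l * k\<^sup>2 + 1 / l * (f y)\<^sup>2)" by (rule ennreal_leI)
        also have "\<dots> = ennreal (l * k\<^sup>2) + ennreal (1 / l * (f y)\<^sup>2)"
          using l by (intro ennreal_plus) auto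
        also have "ennreal (l * k\<^sup>2) = ennreal l * ennreal (k\<^sup>2)" using l by (intro ennreal_mult) auto
        also have "ennreal (1 / l * (f y)\<^sup>2) = ennreal (1 / l) * ennreal ((f y)\<^sup>2)" using l by (intro ennreal_mult) auto
        also have "ennreal l * ennreal (k\<^sup>2) + ennreal (1 / l) * ennreal ((f y)\<^sup>2) = ?A y + ?B y"
          using k0 \<open>R1 \<le> norm y\<close> unfolding kn by simp
        also have "\<dots> \<le> ?A y + ?B y + (?C y + ?E y)" by simp
        finally show ?thesis by (simp add: k_def add.assoc)
      next
        case 2
        then have "R2 \<le> norm y" using x norm_triangle_ineq2[of x y] by (simp add: R_def)
        have "newton (x - y) \<le> 1" unfolding newton_def using 2 by (subst divide_le_eq_1_pos) auto
        then have "f y * newton (x - y) \<le> f y * 1" using fy by (intro mult_left_mono)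
        then have "ennreal (f y * newton (x - y)) \<le> ?C y" using \<open>R2 \<le> norm y\<close> by (simp add: ennreal_leI)
        also have "\<dots> \<le> ?C y + (?A y + ?B y + ?E y)" by simp
        finally show ?thesis by (simp add: ac_simps)
      next
        case 3
        have "newton (x - y) \<le> 1 / K" unfolding newton_def using 3 K by (intro divide_left_mono mult_pos_pos) auto
        then have "f y * newton (x - y) \<le> 1 / K * f y" using fy by (subst mult.commute) (intro mult_right_mono)
        then have "ennreal (f y * newton (x - y)) \<le> ennreal (1 / K * f y)" by (rule ennreal_leI)
        also have "\<dots> = ?E y" using K fy by (intro ennreal_mult) auto
        also have "\<dots> \<le> ?E y + (?A y + ?B y + ?C y)" by simp
        finally show ?thesis by (simp add: ac_simps)
      qed
    qed
    have "potn f x \<le> (\<integral>\<^sup>+y. ?A y + ?B y + ?C y + ?E y \<partial>lborel)"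
      unfolding potn_def by (intro nn_integral_mono pt)
    also have "\<dots> = (\<integral>\<^sup>+y. ?A y + ?B y + ?C y \<partial>lborel) + (\<integral>\<^sup>+y. ?E y \<partial>lborel)" by (rule nn_integral_add) measurable
    also have "(\<integral>\<^sup>+y. ?A y + ?B y + ?C y \<partial>lborel) = (\<integral>\<^sup>+y. ?A y + ?B y \<partial>lborel) + (\<integral>\<^sup>+y. ?C y \<partial>lborel)" by (rule nn_integral_add) measurable
    also have "(\<integral>\<^sup>+y. ?A y + ?B y \<partial>lborel) = (\<integral>\<^sup>+y. ?A y \<partial>lborel) + (\<integral>\<^sup>+y. ?B y \<partial>lborel)" by (rule nn_integral_add) measurable
    finally have sum: "potn f x \<le> (\<integral>\<^sup>+y. ?A y \<partial>lborel) + (\<integral>\<^sup>+y. ?B y \<partial>lborel) + (\<integral>\<^sup>+y. ?C y \<partial>lborel) + (\<integral>\<^sup>+y. ?E y \<partial>lborel)" .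
    have 1: "(\<integral>\<^sup>+y. ?A y \<partial>lborel) \<le> ennreal (\<epsilon> / 4)"
    proof -
      have "(\<integral>\<^sup>+y. ?A y \<partial>lborel) = ennreal l * (\<integral>\<^sup>+y. ennreal (near 1 (x - y) powr 2) \<partial>lborel)" by (rule nn_integral_cmult) measurable
      also have "(\<integral>\<^sup>+y. ennreal (near 1 (x - y) powr 2) \<partial>lborel) = I" unfolding I_def
        by (rule nn_integral_lborel_reflect[where F = "\<lambda>z. ennreal (near 1 z powr 2)"]) measurable
      also have "ennreal l * I = ennreal (l * c)" unfolding Ic using l c by (simp add: ennreal_mult)
      finally show ?thesis using lc by (simp add: ennreal_leI)
    qed
    have 2: "(\<integral>\<^sup>+y. ?B y \<partial>lborel) \<le> ennreal (\<epsilon> / 4)"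
    proof -
      have "(\<integral>\<^sup>+y. ?B y \<partial>lborel) = ennreal (1 / l) * (\<integral>\<^sup>+y. ennreal ((f y)\<^sup>2 * indicator (- ball 0 R1) y) \<partial>lborel)" by (rule nn_integral_cmult) measurable
      also have "\<dots> \<le> ennreal (1 / l) * ennreal (l * (\<epsilon> / 4))" by (intro mult_left_mono R1) auto
      also have "\<dots> = ennreal (1 / l * (l * (\<epsilon> / 4)))" using l \<epsilon> by (intro ennreal_mult[symmetric]) auto
      finally show ?thesis using l by simp
    qed
    have 3: "(\<integral>\<^sup>+y. ?C y \<partial>lborel) \<le> ennreal (\<epsilon> / 4)" by (rule R2(2))
    have 4: "(\<integral>\<^sup>+y. ?E y \<partial>lborel) \<le> ennreal (\<epsilon> / 4)"
    proof -
      have "(\<integral>\<^sup>+y. ?E y \<partial>lborel) = ennreal (1 / K) * (\<integral>\<^sup>+y. ennreal (f y) \<partial>lborel)" by (rule nn_integral_cmult) measurable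
      also have "\<dots> = ennreal (1 / K * mass f)" unfolding nn_mass[OF a] using K mass_nonneg[OF a] by (intro ennreal_mult[symmetric]) auto
      finally show ?thesis using K by (simp add: ennreal_leI)
    qed
    have "potn f x \<le> ennreal (\<epsilon> / 4) + ennreal (\<epsilon> / 4) + ennreal (\<epsilon> / 4) + ennreal (\<epsilon> / 4)"
      by (rule order_trans[OF sum add_mono[OF add_mono[OF add_mono[OF 1 2] 3] 4]])
    also have "\<dots> = ennreal (\<epsilon> / 4 + \<epsilon> / 4 + \<epsilon> / 4 + \<epsilon> / 4)"
      using \<epsilon> by (simp only: ennreal_plus add_nonneg_nonneg divide_nonneg_nonneg less_imp_le zero_le_numeral)
    also have "\<epsilon> / 4 + \<epsilon> / 4 + \<epsilon> / 4 + \<epsilon> / 4 = \<epsilon>" by simp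
    finally show ?thesis .
  qed
  moreover have "0 < R" using R1 by (simp add: R_def)
  ultimately show ?thesis using that by blast
qed

theorem maximizer_compact_support:
  assumes f: "maximizer f"
  obtains R where "0 < R" "AE x in lborel. R \<le> norm x \<longrightarrow> f x = 0"
proof -
  have a: "adm f" using f by (simp add: maximizer_def)
  obtain c1 c2 where c: "0 < c1" "0 < c2"
    "AE x in lborel. ennreal (c1 * f x + c2 * f x powr p) \<le> 2 * (ennreal (f x) * potn f x)"
    by (rule euler_lagrange[OF f]) (rule that)
  \<comment> \<open>Where the potential is at most \<open>c1 / 4\<close>, the Euler-Lagrange
    inequality yields \<open>c1 * f x \<le> c1 * f x / 2\<close>, hence
    \<open>f x = 0\<close>.\<close>
  have "0 < c1 / 4" using c by simp
  then obtain R where R: "0 < R" "\<And>x. R \<le> norm x \<Longrightarrow> potn f x \<le> ennreal (c1 / 4)"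
    using potn_vanishes_at_infinity[OF a maximizer_square_integrable[OF f]] by metis
  have "AE x in lborel. R \<le> norm x \<longrightarrow> f x = 0" using c(3)
  proof (eventually_elim, intro impI)
    fix x assume elim: "ennreal (c1 * f x + c2 * f x powr p) \<le> 2 * (ennreal (f x) * potn f x)" and x: "R \<le> norm x"
    have fx: "0 \<le> f x" by (rule admD(3)[OF a])
    have "ennreal (c1 * f x) \<le> ennreal (c1 * f x + c2 * f x powr p)" using c by (intro ennreal_leI) auto
    also have "\<dots> \<le> 2 * (ennreal (f x) * potn f x)" by (rule elim)
    also have "\<dots> \<le> ennreal 2 * (ennreal (f x) * ennreal (c1 / 4))" using R(2)[OF x] by (simp add: mult_left_mono)
    also have "\<dots> = ennreal (2 * (f x * (c1 / 4)))" using fx c by (simp only: ennreal_mult mult_nonneg_nonneg zero_le_numeral less_imp_le divide_nonneg_nonneg)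
    finally have "c1 * f x \<le> 2 * (f x * (c1 / 4))" using fx c by (subst (asm) ennreal_le_iff) auto
    then have "c1 * f x \<le> 0" by (simp add: field_simps)
    then show "f x = 0" using c fx by (simp add: mult_le_0_iff)
  qed
  with R(1) show ?thesis by (rule that)
qed

end

section \<open>The weak gradient of the potential\<close>

text \<open>The gradient of -1/|z|, in accordance with the negative sign in
  \<open>grav_potential\<close>; at the origin its value is 0.\<close>

definition grad_kernel :: "R3 \<Rightarrow> R3" where "grad_kernel z = (1 / norm z ^ 3) *\<^sub>R z"

lemma norm_grad_kernel: "norm (grad_kernel z) = 1 / (norm z)\<^sup>2"
  by (cases "z = 0") (auto simp: grad_kernel_def power2_eq_square power3_eq_cube)

lemma grad_kernel_measurable [measurable]: "grad_kernel \<in> borel_measurable borel"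
  unfolding grad_kernel_def by measurable

lemma newton_measurable [measurable]: "newton \<in> borel_measurable borel"
  by (rule nonneg_borelD(1)[OF nonneg_borel_newton])

lemma kernel_bounds: "norm (newton z) \<le> norm z powr - 1" "norm (grad_kernel z) \<le> norm z powr - 2"
  by (cases "z = 0"; simp add: newton_def norm_grad_kernel powr_minus_divide)+

text \<open>The bound is uniform in the position \<open>y\<close> of the singularity: points within
  distance 1 of \<open>y\<close> cost at most the singular integral over the unit ball, all others
  at most the volume of the ball.\<close>

lemma nn_integral_kernel_ball_bounded:
  fixes t R :: real assumes t: "0 \<le> t" "t < 3"
  obtains C where "0 \<le> C"
    "\<And>y. (\<integral>\<^sup>+(x::R3). ennreal (indicator (ball 0 R) x * norm (x - y) powr - t) \<partial>lborel) \<le> ennreal C"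
proof -
  define I where "I = (\<integral>\<^sup>+(x::R3). ennreal (norm x powr - t) * indicator (ball 0 1) x \<partial>lborel)"
  have I: "I = ennreal (enn2real I)" using nn_integral_singular_unit_ball[OF t] by (simp add: I_def)
  define V where "V = measure lborel (ball (0::R3) R)"
  have V: "emeasure lborel (ball (0::R3) R) = ennreal V"
    unfolding V_def using emeasure_lborel_ball_finite[of "0::R3" R] by (intro emeasure_eq_ennreal_measure) auto
  have "(\<integral>\<^sup>+(x::R3). ennreal (indicator (ball 0 R) x * norm (x - y) powr - t) \<partial>lborel) \<le> ennreal (enn2real I + V)" for y
  proof -
    let ?h = "\<lambda>z::R3. ennreal (norm z powr - t) * indicator (ball 0 1) z"
    have hm[measurable]: "?h \<in> borel_measurable borel" by measurable
    have "(\<integral>\<^sup>+(x::R3). ennreal (indicator (ball 0 R) x * norm (x - y) powr - t) \<partial>lborel)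
      \<le> (\<integral>\<^sup>+x. ?h (x - y) + indicator (ball 0 R) x \<partial>lborel)"
    proof (rule nn_integral_mono)
      fix x :: R3
      show "ennreal (indicator (ball 0 R) x * norm (x - y) powr - t) \<le> ?h (x - y) + indicator (ball 0 R) x"
      proof (cases "norm (x - y) < 1")
        case True
        have "ennreal (indicator (ball 0 R) x * norm (x - y) powr - t) \<le> ennreal (norm (x - y) powr - t)"
          by (intro ennreal_leI) (auto simp: indicator_def)
        also have "\<dots> = ?h (x - y)" using True by simp
        finally show ?thesis by (simp add: add_increasing2)
      next
        case False
        then have "norm (x - y) powr - t \<le> 1 powr - t" using t by (intro powr_mono2') auto
        then have "ennreal (indicator (ball 0 R) x * norm (x - y) powr - t) \<le> indicator (ball 0 R) x"
          by (auto simp: indicator_def)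
        then show ?thesis by (simp add: add_increasing)
      qed
    qed
    also have "\<dots> = (\<integral>\<^sup>+x. ?h (x - y) \<partial>lborel) + (\<integral>\<^sup>+(x::R3). indicator (ball 0 R) x \<partial>lborel)"
      by (rule nn_integral_add) measurable
    also have "(\<integral>\<^sup>+x. ?h (x - y) \<partial>lborel) = I" unfolding I_def by (rule nn_integral_lborel_translate[OF hm])
    also have "(\<integral>\<^sup>+(x::R3). indicator (ball 0 R) x \<partial>lborel) = ennreal V" using V by simp
    also have "I + ennreal V = ennreal (enn2real I + V)" by (subst I) (simp add: V_def)
    finally show ?thesis .
  qed
  then show ?thesis by (intro that[of "enn2real I + V"]) (auto simp: V_def)
qed

text \<open>Stated for vector-valued kernels so as to serve both the potential and its gradient.
  Absolute integrability follows by integrating over \<open>x\<close> first, where the bound is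
  uniform in \<open>y\<close>, and then using that \<open>f\<close> is integrable.\<close>

lemma kernel_fubini:
  fixes f \<Psi> :: "R3 \<Rightarrow> real" and \<kappa> :: "R3 \<Rightarrow> 'b::euclidean_space"
  assumes f: "integrable lborel f" and \<Psi>[measurable]: "\<Psi> \<in> borel_measurable borel" and B: "\<And>x. \<bar>\<Psi> x\<bar> \<le> B * indicator (ball 0 R) x"
    and \<kappa>[measurable]: "\<kappa> \<in> borel_measurable borel" and t: "0 \<le> t" "t < 3" and \<kappa>t: "\<And>z. norm (\<kappa> z) \<le> norm z powr - t"
  shows "integrable lborel (\<lambda>x. \<Psi> x *\<^sub>R (LINT y|lborel. f y *\<^sub>R \<kappa> (x - y)))"
    and "integrable lborel (\<lambda>y. f y *\<^sub>R (LINT x|lborel. \<Psi> x *\<^sub>R \<kappa> (x - y)))"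
    and "(LINT x|lborel. \<Psi> x *\<^sub>R (LINT y|lborel. f y *\<^sub>R \<kappa> (x - y))) = (LINT y|lborel. f y *\<^sub>R (LINT x|lborel. \<Psi> x *\<^sub>R \<kappa> (x - y)))"
proof -
  have [measurable]: "f \<in> borel_measurable borel" using f by auto
  obtain C where C: "0 \<le> C"
    "\<And>y. (\<integral>\<^sup>+(x::R3). ennreal (indicator (ball 0 R) x * norm (x - y) powr - t) \<partial>lborel) \<le> ennreal C"
    using nn_integral_kernel_ball_bounded[OF t, of R] by blast
  \<comment> \<open>The hypothesis forces \<open>B\<close> to be nonnegative only if the ball is
    nonempty, hence the absolute value.\<close>
  define B' where "B' = \<bar>B\<bar>"
  have B': "0 \<le> B'" "\<bar>\<Psi> x\<bar> \<le> B' * indicator (ball 0 R) x" for x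
    using B[of x] by (auto simp: B'_def indicator_def split: if_splits)
  let ?F = "\<lambda>(x, y). \<Psi> x *\<^sub>R (f y *\<^sub>R \<kappa> (x - y))"
  have Fm[measurable]: "?F \<in> borel_measurable (lborel \<Otimes>\<^sub>M lborel)" by measurable
  have "(\<integral>\<^sup>+z. norm (?F z) \<partial>(lborel \<Otimes>\<^sub>M lborel)) = (\<integral>\<^sup>+y. (\<integral>\<^sup>+x. ennreal (norm (?F (x, y))) \<partial>lborel) \<partial>lborel)"
    by (rule lborel_pair.nn_integral_snd[symmetric]) measurable
  also have "\<dots> \<le> (\<integral>\<^sup>+y. ennreal (B' * \<bar>f y\<bar>) * ennreal C \<partial>lborel)"
  proof (rule nn_integral_mono)
    fix y
    have "(\<integral>\<^sup>+x. ennreal (norm (?F (x, y))) \<partial>lborel)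
        \<le> (\<integral>\<^sup>+x. ennreal (B' * \<bar>f y\<bar>) * ennreal (indicator (ball 0 R) x * norm (x - y) powr - t) \<partial>lborel)"
    proof (rule nn_integral_mono)
      fix x
      have "norm (?F (x, y)) = \<bar>\<Psi> x\<bar> * (\<bar>f y\<bar> * norm (\<kappa> (x - y)))" by (simp add: abs_mult)
      also have "\<dots> \<le> (B' * indicator (ball 0 R) x) * (\<bar>f y\<bar> * norm (x - y) powr - t)"
        using B' by (intro mult_mono \<kappa>t mult_nonneg_nonneg) (auto simp: indicator_def)
      finally have "norm (?F (x, y)) \<le> (B' * \<bar>f y\<bar>) * (indicator (ball 0 R) x * norm (x - y) powr - t)" by (simp add: mult_ac)
      then have "ennreal (norm (?F (x, y))) \<le> ennreal ((B' * \<bar>f y\<bar>) * (indicator (ball 0 R) x * norm (x - y) powr - t))" by (rule ennreal_leI)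
      also have "\<dots> = ennreal (B' * \<bar>f y\<bar>) * ennreal (indicator (ball 0 R) x * norm (x - y) powr - t)"
        using B' by (intro ennreal_mult) auto
      finally show "ennreal (norm (?F (x, y))) \<le> ennreal (B' * \<bar>f y\<bar>) * ennreal (indicator (ball 0 R) x * norm (x - y) powr - t)" .
    qed
    also have "\<dots> = ennreal (B' * \<bar>f y\<bar>) * (\<integral>\<^sup>+x. ennreal (indicator (ball 0 R) x * norm (x - y) powr - t) \<partial>lborel)"
      by (rule nn_integral_cmult) measurable
    also have "\<dots> \<le> ennreal (B' * \<bar>f y\<bar>) * ennreal C" by (intro mult_left_mono C) auto
    finally show "(\<integral>\<^sup>+x. ennreal (norm (?F (x, y))) \<partial>lborel) \<le> ennreal (B' * \<bar>f y\<bar>) * ennreal C" .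
  qed
  also have "\<dots> = (\<integral>\<^sup>+y. ennreal (B' * C) * ennreal \<bar>f y\<bar> \<partial>lborel)"
    using B' C by (intro nn_integral_cong) (simp add: ennreal_mult[symmetric] mult_ac)
  also have "\<dots> = ennreal (B' * C) * (\<integral>\<^sup>+y. ennreal \<bar>f y\<bar> \<partial>lborel)" by (rule nn_integral_cmult) measurable
  also have "\<dots> < \<infinity>" using f by (auto simp: integrable_iff_bounded ennreal_mult_less_top)
  finally have int: "integrable (lborel \<Otimes>\<^sub>M lborel) ?F" by (intro integrableI_bounded) auto
  have eq1: "(LINT y|lborel. \<Psi> x *\<^sub>R (f y *\<^sub>R \<kappa> (x - y))) = \<Psi> x *\<^sub>R (LINT y|lborel. f y *\<^sub>R \<kappa> (x - y))" for x
    by (rule integral_scaleR_right)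
  have eq2: "(LINT x|lborel. \<Psi> x *\<^sub>R (f y *\<^sub>R \<kappa> (x - y))) = f y *\<^sub>R (LINT x|lborel. \<Psi> x *\<^sub>R \<kappa> (x - y))" for y
    unfolding scaleR_left_commute[of "\<Psi> _"] by (rule integral_scaleR_right)
  show "integrable lborel (\<lambda>x. \<Psi> x *\<^sub>R (LINT y|lborel. f y *\<^sub>R \<kappa> (x - y)))"
    using lborel_pair.integrable_fst'[OF int] by (simp only: prod.case eq1)
  show "integrable lborel (\<lambda>y. f y *\<^sub>R (LINT x|lborel. \<Psi> x *\<^sub>R \<kappa> (x - y)))"
    using lborel_pair.integrable_snd[OF int] by (simp only: prod.case eq2)
  show "(LINT x|lborel. \<Psi> x *\<^sub>R (LINT y|lborel. f y *\<^sub>R \<kappa> (x - y))) = (LINT y|lborel. f y *\<^sub>R (LINT x|lborel. \<Psi> x *\<^sub>R \<kappa> (x - y)))"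
    using lborel_pair.Fubini_integral[OF int] by (simp only: prod.case eq1 eq2)
qed

section \<open>Integration by parts against the Newton kernel\<close>

text \<open>A wider class than \<open>test_function\<close>, stable under translations and under
  multiplication by the regularised kernel, so that both operations remain within one notion without
  tracking higher derivatives.\<close>

definition C1c :: "(R3 \<Rightarrow> real) \<Rightarrow> (R3 \<Rightarrow> R3) \<Rightarrow> bool" where
  "C1c \<phi> D\<phi> \<longleftrightarrow> (\<forall>x. GDERIV \<phi> x :> D\<phi> x) \<and> continuous_on UNIV D\<phi> \<and>
     (\<exists>R>0. \<forall>x. R \<le> norm x \<longrightarrow> \<phi> x = 0 \<and> D\<phi> x = 0)"

lemma gderiv_unique: assumes "GDERIV f x :> a" "GDERIV f x :> b" shows "a = b"
proof -
  have "(\<lambda>h. h \<bullet> a) = (\<lambda>h. h \<bullet> b)" using assms unfolding gderiv_def by (rule has_derivative_unique)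
  then have "(a - b) \<bullet> a = (a - b) \<bullet> b" by metis
  then have "(a - b) \<bullet> (a - b) = 0" by (simp add: inner_diff_right)
  then show ?thesis by simp
qed

lemma gderiv_continuous: assumes "\<And>x. GDERIV f x :> Df x" shows "continuous_on UNIV (f :: R3 \<Rightarrow> real)"
  using assms unfolding gderiv_def by (auto intro!: continuous_at_imp_continuous_on has_derivative_continuous)

lemma test_function_C1c:
  assumes \<phi>: "test_function \<phi>" and D: "\<And>x. GDERIV \<phi> x :> D\<phi> x"
  shows "C1c \<phi> D\<phi>"
proof -
  have "C_k (Suc 0) \<phi>" and comp: "compact (closure {x. \<phi> x \<noteq> 0})" using \<phi> by (auto simp: test_function_def)
  then obtain E where E: "\<And>x. GDERIV \<phi> x :> E x" "\<And>i. continuous_on UNIV (\<lambda>x. E x $ i)" by auto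
  have "E = D\<phi>" using gderiv_unique[OF E(1) D] by blast
  have cont: "continuous_on UNIV D\<phi>"
  proof -
    have "continuous_on UNIV (\<lambda>x. \<chi> i. E x $ i)" by (intro continuous_on_vec_lambda E(2))
    then show ?thesis using \<open>E = D\<phi>\<close> by simp
  qed
  obtain R where R: "\<forall>x\<in>closure {x. \<phi> x \<noteq> 0}. norm x \<le> R"
    using compact_imp_bounded[OF comp] unfolding bounded_iff by blast
  have z: "\<phi> x = 0 \<and> D\<phi> x = 0" if "max 0 R + 1 \<le> norm x" for x
  proof -
    let ?U = "- closure {x. \<phi> x \<noteq> 0}"
    have x: "x \<in> ?U"
    proof
      assume "x \<in> closure {x. \<phi> x \<noteq> 0}"
      then have "norm x \<le> R" using R by blast
      with that show False by simp
    qed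
    have zero: "\<phi> y = 0" if y: "y \<in> ?U" for y
    proof (rule ccontr)
      assume "\<phi> y \<noteq> 0"
      then have "y \<in> closure {x. \<phi> x \<noteq> 0}" by (intro closure_subset[THEN subsetD]) simp
      with y show False by simp
    qed
    have op: "open ?U" by (rule open_Compl[OF closed_closure])
    have "((\<lambda>y. 0::real) has_derivative (\<lambda>h. 0)) (at x)" by (rule has_derivative_const)
    from has_derivative_transform_within_open[OF this op x zero[symmetric]]
    have "(\<phi> has_derivative (\<lambda>h. 0)) (at x)" .
    then have "GDERIV \<phi> x :> 0" by (simp add: gderiv_def)
    from gderiv_unique[OF D this] zero[OF x] show ?thesis by simp
  qed
  show ?thesis unfolding C1c_def
  proof (intro conjI allI)
    show "GDERIV \<phi> x :> D\<phi> x" for x by (rule D)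
    show "continuous_on UNIV D\<phi>" by (rule cont)
    have "0 < max 0 R + 1" by simp
    then show "\<exists>R>0. \<forall>x. R \<le> norm x \<longrightarrow> \<phi> x = 0 \<and> D\<phi> x = 0" using z by blast
  qed
qed

lemma C1c_bounds:
  assumes "C1c \<phi> D\<phi>"
  obtains R B where "0 < R" "0 \<le> B" "\<And>x. \<bar>\<phi> x\<bar> \<le> B * indicator (ball 0 R) x" "\<And>x. norm (D\<phi> x) \<le> B * indicator (ball 0 R) x"
proof -
  obtain R where R: "0 < R" "\<And>x. R \<le> norm x \<Longrightarrow> \<phi> x = 0 \<and> D\<phi> x = 0" using assms by (auto simp: C1c_def)
  have c: "continuous_on (cball 0 R) \<phi>" "continuous_on (cball 0 R) D\<phi>"
    using assms gderiv_continuous[of \<phi> D\<phi>] by (auto simp: C1c_def intro: continuous_on_subset)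
  obtain B1 where B1: "\<And>x. x \<in> cball 0 R \<Longrightarrow> norm (\<phi> x) \<le> B1"
    using compact_imp_bounded[OF compact_continuous_image[OF c(1)]] by (force simp: bounded_iff)
  obtain B2 where B2: "\<And>x. x \<in> cball 0 R \<Longrightarrow> norm (D\<phi> x) \<le> B2"
    using compact_imp_bounded[OF compact_continuous_image[OF c(2)]] by (force simp: bounded_iff)
  define B where "B = max B1 B2"
  have "norm (\<phi> 0) \<le> B1" using R by (intro B1) auto
  then have B: "0 \<le> B" unfolding B_def using norm_ge_zero[of "\<phi> 0"] by linarith
  have 1: "\<bar>\<phi> x\<bar> \<le> B * indicator (ball 0 R) x" for x
    using B1[of x] R(2)[of x] by (cases "R \<le> norm x") (auto simp: B_def)
  have 2: "norm (D\<phi> x) \<le> B * indicator (ball 0 R) x" for x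
    using B2[of x] R(2)[of x] by (cases "R \<le> norm x") (auto simp: B_def)
  show ?thesis by (rule that[OF R(1) B 1 2])
qed

text \<open>The difference quotients in a direction \<open>e\<close> have integral 0 by translation
  invariance, and they converge dominatedly to the directional derivative. This avoids integrating
  coordinate by coordinate.\<close>

lemma C1c_integral_gradient_zero:
  assumes c: "C1c \<psi> D\<psi>"
  shows "(LINT x|lborel. D\<psi> x) = 0"
proof -
  obtain R B where RB: "0 < R" "0 \<le> B" "\<And>x. \<bar>\<psi> x\<bar> \<le> B * indicator (ball 0 R) x" "\<And>x. norm (D\<psi> x) \<le> B * indicator (ball 0 R) x"
    by (rule C1c_bounds[OF c]) (rule that)
  have D: "\<And>x. GDERIV \<psi> x :> D\<psi> x" and "continuous_on UNIV D\<psi>" using c by (auto simp: C1c_def)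
  have [measurable]: "\<psi> \<in> borel_measurable borel" "D\<psi> \<in> borel_measurable borel"
    using gderiv_continuous[of \<psi>, OF D] \<open>continuous_on UNIV D\<psi>\<close> by (auto intro: borel_measurable_continuous_onI)
  have fin: "emeasure lborel (ball (0::R3) r) < \<infinity>" for r by (rule emeasure_lborel_ball_finite)
  have ind: "integrable lborel (\<lambda>x::R3. k * indicator (ball 0 r) x :: real)" for k r using fin by auto
  have Dint: "integrable lborel D\<psi>" by (rule Bochner_Integration.integrable_bound[OF ind[of B R]]) (use RB in \<open>auto intro: order_trans[OF _ abs_ge_self]\<close>)
  have \<psi>int: "integrable lborel \<psi>" by (rule Bochner_Integration.integrable_bound[OF ind[of B R]]) (use RB in \<open>auto intro: order_trans[OF _ abs_ge_self]\<close>)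
  have lip: "\<bar>\<psi> x - \<psi> y\<bar> \<le> B * norm (x - y)" for x y
  proof -
    have "norm (\<psi> x - \<psi> y) \<le> B * norm (x - y)"
    proof (rule differentiable_bound[where S = UNIV and f' = "\<lambda>x h. h \<bullet> D\<psi> x"])
      show "(\<psi> has_derivative (\<lambda>h. h \<bullet> D\<psi> x)) (at x within UNIV)" for x using D[of x] by (simp add: gderiv_def)
      have "norm (D\<psi> x) \<le> B" for x using RB(4)[of x] RB(2) by (cases "x \<in> ball 0 R") auto
      then have "norm h * norm (D\<psi> x) \<le> norm h * B" for h x by (intro mult_left_mono) auto
      then have "\<bar>h \<bullet> D\<psi> x\<bar> \<le> norm h * B" for h x by (rule order_trans[OF Cauchy_Schwarz_ineq2])
      then have "norm (h \<bullet> D\<psi> x) \<le> B * norm h" for h x by (simp add: mult.commute)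
      then show "onorm (\<lambda>h. h \<bullet> D\<psi> x) \<le> B" for x by (rule onorm_bound[OF RB(2)])
    qed auto
    then show ?thesis by simp
  qed
  have "(LINT x|lborel. D\<psi> x) \<bullet> e = 0" for e
  proof (cases "e = 0")
    case False
    define g where "g n x = (\<psi> (x + (1 / real (Suc n)) *\<^sub>R e) - \<psi> x) * real (Suc n)" for n x
    have gm[measurable]: "g n \<in> borel_measurable borel" for n unfolding g_def by measurable
    have shift: "integrable lborel (\<lambda>x. \<psi> (x + a))" "(LINT x|lborel. \<psi> (x + a)) = (LINT x|lborel. \<psi> x)" for a
      using lborel_translate[of \<psi> "- a"] \<psi>int by auto
    have zero: "(LINT x|lborel. g n x) = 0" for n
      unfolding g_def using shift \<psi>int by simp
    have "(\<lambda>n. LINT x|lborel. g n x) \<longlonglongrightarrow> (LINT x|lborel. D\<psi> x \<bullet> e)"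
    \<comment> \<open>The quotients are bounded by the Lipschitz constant times
      \<open>norm e\<close>. The steps are no longer than \<open>norm e\<close>, so all quotients
      vanish outside the enlarged ball.\<close>
    proof (rule integral_dominated_convergence[where w = "\<lambda>x. B * norm e * indicator (ball 0 (R + norm e)) x"])
      show "AE x in lborel. (\<lambda>n. g n x) \<longlonglongrightarrow> D\<psi> x \<bullet> e"
      proof (rule AE_I2)
        fix x
        have "((\<lambda>h. x + h *\<^sub>R e) has_derivative (\<lambda>h. h *\<^sub>R e)) (at 0)" by (auto intro!: derivative_eq_intros)
        moreover have "(\<psi> has_derivative (\<lambda>h. h \<bullet> D\<psi> x)) (at (x + 0 *\<^sub>R e))" using D[of x] by (simp add: gderiv_def)
        ultimately have "((\<lambda>h. \<psi> (x + h *\<^sub>R e)) has_derivative (\<lambda>h. (h *\<^sub>R e) \<bullet> D\<psi> x)) (at 0)"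
          using diff_chain_at[of "\<lambda>h. x + h *\<^sub>R e" "\<lambda>h. h *\<^sub>R e" 0 \<psi> "\<lambda>h. h \<bullet> D\<psi> x"] by (simp add: o_def)
        then have "((\<lambda>h. \<psi> (x + h *\<^sub>R e)) has_field_derivative (D\<psi> x \<bullet> e)) (at 0)"
          by (rule has_derivative_imp_has_field_derivative) (simp add: inner_commute)
        then have lim: "((\<lambda>h. (\<psi> (x + h *\<^sub>R e) - \<psi> x) / h) \<longlongrightarrow> D\<psi> x \<bullet> e) (at 0)"
          unfolding has_field_derivative_iff by simp
        have "filterlim (\<lambda>n. 1 / real (Suc n)) (at 0) sequentially"
          unfolding filterlim_at using LIMSEQ_inverse_real_of_nat by (simp add: inverse_eq_divide)
        from filterlim_compose[OF lim this] show "(\<lambda>n. g n x) \<longlonglongrightarrow> D\<psi> x \<bullet> e"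
          by (simp add: g_def)
      qed
      show "AE x in lborel. norm (g n x) \<le> B * norm e * indicator (ball 0 (R + norm e)) x" for n
      proof (rule AE_I2)
        fix x
        let ?h = "(1 / real (Suc n)) *\<^sub>R e"
        have nh: "norm ?h \<le> norm e" by (simp add: divide_le_eq mult_le_cancel_left1)
        show "norm (g n x) \<le> B * norm e * indicator (ball 0 (R + norm e)) x"
        proof (cases "norm x < R + norm e")
          case True
          have "\<bar>g n x\<bar> = \<bar>\<psi> (x + ?h) - \<psi> x\<bar> * real (Suc n)" by (simp add: g_def abs_mult)
          also have "\<dots> \<le> (B * norm ((x + ?h) - x)) * real (Suc n)" by (intro mult_right_mono lip) auto
          also have "\<dots> = B * norm e" by simp
          finally show ?thesis using True by simp
        next
          case False
          have "norm x - norm ?h \<le> norm (x + ?h)" using norm_triangle_ineq2[of x "- ?h"] by simp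
          then have "R \<le> norm (x + ?h)" "R \<le> norm x" using False nh norm_ge_zero[of e] by linarith+
          then have "\<psi> (x + ?h) = 0" "\<psi> x = 0" using RB(3)[of "x + ?h"] RB(3)[of x] by auto
          then show ?thesis using False by (simp add: g_def)
        qed
      qed
      show "integrable lborel (\<lambda>x::R3. B * norm e * indicator (ball 0 (R + norm e)) x)" by (rule ind)
    qed auto
    then have "(LINT x|lborel. D\<psi> x \<bullet> e) = 0" using LIMSEQ_unique[OF tendsto_const[of 0]] by (simp add: zero)
    then show ?thesis using Dint by simp
  qed simp
  then show ?thesis by (metis inner_eq_zero_iff)
qed

lemma gderiv_regularised_newton:
  fixes \<epsilon> :: real assumes "0 < \<epsilon>"
  shows "GDERIV (\<lambda>x::R3. 1 / sqrt ((norm x)\<^sup>2 + \<epsilon>)) x :> (- (1 / sqrt ((norm x)\<^sup>2 + \<epsilon>) ^ 3)) *\<^sub>R x"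
proof -
  let ?s = "(norm x)\<^sup>2 + \<epsilon>"
  have s: "0 < ?s" using assms by (simp add: add_nonneg_pos)
  have 1: "GDERIV (\<lambda>x::R3. (norm x)\<^sup>2 + \<epsilon>) x :> 2 *\<^sub>R x"
  proof -
    have "((\<lambda>x::R3. x \<bullet> x + \<epsilon>) has_derivative (\<lambda>h. h \<bullet> (2 *\<^sub>R x))) (at x)"
      by (auto intro!: derivative_eq_intros simp: inner_commute algebra_simps)
    then show ?thesis by (simp add: gderiv_def power2_norm_eq_inner)
  qed
  have 2: "DERIV (\<lambda>u. 1 / sqrt u) ?s :> - (1 / (2 * sqrt ?s ^ 3))"
  proof -
    have "sqrt ?s \<noteq> 0" using s by simp
    then show ?thesis using s
      by (auto intro!: derivative_eq_intros simp: power3_eq_cube power2_eq_square field_simps)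
  qed
  show ?thesis using GDERIV_DERIV_compose[OF 1 2] by (rule GDERIV_subst) simp
qed

text \<open>Instead of cutting out a ball around the singularity, the kernel is replaced by
  1/sqrt(|x|^2 + \<epsilon>), which is differentiable everywhere. The product with \<psi> has a
  gradient of integral 0, and \<epsilon> tends to 0 under the dominating powers |x|^(-1) and
  |x|^(-2). The derivative of \<open>newton\<close> is \<open>- grad_kernel\<close>, whence equal
  signs on both sides.\<close>

lemma newton_integration_by_parts:
  assumes c: "C1c \<psi> D\<psi>"
  shows "(LINT x|lborel. newton x *\<^sub>R D\<psi> x) = (LINT x|lborel. \<psi> x *\<^sub>R grad_kernel x)"
proof -
  obtain R B where RB: "0 < R" "0 \<le> B" "\<And>x. \<bar>\<psi> x\<bar> \<le> B * indicator (ball 0 R) x" "\<And>x. norm (D\<psi> x) \<le> B * indicator (ball 0 R) x"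
    by (rule C1c_bounds[OF c]) (rule that)
  have D: "\<And>x. GDERIV \<psi> x :> D\<psi> x" and cD: "continuous_on UNIV D\<psi>" using c by (auto simp: C1c_def)
  have c\<psi>: "continuous_on UNIV \<psi>" by (rule gderiv_continuous[OF D])
  have [measurable]: "\<psi> \<in> borel_measurable borel" "D\<psi> \<in> borel_measurable borel"
    using c\<psi> cD by (auto intro: borel_measurable_continuous_onI)
  define \<epsilon> where "\<epsilon> n = 1 / real (Suc n)" for n
  have \<epsilon>: "0 < \<epsilon> n" for n by (simp add: \<epsilon>_def)
  have \<epsilon>0: "\<epsilon> \<longlonglongrightarrow> 0" unfolding \<epsilon>_def[abs_def] using LIMSEQ_inverse_real_of_nat by (simp add: inverse_eq_divide)
  define q where "q n x = sqrt ((norm x)\<^sup>2 + \<epsilon> n)" for n and x :: R3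
  have q: "0 < q n x" "norm x \<le> q n x" for n x
  proof -
    show "0 < q n x" using \<epsilon>[of n] by (simp add: q_def add_nonneg_pos)
    have "sqrt ((norm x)\<^sup>2) \<le> q n x" unfolding q_def using \<epsilon>[of n] by (intro real_sqrt_le_mono) simp
    then show "norm x \<le> q n x" by simp
  qed
  have qlim: "(\<lambda>n. q n x) \<longlonglongrightarrow> norm x" for x
  proof -
    have "(\<lambda>n. q n x) \<longlonglongrightarrow> sqrt ((norm x)\<^sup>2 + 0)" unfolding q_def by (intro tendsto_intros \<epsilon>0)
    then show ?thesis by simp
  qed
  have qm[measurable]: "q n \<in> borel_measurable borel" for n unfolding q_def by measurable
  have kint: "integrable lborel (\<lambda>x::R3. B * (indicator (ball 0 R) x * norm x powr - t))" if t: "0 \<le> t" "t < 3" for t :: real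
  proof -
    obtain C where "\<And>y. (\<integral>\<^sup>+(x::R3). ennreal (indicator (ball 0 R) x * norm (x - y) powr - t) \<partial>lborel) \<le> ennreal C"
      by (rule nn_integral_kernel_ball_bounded[OF t, of R]) (rule that)
    from this[of 0] have "(\<integral>\<^sup>+(x::R3). ennreal (indicator (ball 0 R) x * norm x powr - t) \<partial>lborel) < \<infinity>" by (auto intro: le_less_trans)
    then have "integrable lborel (\<lambda>x::R3. indicator (ball 0 R) x * norm x powr - t)"
      by (intro integrableI_bounded) (auto simp: abs_mult)
    then show ?thesis by simp
  qed
  have AE0: "AE x in lborel. x \<noteq> (0::R3)" by (rule AE_lborel_singleton)
  have e: "(LINT x|lborel. (1 / q n x) *\<^sub>R D\<psi> x) = (LINT x|lborel. \<psi> x *\<^sub>R ((1 / q n x ^ 3) *\<^sub>R x))" for n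
  proof -
    let ?Dp = "\<lambda>x. \<psi> x *\<^sub>R ((- (1 / q n x ^ 3)) *\<^sub>R x) + (1 / q n x) *\<^sub>R D\<psi> x"
    have cq: "continuous_on UNIV (q n)" unfolding q_def by (intro continuous_intros)
    have "C1c (\<lambda>x. \<psi> x * (1 / q n x)) ?Dp"
      unfolding C1c_def
    proof (intro conjI allI)
      fix x
      have "GDERIV (\<lambda>x. 1 / q n x) x :> (- (1 / q n x ^ 3)) *\<^sub>R x"
        unfolding q_def by (rule gderiv_regularised_newton[OF \<epsilon>])
      from GDERIV_mult[OF D[of x] this] show "GDERIV (\<lambda>x. \<psi> x * (1 / q n x)) x :> ?Dp x"
        by (rule GDERIV_subst) (simp add: add.commute)
    next
      show "continuous_on UNIV ?Dp" using q(1) by (intro continuous_intros cq c\<psi> cD) (auto simp: less_imp_neq[symmetric])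
      show "\<exists>R>0. \<forall>x. R \<le> norm x \<longrightarrow> \<psi> x * (1 / q n x) = 0 \<and> ?Dp x = 0"
        using c by (auto simp: C1c_def)
    qed
    then have z: "(LINT x|lborel. ?Dp x) = 0" by (rule C1c_integral_gradient_zero)
    have i1: "integrable lborel (\<lambda>x. (1 / q n x) *\<^sub>R D\<psi> x)"
    proof (rule Bochner_Integration.integrable_bound[OF kint[of 1]])
      show "AE x in lborel. norm ((1 / q n x) *\<^sub>R D\<psi> x) \<le> norm (B * (indicator (ball 0 R) x * norm x powr - 1))"
        using AE0
      proof eventually_elim
        case (elim x)
        have "1 / q n x \<le> norm x powr - 1" using q(1)[of n x] q(2)[of x n] elim by (simp add: powr_minus_divide frac_le)
        then have "1 / q n x * norm (D\<psi> x) \<le> norm x powr - 1 * (B * indicator (ball 0 R) x)"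
          using RB(4)[of x] q(1)[of n x] by (intro mult_mono) auto
        then show ?case using q(1)[of n x] RB(2) by (simp add: abs_mult mult_ac)
      qed
    qed auto
    have i2: "integrable lborel (\<lambda>x. \<psi> x *\<^sub>R ((1 / q n x ^ 3) *\<^sub>R x))"
    proof (rule Bochner_Integration.integrable_bound[OF kint[of 2]])
      show "AE x in lborel. norm (\<psi> x *\<^sub>R ((1 / q n x ^ 3) *\<^sub>R x)) \<le> norm (B * (indicator (ball 0 R) x * norm x powr - 2))"
        using AE0
      proof eventually_elim
        case (elim x)
        have "norm x / q n x ^ 3 \<le> norm x / norm x ^ 3" using q(1)[of n x] q(2)[of x n] elim by (intro divide_left_mono power_mono mult_pos_pos) auto
        also have "\<dots> = norm x powr - 2" using elim by (simp add: powr_minus_divide power3_eq_cube power2_eq_square)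
        finally have "\<bar>\<psi> x\<bar> * (norm x / q n x ^ 3) \<le> (B * indicator (ball 0 R) x) * norm x powr - 2"
          using RB(3)[of x] q(1)[of n x] RB(2) by (intro mult_mono) auto
        then show ?case using q(1)[of n x] RB(2) by (simp add: abs_mult mult_ac)
      qed
    qed auto
    have "?Dp = (\<lambda>x. (1 / q n x) *\<^sub>R D\<psi> x - \<psi> x *\<^sub>R ((1 / q n x ^ 3) *\<^sub>R x))" by auto
    then show ?thesis using z i1 i2 by simp
  qed
  have l1: "(\<lambda>n. LINT x|lborel. (1 / q n x) *\<^sub>R D\<psi> x) \<longlonglongrightarrow> (LINT x|lborel. newton x *\<^sub>R D\<psi> x)"
  proof (rule integral_dominated_convergence[OF _ _ kint[of 1]])
    show "AE x in lborel. (\<lambda>n. (1 / q n x) *\<^sub>R D\<psi> x) \<longlonglongrightarrow> newton x *\<^sub>R D\<psi> x"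
      using AE0 by eventually_elim (auto simp: newton_def intro!: tendsto_intros qlim)
    show "AE x in lborel. norm ((1 / q n x) *\<^sub>R D\<psi> x) \<le> B * (indicator (ball 0 R) x * norm x powr - 1)" for n
      using AE0
    proof eventually_elim
      case (elim x)
      have "1 / q n x \<le> norm x powr - 1" using q(1)[of n x] q(2)[of x n] elim by (simp add: powr_minus_divide frac_le)
      then have "1 / q n x * norm (D\<psi> x) \<le> norm x powr - 1 * (B * indicator (ball 0 R) x)"
        using RB(4)[of x] q(1)[of n x] by (intro mult_mono) auto
      then show ?case using q(1)[of n x] by (simp add: mult_ac)
    qed
  qed auto
  have l2: "(\<lambda>n. LINT x|lborel. \<psi> x *\<^sub>R ((1 / q n x ^ 3) *\<^sub>R x)) \<longlonglongrightarrow> (LINT x|lborel. \<psi> x *\<^sub>R grad_kernel x)"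
  proof (rule integral_dominated_convergence[OF _ _ kint[of 2]])
    show "AE x in lborel. (\<lambda>n. \<psi> x *\<^sub>R ((1 / q n x ^ 3) *\<^sub>R x)) \<longlonglongrightarrow> \<psi> x *\<^sub>R grad_kernel x"
      using AE0 by eventually_elim (auto simp: grad_kernel_def intro!: tendsto_intros qlim)
    show "AE x in lborel. norm (\<psi> x *\<^sub>R ((1 / q n x ^ 3) *\<^sub>R x)) \<le> B * (indicator (ball 0 R) x * norm x powr - 2)" for n
      using AE0
    proof eventually_elim
      case (elim x)
      have "norm x / q n x ^ 3 \<le> norm x / norm x ^ 3" using q(1)[of n x] q(2)[of x n] elim by (intro divide_left_mono power_mono mult_pos_pos) auto
      also have "\<dots> = norm x powr - 2" using elim by (simp add: powr_minus_divide power3_eq_cube power2_eq_square)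
      finally have "\<bar>\<psi> x\<bar> * (norm x / q n x ^ 3) \<le> (B * indicator (ball 0 R) x) * norm x powr - 2"
        using RB(3)[of x] q(1)[of n x] RB(2) by (intro mult_mono) auto
      then show ?case using q(1)[of n x] by (simp add: abs_mult mult_ac)
    qed
  qed auto
  show ?thesis by (rule LIMSEQ_unique[OF l1]) (use l2 in \<open>simp add: e\<close>)
qed

lemma newton_integration_by_parts_shifted:
  assumes c: "C1c \<phi> D\<phi>"
  shows "(LINT x|lborel. newton (x - y) *\<^sub>R D\<phi> x) = (LINT x|lborel. \<phi> x *\<^sub>R grad_kernel (x - y))"
proof -
  have D: "\<And>x. GDERIV \<phi> x :> D\<phi> x" and cD: "continuous_on UNIV D\<phi>" using c by (auto simp: C1c_def)
  have [measurable]: "\<phi> \<in> borel_measurable borel" "D\<phi> \<in> borel_measurable borel"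
    using gderiv_continuous[of \<phi>, OF D] cD by (auto intro: borel_measurable_continuous_onI)
  have "C1c (\<lambda>x. \<phi> (x + y)) (\<lambda>x. D\<phi> (x + y))"
    unfolding C1c_def
  proof (intro conjI allI)
    fix x
    have "((\<lambda>x. x + y) has_derivative (\<lambda>h. h)) (at x)" by (auto intro!: derivative_eq_intros)
    moreover have "(\<phi> has_derivative (\<lambda>h. h \<bullet> D\<phi> (x + y))) (at (x + y))" using D[of "x + y"] by (simp add: gderiv_def)
    ultimately show "GDERIV (\<lambda>x. \<phi> (x + y)) x :> D\<phi> (x + y)"
      using diff_chain_at[of "\<lambda>x. x + y" "\<lambda>h. h" x \<phi>] by (simp add: gderiv_def o_def)
  next
    show "continuous_on UNIV (\<lambda>x. D\<phi> (x + y))"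
      by (rule continuous_on_compose2[OF cD]) (auto intro!: continuous_intros)
    obtain R where R: "0 < R" "\<And>x. R \<le> norm x \<Longrightarrow> \<phi> x = 0 \<and> D\<phi> x = 0" using c by (auto simp: C1c_def)
    have "R \<le> norm (x + y)" if "R + norm y \<le> norm x" for x
      using that norm_triangle_ineq2[of x "- y"] by simp
    then show "\<exists>R>0. \<forall>x. R \<le> norm x \<longrightarrow> \<phi> (x + y) = 0 \<and> D\<phi> (x + y) = 0"
      using R by (intro exI[of _ "R + norm y"]) (auto simp: add_pos_nonneg)
  qed
  from newton_integration_by_parts[OF this]
  have "(LINT x|lborel. newton x *\<^sub>R D\<phi> (x + y)) = (LINT x|lborel. \<phi> (x + y) *\<^sub>R grad_kernel x)" .
  then show ?thesis
    using lborel_translate(2)[of "\<lambda>x. newton x *\<^sub>R D\<phi> (x + y)" y] lborel_translate(2)[of "\<lambda>x. \<phi> (x + y) *\<^sub>R grad_kernel x" y] by simp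
qed

text \<open>Candidate for the gradient of \<open>grav_potential\<close>. Where the integral diverges
  it takes the default value 0; for admissible densities this happens only on a null set.\<close>

definition grad_pot :: "(R3 \<Rightarrow> real) \<Rightarrow> R3 \<Rightarrow> R3" where
  "grad_pot f x = (LINT y|lborel. f y *\<^sub>R grad_kernel (x - y))"

lemma grav_potential_eq:
  assumes [measurable]: "f \<in> borel_measurable borel"
  shows "grav_potential f x = - (LINT y|lborel. f y *\<^sub>R newton (x - y))"
proof -
  have "(LINT y|lebesgue. f y / norm (x - y)) = (LINT y|lborel. f y / norm (x - y))"
    by (rule integral_completion) measurable
  then show ?thesis by (simp add: grav_potential_def newton_def)
qed

lemma locally_integrable_convolution:
  fixes f :: "R3 \<Rightarrow> real" and \<kappa> :: "R3 \<Rightarrow> 'b::euclidean_space"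
  assumes f: "integrable lborel f"
    and \<kappa>[measurable]: "\<kappa> \<in> borel_measurable borel" and t: "0 \<le> t" "t < 3" and \<kappa>t: "\<And>z. norm (\<kappa> z) \<le> norm z powr - t"
  shows "locally_integrable (\<lambda>x. LINT y|lborel. f y *\<^sub>R \<kappa> (x - y))"
  unfolding locally_integrable_def
proof (intro allI impI)
  fix K :: "R3 set" assume K: "compact K"
  obtain b where b: "\<forall>x\<in>K. norm x \<le> b" using compact_imp_bounded[OF K] unfolding bounded_iff by blast
  have [measurable]: "K \<in> sets borel" using K by (simp add: borel_compact)
  have B: "\<bar>indicator K x\<bar> \<le> 1 * (indicator (ball 0 (b + 1)) x :: real)" for x
    using b by (auto simp: indicator_def)
  have "integrable lborel (\<lambda>x. (indicator K x :: real) *\<^sub>R (LINT y|lborel. f y *\<^sub>R \<kappa> (x - y)))"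
    by (rule kernel_fubini(1)[OF f _ B \<kappa> t \<kappa>t]) measurable
  then show "set_integrable lebesgue K (\<lambda>x. LINT y|lborel. f y *\<^sub>R \<kappa> (x - y))"
    unfolding set_integrable_def by (subst integrable_completion) (auto dest: borel_measurable_integrable)
qed

text \<open>Fubini moves the density outside, for each \<open>y\<close> the derivative is shifted
  from the test function to the kernel centred at \<open>y\<close>, and Fubini moves the density
  back.\<close>

lemma weak_gradient_grav_potential:
  assumes f: "integrable lborel f"
  shows "weak_gradient (grav_potential f) (grad_pot f)"
proof -
  have fm[measurable]: "f \<in> borel_measurable borel" using f by auto
  let ?V = "\<lambda>x. LINT y|lborel. f y *\<^sub>R newton (x - y)"
  have U: "grav_potential f = (\<lambda>x. - ?V x)" using grav_potential_eq[OF fm] by auto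
  have Vm[measurable]: "?V \<in> borel_measurable borel" by measurable
  have Gm[measurable]: "grad_pot f \<in> borel_measurable borel" unfolding grad_pot_def[abs_def] by measurable
  note kn = kernel_bounds(1) and kg = kernel_bounds(2)
  have "locally_integrable ?V" by (rule locally_integrable_convolution[OF f newton_measurable _ _ kn]) auto
  then have liU: "locally_integrable (grav_potential f)" unfolding U locally_integrable_def set_integrable_def by simp
  have liG: "locally_integrable (grad_pot f)" unfolding grad_pot_def[abs_def]
    by (rule locally_integrable_convolution[OF f grad_kernel_measurable _ _ kg]) auto
  have main: "(LINT x|lebesgue. grav_potential f x *\<^sub>R D\<phi> x) = - (LINT x|lebesgue. \<phi> x *\<^sub>R grad_pot f x)"
    if c: "C1c \<phi> D\<phi>" for \<phi> D\<phi>
  proof -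
    obtain R B where RB: "0 < R" "0 \<le> B" "\<And>x. \<bar>\<phi> x\<bar> \<le> B * indicator (ball 0 R) x" "\<And>x. norm (D\<phi> x) \<le> B * indicator (ball 0 R) x"
      by (rule C1c_bounds[OF c]) (rule that)
    have D: "\<And>x. GDERIV \<phi> x :> D\<phi> x" and cD: "continuous_on UNIV D\<phi>" using c by (auto simp: C1c_def)
    have \<phi>m[measurable]: "\<phi> \<in> borel_measurable borel" and Dm[measurable]: "D\<phi> \<in> borel_measurable borel"
      using gderiv_continuous[of \<phi>, OF D] cD by (auto intro: borel_measurable_continuous_onI)
    have L: "(LINT x|lebesgue. grav_potential f x *\<^sub>R D\<phi> x) = - (LINT x|lborel. ?V x *\<^sub>R D\<phi> x)"
      unfolding U by (subst integral_completion) auto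
    have Rr: "(LINT x|lebesgue. \<phi> x *\<^sub>R grad_pot f x) = (LINT x|lborel. \<phi> x *\<^sub>R grad_pot f x)"
      by (rule integral_completion) measurable
    have bV: "\<bar>B * indicator (ball 0 R) x\<bar> \<le> B * indicator (ball 0 R) x" for x :: R3 using RB(2) by (auto simp: indicator_def)
    have "integrable lborel (\<lambda>x. (B * indicator (ball 0 R) x) *\<^sub>R ?V x)"
      by (rule kernel_fubini(1)[OF f _ bV newton_measurable _ _ kn]) auto
    then have intVD: "integrable lborel (\<lambda>x. ?V x *\<^sub>R D\<phi> x)"
    proof (rule Bochner_Integration.integrable_bound)
      show "AE x in lborel. norm (?V x *\<^sub>R D\<phi> x) \<le> norm ((B * indicator (ball 0 R) x) *\<^sub>R ?V x)"
      proof (rule AE_I2)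
        fix x
        have "norm (?V x *\<^sub>R D\<phi> x) = \<bar>?V x\<bar> * norm (D\<phi> x)" by simp
        also have "\<dots> \<le> \<bar>?V x\<bar> * (B * indicator (ball 0 R) x)" by (intro mult_left_mono RB(4)) auto
        also have "\<dots> = norm ((B * indicator (ball 0 R) x) *\<^sub>R ?V x)" using RB(2) by (simp add: abs_mult)
        finally show "norm (?V x *\<^sub>R D\<phi> x) \<le> norm ((B * indicator (ball 0 R) x) *\<^sub>R ?V x)" .
      qed
    qed measurable
    note F2 = kernel_fubini[OF f \<phi>m RB(3) grad_kernel_measurable _ _ kg]
    have R2: "(LINT x|lborel. \<phi> x *\<^sub>R grad_pot f x) = (LINT y|lborel. f y *\<^sub>R (LINT x|lborel. \<phi> x *\<^sub>R grad_kernel (x - y)))"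
      unfolding grad_pot_def by (rule F2(3)) auto
    have i2: "integrable lborel (\<lambda>y. f y *\<^sub>R (LINT x|lborel. \<phi> x *\<^sub>R grad_kernel (x - y)))" by (rule F2(2)) auto
    \<comment> \<open>\<open>kernel_fubini\<close> takes real-valued weights, so the vector field
      \<open>D\<phi>\<close> is first paired with an arbitrary vector \<open>e\<close>.\<close>
    have "(LINT x|lborel. ?V x *\<^sub>R D\<phi> x) \<bullet> e = (LINT x|lborel. \<phi> x *\<^sub>R grad_pot f x) \<bullet> e" for e
    proof -
      have be: "\<bar>D\<phi> x \<bullet> e\<bar> \<le> (B * norm e) * indicator (ball 0 R) x" for x
      proof -
        have "\<bar>D\<phi> x \<bullet> e\<bar> \<le> norm (D\<phi> x) * norm e" by (rule Cauchy_Schwarz_ineq2)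
        also have "\<dots> \<le> (B * indicator (ball 0 R) x) * norm e" by (intro mult_right_mono RB(4)) auto
        finally show ?thesis by (simp add: mult_ac)
      qed
      have em: "(\<lambda>x. D\<phi> x \<bullet> e) \<in> borel_measurable borel" by measurable
      have "(LINT x|lborel. ?V x *\<^sub>R D\<phi> x) \<bullet> e = (LINT x|lborel. (?V x *\<^sub>R D\<phi> x) \<bullet> e)"
        using intVD by (subst integral_inner_left) auto
      also have "\<dots> = (LINT x|lborel. (D\<phi> x \<bullet> e) *\<^sub>R ?V x)" by (simp add: mult.commute)
      also have "\<dots> = (LINT y|lborel. f y *\<^sub>R (LINT x|lborel. (D\<phi> x \<bullet> e) *\<^sub>R newton (x - y)))"
        by (rule kernel_fubini(3)[OF f em be newton_measurable _ _ kn]) auto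
      also have "\<dots> = (LINT y|lborel. (f y *\<^sub>R (LINT x|lborel. \<phi> x *\<^sub>R grad_kernel (x - y))) \<bullet> e)"
      proof (rule Bochner_Integration.integral_cong[OF refl])
        fix y
        have iD: "integrable lborel (\<lambda>x. newton (x - y) *\<^sub>R D\<phi> x)"
        proof -
          obtain C where C: "0 \<le> C" "\<And>y. (\<integral>\<^sup>+(x::R3). ennreal (indicator (ball 0 R) x * norm (x - y) powr - 1) \<partial>lborel) \<le> ennreal C"
            by (rule nn_integral_kernel_ball_bounded[of 1 R]) (auto intro: that)
          have "(\<integral>\<^sup>+x. ennreal (norm (newton (x - y) *\<^sub>R D\<phi> x)) \<partial>lborel)
              \<le> (\<integral>\<^sup>+(x::R3). ennreal B * ennreal (indicator (ball 0 R) x * norm (x - y) powr - 1) \<partial>lborel)"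
          proof (rule nn_integral_mono)
            fix x
            have "norm (newton (x - y) *\<^sub>R D\<phi> x) = norm (newton (x - y)) * norm (D\<phi> x)" by simp
            also have "\<dots> \<le> norm (x - y) powr - 1 * (B * indicator (ball 0 R) x)" by (intro mult_mono kn RB(4)) auto
            finally have "norm (newton (x - y) *\<^sub>R D\<phi> x) \<le> B * (indicator (ball 0 R) x * norm (x - y) powr - 1)" by (simp add: mult_ac)
            then have "ennreal (norm (newton (x - y) *\<^sub>R D\<phi> x)) \<le> ennreal (B * (indicator (ball 0 R) x * norm (x - y) powr - 1))"
              by (rule ennreal_leI)
            also have "\<dots> = ennreal B * ennreal (indicator (ball 0 R) x * norm (x - y) powr - 1)" using RB(2) by (intro ennreal_mult) auto
            finally show "ennreal (norm (newton (x - y) *\<^sub>R D\<phi> x)) \<le> ennreal B * ennreal (indicator (ball 0 R) x * norm (x - y) powr - 1)" .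
          qed
          also have "\<dots> = ennreal B * (\<integral>\<^sup>+(x::R3). ennreal (indicator (ball 0 R) x * norm (x - y) powr - 1) \<partial>lborel)"
            by (rule nn_integral_cmult) measurable
          also have "\<dots> \<le> ennreal B * ennreal C" by (intro mult_left_mono C) auto
          also have "\<dots> < \<infinity>" by (simp add: ennreal_mult_less_top)
          finally show ?thesis by (intro integrableI_bounded) auto
        qed
        have "(LINT x|lborel. (D\<phi> x \<bullet> e) *\<^sub>R newton (x - y)) = (LINT x|lborel. (newton (x - y) *\<^sub>R D\<phi> x) \<bullet> e)"
          by (simp add: mult.commute)
        also have "\<dots> = (LINT x|lborel. newton (x - y) *\<^sub>R D\<phi> x) \<bullet> e" using iD by (subst integral_inner_left) auto
        also have "\<dots> = (LINT x|lborel. \<phi> x *\<^sub>R grad_kernel (x - y)) \<bullet> e"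
          by (simp only: newton_integration_by_parts_shifted[OF c])
        finally show "f y *\<^sub>R (LINT x|lborel. (D\<phi> x \<bullet> e) *\<^sub>R newton (x - y)) = (f y *\<^sub>R (LINT x|lborel. \<phi> x *\<^sub>R grad_kernel (x - y))) \<bullet> e"
          by simp
      qed
      also have "\<dots> = (LINT y|lborel. f y *\<^sub>R (LINT x|lborel. \<phi> x *\<^sub>R grad_kernel (x - y))) \<bullet> e"
        using i2 by (rule integral_inner_left)
      finally show ?thesis by (simp only: R2)
    qed
    then have "(LINT x|lborel. ?V x *\<^sub>R D\<phi> x) = (LINT x|lborel. \<phi> x *\<^sub>R grad_pot f x)" using vector_eq_rdot by blast
    then show ?thesis by (simp only: L Rr)
  qed
  show ?thesis
    unfolding weak_gradient_def using liU liG main test_function_C1c by blast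
qed

section \<open>Square integrability of the gradient\<close>

text \<open>The square is written as a double integral over \<open>y\<close> and \<open>z\<close>;
  after Tonelli the integral over \<open>x\<close> is the one bounded in
  \<open>nn_integral_inverse_square_product\<close>. That bound requires
  \<open>y \<noteq> z\<close>, whose failure is a null set in \<open>z\<close>.\<close>

lemma nn_integral_riesz_square:
  obtains C where "0 \<le> C"
    "\<And>h. nonneg_borel h \<Longrightarrow>
      (\<integral>\<^sup>+x. (\<integral>\<^sup>+y. ennreal (h y * (1 / (norm (x - y))\<^sup>2)) \<partial>lborel)\<^sup>2 \<partial>lborel) \<le> ennreal C * pair_energy newton h h"
proof -
  obtain C where C: "0 \<le> C"
    "\<And>y z::R3. y \<noteq> z \<Longrightarrow>
      (\<integral>\<^sup>+x. ennreal (1 / (norm (x - y))\<^sup>2 * (1 / (norm (x - z))\<^sup>2)) \<partial>lborel) \<le> ennreal (C / norm (y - z))"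
    by (rule nn_integral_inverse_square_product) (rule that)
  have "(\<integral>\<^sup>+x. (\<integral>\<^sup>+y. ennreal (h y * (1 / (norm (x - y))\<^sup>2)) \<partial>lborel)\<^sup>2 \<partial>lborel) \<le> ennreal C * pair_energy newton h h"
    if h: "nonneg_borel h" for h
  proof -
    note hm[measurable] = nonneg_borelD(1)[OF h]
    have hn: "0 \<le> h y" for y by (rule nonneg_borelD(2)[OF h])
    let ?k = "\<lambda>z::R3. 1 / (norm z)\<^sup>2"
    let ?K = "\<lambda>x y. ennreal (h y * ?k (x - y))"
    have "(\<integral>\<^sup>+x. (\<integral>\<^sup>+y. ?K x y \<partial>lborel)\<^sup>2 \<partial>lborel) = (\<integral>\<^sup>+x. (\<integral>\<^sup>+y. (\<integral>\<^sup>+z. ?K x y * ?K x z \<partial>lborel) \<partial>lborel) \<partial>lborel)"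
    proof (rule nn_integral_cong)
      fix x
      have "(\<integral>\<^sup>+y. (\<integral>\<^sup>+z. ?K x y * ?K x z \<partial>lborel) \<partial>lborel) = (\<integral>\<^sup>+y. ?K x y * (\<integral>\<^sup>+z. ?K x z \<partial>lborel) \<partial>lborel)"
        by (intro nn_integral_cong nn_integral_cmult) measurable
      also have "\<dots> = (\<integral>\<^sup>+y. ?K x y \<partial>lborel) * (\<integral>\<^sup>+z. ?K x z \<partial>lborel)" by (rule nn_integral_multc) measurable
      finally show "(\<integral>\<^sup>+y. ?K x y \<partial>lborel)\<^sup>2 = (\<integral>\<^sup>+y. (\<integral>\<^sup>+z. ?K x y * ?K x z \<partial>lborel) \<partial>lborel)"
        by (simp only: power2_eq_square)
    qed
    also have "\<dots> = (\<integral>\<^sup>+y. (\<integral>\<^sup>+x. (\<integral>\<^sup>+z. ?K x y * ?K x z \<partial>lborel) \<partial>lborel) \<partial>lborel)"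
      by (rule lborel_pair.Fubini'[where f = "\<lambda>y x. (\<integral>\<^sup>+z. ?K x y * ?K x z \<partial>lborel)"]) measurable
    also have "\<dots> = (\<integral>\<^sup>+y. (\<integral>\<^sup>+z. (\<integral>\<^sup>+x. ?K x y * ?K x z \<partial>lborel) \<partial>lborel) \<partial>lborel)"
    proof (rule nn_integral_cong)
      fix y
      show "(\<integral>\<^sup>+x. (\<integral>\<^sup>+z. ?K x y * ?K x z \<partial>lborel) \<partial>lborel) = (\<integral>\<^sup>+z. (\<integral>\<^sup>+x. ?K x y * ?K x z \<partial>lborel) \<partial>lborel)"
        by (rule lborel_pair.Fubini') measurable
    qed
    also have "\<dots> \<le> (\<integral>\<^sup>+y. (\<integral>\<^sup>+z. ennreal C * ennreal (h y * h z * newton (y - z)) \<partial>lborel) \<partial>lborel)"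
    proof (rule nn_integral_mono, rule nn_integral_mono_AE)
      fix y
      show "AE z in lborel. (\<integral>\<^sup>+x. ?K x y * ?K x z \<partial>lborel) \<le> ennreal C * ennreal (h y * h z * newton (y - z))"
        using AE_lborel_singleton[of y]
      proof eventually_elim
        case (elim z)
        have "(\<integral>\<^sup>+x. ?K x y * ?K x z \<partial>lborel) = (\<integral>\<^sup>+x. ennreal (h y * h z) * ennreal (?k (x - y) * ?k (x - z)) \<partial>lborel)"
        proof (rule nn_integral_cong)
          fix x
          have "?K x y * ?K x z = ennreal (h y * ?k (x - y) * (h z * ?k (x - z)))" using hn by (intro ennreal_mult[symmetric]) auto
          also have "h y * ?k (x - y) * (h z * ?k (x - z)) = (h y * h z) * (?k (x - y) * ?k (x - z))" by (simp only: mult_ac)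
          also have "ennreal \<dots> = ennreal (h y * h z) * ennreal (?k (x - y) * ?k (x - z))" using hn by (intro ennreal_mult) auto
          finally show "?K x y * ?K x z = ennreal (h y * h z) * ennreal (?k (x - y) * ?k (x - z))" .
        qed
        also have "\<dots> = ennreal (h y * h z) * (\<integral>\<^sup>+x. ennreal (?k (x - y) * ?k (x - z)) \<partial>lborel)" by (rule nn_integral_cmult) measurable
        also have "\<dots> \<le> ennreal (h y * h z) * ennreal (C / norm (y - z))" using elim by (intro mult_left_mono C(2)) auto
        also have "\<dots> = ennreal (h y * h z * (C / norm (y - z)))" using hn C(1) by (intro ennreal_mult[symmetric]) auto
        also have "h y * h z * (C / norm (y - z)) = C * (h y * h z * newton (y - z))" by (simp add: newton_def)
        also have "ennreal \<dots> = ennreal C * ennreal (h y * h z * newton (y - z))"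
          using hn C(1) nonneg_borelD(2)[OF nonneg_borel_newton] by (intro ennreal_mult) auto
        finally show ?case .
      qed
    qed
    also have "\<dots> = (\<integral>\<^sup>+y. ennreal C * (\<integral>\<^sup>+z. ennreal (h y * h z * newton (y - z)) \<partial>lborel) \<partial>lborel)"
      by (intro nn_integral_cong nn_integral_cmult) measurable
    also have "\<dots> = ennreal C * pair_energy newton h h" unfolding pair_energy_def by (rule nn_integral_cmult) measurable
    finally show ?thesis .
  qed
  with C(1) show ?thesis by (rule that)
qed

context polytrope
begin

lemma grad_pot_measurable: "adm f \<Longrightarrow> grad_pot f \<in> borel_measurable borel"
proof -
  assume "adm f"
  note [measurable] = admD(2)[OF this]
  show ?thesis unfolding grad_pot_def[abs_def] by measurable
qed

text \<open>\<open>grad_pot\<close> is additive only where its integral converges absolutely. The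
  finite integral of the square makes that almost everywhere, which justifies subtracting two
  gradients under the integral sign.\<close>

lemma AE_integrable_grad_kernel:
  assumes f: "adm f" shows "AE x in lborel. integrable lborel (\<lambda>y. f y *\<^sub>R grad_kernel (x - y))"
proof -
  note [measurable] = admD(2)[OF f]
  obtain C where C: "0 \<le> C" "\<And>h. nonneg_borel h \<Longrightarrow>
      (\<integral>\<^sup>+x. (\<integral>\<^sup>+y. ennreal (h y * (1 / (norm (x - y))\<^sup>2)) \<partial>lborel)\<^sup>2 \<partial>lborel) \<le> ennreal C * pair_energy newton h h"
    by (rule nn_integral_riesz_square) (rule that)
  have "(\<integral>\<^sup>+x. (\<integral>\<^sup>+y. ennreal (f y * (1 / (norm (x - y))\<^sup>2)) \<partial>lborel)\<^sup>2 \<partial>lborel) \<le> ennreal C * pair_energy newton f f"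
    by (rule C(2)[OF admD(1)[OF f]])
  also have "\<dots> < \<infinity>" using pair_energy_finite[OF f f] by (simp add: ennreal_mult_less_top)
  finally have fin: "(\<integral>\<^sup>+x. (\<integral>\<^sup>+y. ennreal (f y * (1 / (norm (x - y))\<^sup>2)) \<partial>lborel)\<^sup>2 \<partial>lborel) \<noteq> \<infinity>" by simp
  have "AE x in lborel. (\<integral>\<^sup>+y. ennreal (f y * (1 / (norm (x - y))\<^sup>2)) \<partial>lborel)\<^sup>2 \<noteq> \<infinity>"
    by (rule nn_integral_noteq_infinite[OF _ fin]) measurable
  then show ?thesis
  proof eventually_elim
    case (elim x)
    then have "(\<integral>\<^sup>+y. ennreal (f y * (1 / (norm (x - y))\<^sup>2)) \<partial>lborel) < \<infinity>"
      by (auto simp: power2_eq_square ennreal_mult_eq_top_iff less_top)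
    moreover have "norm (f y *\<^sub>R grad_kernel (x - y)) = f y * (1 / (norm (x - y))\<^sup>2)" for y
      using admD(3)[OF f] by (simp add: norm_grad_kernel)
    ultimately show ?case by (intro integrableI_bounded) auto
  qed
qed

text \<open>The constant is the same for all pairs, as convergence along a sequence demands; the
  choice of the zero density for \<open>g\<close> puts a single gradient into L^2.\<close>

theorem grad_pot_diff_L2:
  obtains C where "0 \<le> C"
    "\<And>f g. adm f \<Longrightarrow> adm g \<Longrightarrow> integrable lborel (\<lambda>x. (norm (grad_pot f x - grad_pot g x))\<^sup>2)"
    "\<And>f g. adm f \<Longrightarrow> adm g \<Longrightarrow>
      (LINT x|lborel. (norm (grad_pot f x - grad_pot g x))\<^sup>2) \<le> C * D (\<lambda>x. \<bar>f x - g x\<bar>) (\<lambda>x. \<bar>f x - g x\<bar>)"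
proof -
  obtain C where C: "0 \<le> C" "\<And>h. nonneg_borel h \<Longrightarrow>
      (\<integral>\<^sup>+x. (\<integral>\<^sup>+y. ennreal (h y * (1 / (norm (x - y))\<^sup>2)) \<partial>lborel)\<^sup>2 \<partial>lborel) \<le> ennreal C * pair_energy newton h h"
    by (rule nn_integral_riesz_square) (rule that)
  have main: "(\<integral>\<^sup>+x. ennreal ((norm (grad_pot f x - grad_pot g x))\<^sup>2) \<partial>lborel) \<le> ennreal (C * D (\<lambda>x. \<bar>f x - g x\<bar>) (\<lambda>x. \<bar>f x - g x\<bar>))"
    if f: "adm f" and g: "adm g" for f g
  proof -
    let ?h = "\<lambda>x. \<bar>f x - g x\<bar>"
    have h: "adm ?h" by (rule adm_abs_diff[OF f g])
    have "(\<integral>\<^sup>+x. ennreal ((norm (grad_pot f x - grad_pot g x))\<^sup>2) \<partial>lborel)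
       \<le> (\<integral>\<^sup>+x. (\<integral>\<^sup>+y. ennreal (?h y * (1 / (norm (x - y))\<^sup>2)) \<partial>lborel)\<^sup>2 \<partial>lborel)"
    proof (rule nn_integral_mono_AE)
      show "AE x in lborel. ennreal ((norm (grad_pot f x - grad_pot g x))\<^sup>2) \<le> (\<integral>\<^sup>+y. ennreal (?h y * (1 / (norm (x - y))\<^sup>2)) \<partial>lborel)\<^sup>2"
        using AE_integrable_grad_kernel[OF f] AE_integrable_grad_kernel[OF g]
      proof eventually_elim
        case (elim x)
        have "grad_pot f x - grad_pot g x = (LINT y|lborel. f y *\<^sub>R grad_kernel (x - y) - g y *\<^sub>R grad_kernel (x - y))"
          unfolding grad_pot_def by (rule Bochner_Integration.integral_diff[OF elim, symmetric])
        also have "ennreal (norm \<dots>) \<le> (\<integral>\<^sup>+y. ennreal (norm (f y *\<^sub>R grad_kernel (x - y) - g y *\<^sub>R grad_kernel (x - y))) \<partial>lborel)"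
          by (rule integral_norm_bound_ennreal[OF Bochner_Integration.integrable_diff[OF elim]])
        also have "\<dots> = (\<integral>\<^sup>+y. ennreal (?h y * (1 / (norm (x - y))\<^sup>2)) \<partial>lborel)"
          by (simp add: scaleR_left_diff_distrib[symmetric] norm_grad_kernel)
        finally have le: "ennreal (norm (grad_pot f x - grad_pot g x)) \<le> (\<integral>\<^sup>+y. ennreal (?h y * (1 / (norm (x - y))\<^sup>2)) \<partial>lborel)" .
        have "ennreal ((norm (grad_pot f x - grad_pot g x))\<^sup>2) = (ennreal (norm (grad_pot f x - grad_pot g x)))\<^sup>2"
          by (simp add: ennreal_power)
        also have "\<dots> \<le> (\<integral>\<^sup>+y. ennreal (?h y * (1 / (norm (x - y))\<^sup>2)) \<partial>lborel)\<^sup>2" by (intro power_mono le) auto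
        finally show ?case .
      qed
    qed
    also have "\<dots> \<le> ennreal C * pair_energy newton ?h ?h" by (rule C(2)[OF admD(1)[OF h]])
    also have "\<dots> = ennreal (C * D ?h ?h)" unfolding ennreal_D[OF h h, symmetric] using C(1) D_nonneg by (intro ennreal_mult[symmetric])
    finally show ?thesis .
  qed
  have int: "integrable lborel (\<lambda>x. (norm (grad_pot f x - grad_pot g x))\<^sup>2)" if f: "adm f" and g: "adm g" for f g
  proof -
    note [measurable] = grad_pot_measurable[OF f] grad_pot_measurable[OF g]
    show ?thesis by (rule integrableI_bounded) (use main[OF f g] in \<open>auto intro: le_less_trans\<close>)
  qed
  have le: "(LINT x|lborel. (norm (grad_pot f x - grad_pot g x))\<^sup>2) \<le> C * D (\<lambda>x. \<bar>f x - g x\<bar>) (\<lambda>x. \<bar>f x - g x\<bar>)"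
    if f: "adm f" and g: "adm g" for f g
  proof -
    have "ennreal (LINT x|lborel. (norm (grad_pot f x - grad_pot g x))\<^sup>2) \<le> ennreal (C * D (\<lambda>x. \<bar>f x - g x\<bar>) (\<lambda>x. \<bar>f x - g x\<bar>))"
      using main[OF f g] nn_integral_eq_integral[OF int[OF f g]] by simp
    then show ?thesis using C(1) D_nonneg by (subst (asm) ennreal_le_iff) auto
  qed
  show ?thesis by (rule that[OF C(1) int le])
qed

end

section \<open>The variational problem\<close>

text \<open>Completeness of Lebesgue measure: preimages under \<open>u\<close> and \<open>v\<close>
  differ only within a null set, all of whose subsets are measurable. A general codomain covers
  densities and gradients alike.\<close>

lemma lebesgue_measurable_AE_eq:
  fixes u v :: "R3 \<Rightarrow> 'b::topological_space"
  assumes v: "v \<in> borel_measurable borel" and eq: "AE x in lborel. u x = v x"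
  shows "u \<in> borel_measurable lebesgue"
proof (rule measurableI)
  fix A :: "'b set" assume A: "A \<in> sets borel"
  obtain N where N: "{x \<in> space lborel. \<not> u x = v x} \<subseteq> N" "emeasure lborel N = 0" "N \<in> sets lborel"
    using eq by (rule AE_E)
  have "N \<in> null_sets (lborel :: R3 measure)" using N by auto
  then have N0: "N \<in> null_sets lebesgue" by (rule null_sets_completionI)
  have "u -` A \<inter> space lebesgue = (v -` A - N) \<union> (u -` A \<inter> N)" using N(1) by auto
  moreover have "v -` A - N \<in> sets lebesgue"
  proof -
    have "v -` A \<inter> space borel \<in> sets borel" by (rule measurable_sets[OF v A])
    then have "v -` A - N \<in> sets borel" using N(3) by auto
    then show ?thesis by auto
  qed
  moreover have "u -` A \<inter> N \<in> sets lebesgue"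
    using null_sets_completion_subset[OF _ N0, of "u -` A \<inter> N"] by auto
  ultimately show "u -` A \<inter> space lebesgue \<in> sets lebesgue" by (simp only: sets.Un)
qed auto

lemma lebesgue_AE_eq:
  fixes u v :: "R3 \<Rightarrow> 'b::{banach, second_countable_topology}"
  assumes v: "v \<in> borel_measurable borel" and eq: "AE x in lborel. u x = v x"
  shows "integral\<^sup>L lebesgue u = integral\<^sup>L lborel v" "integrable lebesgue u \<longleftrightarrow> integrable lborel v"
proof -
  have vl: "v \<in> borel_measurable lborel" using v by simp
  have vL: "v \<in> borel_measurable lebesgue" by (rule measurable_completion[OF vl])
  have u: "u \<in> borel_measurable lebesgue" by (rule lebesgue_measurable_AE_eq[OF assms])
  have eq': "AE x in lebesgue. u x = v x" using eq by (rule AE_completion)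
  have "integral\<^sup>L lebesgue u = integral\<^sup>L lebesgue v" by (rule integral_cong_AE[OF u vL eq'])
  also have "\<dots> = integral\<^sup>L lborel v" by (rule integral_completion[OF vl])
  finally show "integral\<^sup>L lebesgue u = integral\<^sup>L lborel v" .
  have "integrable lebesgue u \<longleftrightarrow> integrable lebesgue v" by (rule integrable_cong_AE[OF u vL eq'])
  also have "\<dots> \<longleftrightarrow> integrable lborel v" by (rule integrable_completion[OF vl])
  finally show "integrable lebesgue u \<longleftrightarrow> integrable lborel v" .
qed

lemma AE_lborel_translate:
  assumes "AE x in lborel. P (x :: R3)" shows "AE x in lborel. P (x - a)"
proof -
  obtain N where N: "{x \<in> space lborel. \<not> P x} \<subseteq> N" "emeasure lborel N = 0" "N \<in> sets lborel"
    using assms by (rule AE_E)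
  have [measurable]: "N \<in> sets borel" using N by simp
  have "(\<integral>\<^sup>+x. indicator N (x - a) \<partial>lborel) = (\<integral>\<^sup>+x. indicator N x \<partial>lborel)"
    by (rule nn_integral_lborel_translate) measurable
  also have "\<dots> = 0" using N by simp
  finally have "AE x in lborel. indicator N (x - a) = (0::ennreal)" by (subst (asm) nn_integral_0_iff_AE) auto
  then show ?thesis
  proof eventually_elim
    case (elim x)
    then show ?case using N(1) by (auto simp: indicator_def split: if_splits)
  qed
qed

text \<open>The equality holds at every point because each value is an integral. Hence a weak
  gradient found for a representative is one for the given density.\<close>

lemma grav_potential_cong_AE:
  assumes f: "f \<in> borel_measurable borel" and eq: "AE x in lborel. u x = f x"
  shows "grav_potential u = grav_potential f"
proof
  fix x
  have "(LINT y|lebesgue. u y / norm (x - y)) = (LINT y|lborel. f y / norm (x - y))"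
    using f eq by (intro lebesgue_AE_eq(1)) (measurable, auto)
  moreover have "(LINT y|lebesgue. f y / norm (x - y)) = (LINT y|lborel. f y / norm (x - y))"
    using f by (intro lebesgue_AE_eq(1)) (measurable, auto)
  ultimately show "grav_potential u x = grav_potential f x" by (simp add: grav_potential_def)
qed

context polytrope
begin

lemma E_pot_eq:
  assumes f: "adm f" and eq: "AE x in lborel. u x = f x"
  shows "E_pot u = - (1 / 2) * D f f"
proof -
  note fm[measurable] = admD(2)[OF f]
  have inner: "(LINT y|lebesgue. u x * u y / norm (x - y)) = u x * (LINT y|lborel. f y * newton (x - y))" for x
  proof -
    have "(LINT y|lebesgue. u x * u y / norm (x - y)) = (LINT y|lborel. u x * (f y * newton (x - y)))"
      by (rule lebesgue_AE_eq(1)) (measurable, use eq in eventually_elim, simp add: newton_def)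
    then show ?thesis by simp
  qed
  \<comment> \<open>At points where the inner integral diverges, the Bochner integral of
    \<open>E_pot\<close> has the default value 0 and disagrees with \<open>pair_energy\<close>;
    finiteness of the energy makes these points negligible.\<close>
  have fin: "AE x in lborel. (\<integral>\<^sup>+y. ennreal (f x * f y * newton (x - y)) \<partial>lborel) \<noteq> \<infinity>"
    by (rule nn_integral_noteq_infinite) (use pair_energy_finite[OF f f] in \<open>auto simp: pair_energy_def\<close>)
  have "(LINT x|lebesgue. LINT y|lebesgue. u x * u y / norm (x - y)) = (LINT x|lborel. f x * (LINT y|lborel. f y * newton (x - y)))"
    unfolding inner by (rule lebesgue_AE_eq(1)) (measurable, use eq in eventually_elim, simp)
  also have "\<dots> = (LINT x|lborel. LINT y|lborel. f x * f y * newton (x - y))" by (simp add: mult.assoc)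
  also have "\<dots> = D f f"
  proof -
    have nn: "0 \<le> f x * f y * newton (x - y)" for x y
      using admD(3)[OF f] nonneg_borelD(2)[OF nonneg_borel_newton] by simp
    have i: "(LINT y|lborel. f x * f y * newton (x - y)) = enn2real (\<integral>\<^sup>+y. ennreal (f x * f y * newton (x - y)) \<partial>lborel)" for x
      by (rule integral_eq_nn_integral) (use nn in auto)
    have "(LINT x|lborel. LINT y|lborel. f x * f y * newton (x - y)) = enn2real (\<integral>\<^sup>+x. ennreal (LINT y|lborel. f x * f y * newton (x - y)) \<partial>lborel)"
      by (rule integral_eq_nn_integral) (use nn in \<open>auto intro!: integral_nonneg_AE\<close>)
    also have "(\<integral>\<^sup>+x. ennreal (LINT y|lborel. f x * f y * newton (x - y)) \<partial>lborel) = pair_energy newton f f"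
      unfolding pair_energy_def i
      by (rule nn_integral_cong_AE, use fin in eventually_elim) (simp add: less_top)
    finally show ?thesis by (simp add: D_def)
  qed
  finally show ?thesis by (simp add: E_pot_def)
qed

lemma adm_cong_AE:
  assumes f: "adm f" and eq: "AE x in lborel. u x = f x"
  shows "u \<in> borel_measurable lebesgue" "u \<in> Lp 1" "u \<in> Lp p" "AE x in lebesgue. 0 \<le> u x"
    "(LINT x|lebesgue. u x) = mass f" "(LINT x|lebesgue. u x powr p) = pint f"
proof -
  note fm[measurable] = admD(2)[OF f]
  have fn: "norm (f x) powr q = f x powr q" for x q using admD(3)[OF f, of x] by simp
  have f1: "f x powr 1 = f x" for x using admD(3)[OF f, of x] by simp
  show u: "u \<in> borel_measurable lebesgue" by (rule lebesgue_measurable_AE_eq[OF fm eq])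
  have i: "integrable lebesgue (\<lambda>x. norm (u x) powr q) \<longleftrightarrow> integrable lborel (\<lambda>x. f x powr q)" for q
    by (rule lebesgue_AE_eq(2)) (measurable, use eq in eventually_elim, simp add: fn del: real_norm_def)
  have "integrable lebesgue (\<lambda>x. norm (u x) powr 1)" "integrable lebesgue (\<lambda>x. norm (u x) powr p)"
    unfolding i f1 using admD(4,5)[OF f] by auto
  then show "u \<in> Lp 1" "u \<in> Lp p" using u unfolding Lp_def by blast+
  have "AE x in lborel. 0 \<le> u x" using eq by eventually_elim (simp add: admD(3)[OF f])
  then show "AE x in lebesgue. 0 \<le> u x" by (rule AE_completion)
  show "(LINT x|lebesgue. u x) = mass f" unfolding mass_def by (rule lebesgue_AE_eq(1)[OF fm eq])
  show "(LINT x|lebesgue. u x powr p) = pint f" unfolding pint_def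
    by (rule lebesgue_AE_eq(1)) (measurable, use eq in eventually_elim, simp)
qed

lemma borel_representative:
  assumes "u \<in> Lp 1" "u \<in> Lp p" "AE x in lebesgue. 0 \<le> u x"
  obtains f where "adm f" "AE x in lborel. u x = f x"
proof -
  have um: "u \<in> borel_measurable lebesgue" using assms by (simp add: Lp_def)
  obtain g where g: "g \<in> borel_measurable lborel" "AE x in lborel. u x = g x"
    using completion_ex_borel_measurable_real[OF um] by blast
  define f where "f x = max 0 (g x)" for x
  have fm[measurable]: "f \<in> borel_measurable borel" unfolding f_def[abs_def] using g(1) by measurable
  have "AE x in lborel. 0 \<le> u x" using assms(3) by (simp add: AE_completion_iff)
  with g(2) have eq: "AE x in lborel. u x = f x" by eventually_elim (simp add: f_def)
  have nn: "0 \<le> f x" for x by (simp add: f_def)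
  have i: "integrable lebesgue (\<lambda>x. norm (u x) powr q) \<longleftrightarrow> integrable lborel (\<lambda>x. f x powr q)" for q
    by (rule lebesgue_AE_eq(2)) (measurable, use eq in eventually_elim, simp add: nn)
  have f1: "f x powr 1 = f x" for x using nn by simp
  have "integrable lebesgue (\<lambda>x. norm (u x) powr 1)" "integrable lebesgue (\<lambda>x. norm (u x) powr p)"
    using assms(1,2) unfolding Lp_def by blast+
  then have "adm f" unfolding i f1 using nn fm by (auto simp: adm_def nonneg_borel_def)
  with eq show ?thesis by (intro that)
qed

lemma Lp_norm_diff:
  assumes f: "adm f" and g: "adm g" and u: "AE x in lborel. u x = f x"
  shows "Lp_norm p (\<lambda>x. u x - g x) = pint (\<lambda>x. \<bar>f x - g x\<bar>) powr (1 / p)"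
proof -
  note [measurable] = admD(2)[OF f] admD(2)[OF g]
  have "(LINT x|lebesgue. norm (u x - g x) powr p) = (LINT x|lborel. \<bar>f x - g x\<bar> powr p)"
    by (rule lebesgue_AE_eq(1)) (measurable, use u in eventually_elim, simp)
  then show ?thesis by (simp add: Lp_norm_def pint_def)
qed

text \<open>Completing the square in the variable \<open>t = pint f powr \<beta>\<close>, with
  \<open>d\<close> the energy \<open>D f f\<close> and \<open>c = best * M powr \<alpha>\<close>.
  The square retained on the left later forces \<open>t\<close> to converge.\<close>

lemma energy_below:
  fixes A c t d :: real
  assumes A: "0 < A" and d: "d \<le> c * t"
  shows "A * (t - c / (4 * A))\<^sup>2 - c\<^sup>2 / (16 * A) \<le> A * t\<^sup>2 - d / 2"
proof -
  have "A * (t - c / (4 * A))\<^sup>2 - c\<^sup>2 / (16 * A) = A * t\<^sup>2 - c * t / 2"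
    using A by (simp add: power2_eq_square field_simps)
  with d show ?thesis by simp
qed

lemma best_approx:
  assumes f: "adm f" "0 < mass f" and b: "b < best"
  obtains g where "adm g" "mass g = 1" "pint g = 1" "b < D g g"
proof -
  obtain g0 where g0: "adm g0" "mass g0 = 1" "pint g0 = 1" using normalize[OF f] by metis
  let ?S = "{D f f |f. adm f \<and> mass f = 1 \<and> pint f = 1}"
  have "?S \<noteq> {}" using g0 by blast
  then obtain y where "y \<in> ?S" "b < y" using b less_cSupE[of b ?S] unfolding best_def by blast
  then show ?thesis using that by blast
qed

end

lemma nonneg_limit_powr:
  fixes f :: "nat \<Rightarrow> real"
  assumes "f \<longlonglongrightarrow> 0" "\<And>n. 0 \<le> f n" "0 < q" shows "(\<lambda>n. f n powr q) \<longlonglongrightarrow> 0"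
proof -
  have "(\<lambda>n. f n powr q) \<longlonglongrightarrow> 0 powr q"
    using assms by (intro tendsto_powr' tendsto_intros) auto
  then show ?thesis by simp
qed

theorem theorem1:
  fixes K \<mu> M J :: real and \<rho> :: "nat \<Rightarrow> real ^ 3 \<Rightarrow> real"
  assumes "K > 0" and "0 < \<mu>" and "\<mu> < 7 / 2" and "M > 0" and "J > 0"
    and "\<And>n. \<rho> n \<in> constraint_set \<mu> M"
    and "(\<lambda>n. energy K \<mu> J (\<rho> n)) \<longlonglongrightarrow> (INF \<sigma>\<in>constraint_set \<mu> M. energy K \<mu> J \<sigma>)"
  shows "\<exists>(T :: nat \<Rightarrow> (real ^ 3 \<Rightarrow> real) \<Rightarrow> (real ^ 3 \<Rightarrow> real)) (r :: nat \<Rightarrow> nat)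
            (R :: real) (\<rho>\<^sub>0 :: real ^ 3 \<Rightarrow> real).
     (\<forall>n. translation (T n)) \<and> strict_mono r \<and> R > 0 \<and>
     (\<lambda>n. LINT x:{x. norm x \<ge> R}|lebesgue. T n (\<rho> (r n)) x) \<longlonglongrightarrow> 0 \<and>
     Lp_converges (expo \<mu>) (\<lambda>n. T n (\<rho> (r n))) \<rho>\<^sub>0 \<and>
     (LINT x:cball 0 R|lebesgue. \<rho>\<^sub>0 x) = M \<and>
     ess_supp \<rho>\<^sub>0 \<subseteq> cball 0 R \<and>
     (\<exists>(G :: nat \<Rightarrow> real ^ 3 \<Rightarrow> real ^ 3) (G\<^sub>0 :: real ^ 3 \<Rightarrow> real ^ 3).
        (\<forall>n. weak_gradient (grav_potential (T n (\<rho> (r n)))) (G n)) \<and>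
        weak_gradient (grav_potential \<rho>\<^sub>0) G\<^sub>0 \<and>
        Lp_converges 2 G G\<^sub>0) \<and>
     is_arg_min (energy K \<mu> J) (\<lambda>\<sigma>. \<sigma> \<in> constraint_set \<mu> M) \<rho>\<^sub>0"
proof -
  define p where "p = expo \<mu>"
  have p_eq: "p = 1 + 2 / (2 * \<mu> + 3)" using assms(2) by (simp add: p_def expo_def field_simps)
  interpret polytrope p
  proof
    have "1 / 5 < 2 / (2 * \<mu> + 3)" using assms(2,3) by (simp add: field_simps)
    then show "6 / 5 < p" unfolding p_eq by simp
    have "2 / (2 * \<mu> + 3) < 1" using assms(2) by simp
    then show "p < 2" unfolding p_eq by simp
  qed
  \<comment> \<open>From \<open>p - 1 = 2 / (2 * \<mu> + 3)\<close>. The even multiple of \<beta> is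
    what makes the energy quadratic in \<open>pint f powr \<beta>\<close>.\<close>
  have \<beta>_eq: "(2 * \<mu> + 3) / 3 = 2 * \<beta>" unfolding \<beta>_def unfolding p_eq using assms(2) by (simp add: field_simps)
  have p0: "0 < p" using p_gt by simp
  define A where "A = K / J powr (2 * (\<mu> + 1) / 3)"
  have A: "0 < A" using assms(1,5) by (simp add: A_def)
  have energy_eq: "energy K \<mu> J u = A * (pint f powr \<beta>)\<^sup>2 - D f f / 2"
    if "adm f" "AE x in lborel. u x = f x" for u f
  proof -
    have "pint f powr (2 * \<beta>) = (pint f powr \<beta>)\<^sup>2" using powr_add[of "pint f" \<beta> \<beta>] by (simp add: power2_eq_square)
    then show ?thesis
      using adm_cong_AE(6)[OF that] E_pot_eq[OF that] by (simp add: energy_def A_def \<beta>_eq p_def[symmetric])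
  qed
  have rep: "\<exists>f. adm f \<and> mass f = M \<and> (AE x in lborel. u x = f x)" if u: "u \<in> constraint_set \<mu> M" for u
  proof -
    have "u \<in> Lp 1" "u \<in> Lp p" "AE x in lebesgue. 0 \<le> u x" "(LINT x|lebesgue. u x) = M"
      using u by (auto simp: constraint_set_def p_def)
    then show ?thesis using borel_representative[of u] adm_cong_AE(5) by metis
  qed
  have constr: "u \<in> constraint_set \<mu> M" if "adm f" "mass f = M" "AE x in lborel. u x = f x" for u f
    using adm_cong_AE[OF that(1,3)] that(2) by (simp add: constraint_set_def p_def)
  obtain f where f: "\<And>n. adm (f n)" "\<And>n. mass (f n) = M" "\<And>n. AE x in lborel. \<rho> n x = f n x"
    using rep[OF assms(6)] by metis
  define c where "c = best * M powr \<alpha>"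
  have best: "0 < best" using best_pos[OF f(1)] f(2) assms(4) by simp
  have c: "0 < c" using best assms(4) by (simp add: c_def)
  \<comment> \<open>Minimum point of \<open>A * t\<^sup>2 - c * t / 2\<close>; the value there is
    \<open>h\<close>.\<close>
  define ts where "ts = c / (4 * A)"
  have ts: "0 < ts" using c A by (simp add: ts_def)
  define h where "h = - (c\<^sup>2 / (16 * A))"
  have below: "A * (pint g powr \<beta> - ts)\<^sup>2 + h \<le> energy K \<mu> J u" if "adm g" "mass g = M" "AE x in lborel. u x = g x" for u g
  proof -
    have "D g g \<le> c * pint g powr \<beta>" using D_le_best[OF that(1)] that(2) by (simp add: c_def mult.assoc)
    from energy_below[OF A this] show ?thesis unfolding energy_eq[OF that(1,3)] ts_def h_def by simp
  qed
  have lower: "h \<le> energy K \<mu> J u" if u: "u \<in> constraint_set \<mu> M" for u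
  proof -
    obtain g where g: "adm g" "mass g = M" "AE x in lborel. u x = g x" using rep[OF u] by blast
    have "0 \<le> A * (pint g powr \<beta> - ts)\<^sup>2" using A by simp
    then show ?thesis using below[OF g] by linarith
  qed
  have inf_le: "(INF \<sigma>\<in>constraint_set \<mu> M. energy K \<mu> J \<sigma>) \<le> h"
  proof (rule field_le_epsilon)
    fix e :: real assume e: "0 < e"
    \<comment> \<open>Lowering \<open>best\<close> to \<open>b\<close> changes the energy of the
      rescaled trial density by at most \<open>M powr \<alpha> * ts * (best - b) / 2\<close>, which
      is \<open>e\<close>.\<close>
    define b where "b = best - 2 * e / (M powr \<alpha> * ts)"
    have "0 < 2 * e / (M powr \<alpha> * ts)" using e ts assms(4) by simp
    then have "b < best" by (simp add: b_def)
    moreover have "0 < mass (f 0)" using f(2) assms(4) by simp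
    ultimately obtain g where g: "adm g" "mass g = 1" "pint g = 1" "b < D g g"
      using best_approx[OF f(1)[of 0]] by metis
    obtain k where k: "adm k" "mass k = M" "pint k powr \<beta> = ts" "D k k = M powr \<alpha> * ts * D g g"
      using rescale[OF g(1-3) assms(4) ts] by metis
    have "k \<in> constraint_set \<mu> M" by (rule constr[OF k(1,2)]) simp
    then have "(INF \<sigma>\<in>constraint_set \<mu> M. energy K \<mu> J \<sigma>) \<le> energy K \<mu> J k"
      using lower by (intro cINF_lower bdd_belowI2[of _ h]) auto
    also have "\<dots> = A * ts\<^sup>2 - D k k / 2" using energy_eq[OF k(1), of k] k(3) by simp
    also have "\<dots> \<le> A * ts\<^sup>2 - (M powr \<alpha> * ts * b) / 2"
      unfolding k(4) using g(4) ts assms(4) by (intro diff_left_mono divide_right_mono mult_left_mono) auto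
    also have "M powr \<alpha> * ts * b = c * ts - 2 * e"
      using ts assms(4) by (simp add: b_def c_def right_diff_distrib)
    also have "A * ts\<^sup>2 - (c * ts - 2 * e) / 2 = h + e"
      using A by (simp add: ts_def h_def power2_eq_square field_simps)
    finally show "(INF \<sigma>\<in>constraint_set \<mu> M. energy K \<mu> J \<sigma>) \<le> h + e" .
  qed
  have inf_ge: "h \<le> (INF \<sigma>\<in>constraint_set \<mu> M. energy K \<mu> J \<sigma>)"
    using assms(6)[of 0] by (intro cINF_greatest lower) auto
  have Elim: "(\<lambda>n. energy K \<mu> J (\<rho> n)) \<longlonglongrightarrow> h" using assms(7) antisym[OF inf_le inf_ge] by simp
  define t where "t n = pint (f n) powr \<beta>" for n
  \<comment> \<open>The square kept in \<open>energy_below\<close> is bounded by the excess of the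
    energy over the infimum \<open>h\<close>, divided by \<open>A\<close>.\<close>
  have tlim: "t \<longlonglongrightarrow> ts"
  proof -
    have "(\<lambda>n. (energy K \<mu> J (\<rho> n) - h) / A) \<longlonglongrightarrow> (h - h) / A" by (intro tendsto_intros Elim) (use A in auto)
    then have l0: "(\<lambda>n. (energy K \<mu> J (\<rho> n) - h) / A) \<longlonglongrightarrow> 0" by simp
    have le: "(t n - ts)\<^sup>2 \<le> (energy K \<mu> J (\<rho> n) - h) / A" for n
      using below[OF f(1) f(2) f(3), of n] A by (simp add: t_def field_simps)
    have "(\<lambda>n. (t n - ts)\<^sup>2) \<longlonglongrightarrow> 0"
      by (rule tendsto_sandwich[OF _ _ tendsto_const l0]) (use le in auto)
    then have "(\<lambda>n. sqrt ((t n - ts)\<^sup>2)) \<longlonglongrightarrow> sqrt 0" by (rule tendsto_real_sqrt)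
    then have "(\<lambda>n. t n - ts) \<longlonglongrightarrow> 0" by (simp add: tendsto_rabs_zero_iff)
    then show ?thesis by (simp add: LIM_zero_iff)
  qed
  define X where "X = ts powr (1 / \<beta>)"
  have X: "0 < X" "X powr \<beta> = ts" using ts \<beta>_pos by (auto simp: X_def powr_powr)
  have Xlim: "(\<lambda>n. pint (f n)) \<longlonglongrightarrow> X"
  proof -
    have "(\<lambda>n. t n powr (1 / \<beta>)) \<longlonglongrightarrow> X" unfolding X_def using ts by (intro tendsto_powr tlim tendsto_const) auto
    moreover have "t n powr (1 / \<beta>) = pint (f n)" for n
      using \<beta>_pos pint_nonneg[of "f n"] by (simp add: t_def powr_powr)
    ultimately show ?thesis by simp
  qed
  have Dlim: "(\<lambda>n. D (f n) (f n)) \<longlonglongrightarrow> best * (M powr \<alpha> * X powr \<beta>)"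
  proof -
    have "(\<lambda>n. 2 * (A * (t n)\<^sup>2 - energy K \<mu> J (\<rho> n))) \<longlonglongrightarrow> 2 * (A * ts\<^sup>2 - h)"
      by (intro tendsto_intros tlim Elim)
    moreover have "2 * (A * (t n)\<^sup>2 - energy K \<mu> J (\<rho> n)) = D (f n) (f n)" for n
      using energy_eq[OF f(1) f(3), of n] by (simp add: t_def)
    moreover have "2 * (A * ts\<^sup>2 - h) = best * (M powr \<alpha> * X powr \<beta>)"
    proof -
      have "2 * (A * ts\<^sup>2 - h) = c * ts" using A by (simp add: ts_def h_def power2_eq_square field_simps)
      then show ?thesis by (simp add: c_def X(2))
    qed
    ultimately show ?thesis by simp
  qed
  have max: "maximizing M X f" unfolding maximizing_def using assms(4) X(1) f(1,2) Xlim Dlim by blast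
  obtain s a f0 where lim: "strict_mono (s :: nat \<Rightarrow> nat)" "adm f0" "mass f0 = M" "pint f0 = X"
    "D f0 f0 = best * (M powr \<alpha> * X powr \<beta>)"
    "(\<lambda>n. mass (\<lambda>x. \<bar>shift (a n) (f (s n)) x - f0 x\<bar>)) \<longlonglongrightarrow> 0"
    "(\<lambda>n. pint (\<lambda>x. \<bar>shift (a n) (f (s n)) x - f0 x\<bar>)) \<longlonglongrightarrow> 0"
    "(\<lambda>n. D (\<lambda>x. \<bar>shift (a n) (f (s n)) x - f0 x\<bar>) (\<lambda>x. \<bar>shift (a n) (f (s n)) x - f0 x\<bar>)) \<longlonglongrightarrow> 0"
    by (rule maximizing_compact[OF max]) (rule that)
  have mx: "maximizer f0" unfolding maximizer_def using lim assms(4) by simp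
  obtain R where R: "0 < R" "AE x in lborel. R \<le> norm x \<longrightarrow> f0 x = 0"
    by (rule maximizer_compact_support[OF mx]) (rule that)
  define g where "g n = shift (a n) (f (s n))" for n
  define T :: "nat \<Rightarrow> (R3 \<Rightarrow> real) \<Rightarrow> R3 \<Rightarrow> real" where "T n u = (\<lambda>x. u (x - a n))" for n u
  have ga: "adm (g n)" for n unfolding g_def by (rule adm_shift(1)[OF f(1)])
  have Tg: "AE x in lborel. T n (\<rho> (s n)) x = g n x" for n
    using AE_lborel_translate[OF f(3)[of "s n"], of "a n"] by (simp add: T_def g_def shift_def)
  note gm[measurable] = admD(2)[OF ga] and f0m[measurable] = admD(2)[OF lim(2)]
  have c1: "\<forall>n. translation (T n)" unfolding translation_def T_def by blast
  \<comment> \<open>\<open>f0\<close> vanishes almost everywhere outside the ball, so the mass left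
    there is at most the L^1 distance to \<open>f0\<close>. The radius of the support therefore
    serves for the sequence as well.\<close>
  have c2: "(\<lambda>n. LINT x:{x. norm x \<ge> R}|lebesgue. T n (\<rho> (s n)) x) \<longlonglongrightarrow> 0"
  proof (rule tendsto_sandwich[OF _ _ tendsto_const lim(6)])
    have S: "- ball (0::R3) R \<in> sets borel" by simp
    have eq: "(LINT x:{x. norm x \<ge> R}|lebesgue. T n (\<rho> (s n)) x) = mass (restr (- ball 0 R) (g n))" for n
      unfolding set_lebesgue_integral_def mass_def
    proof (rule lebesgue_AE_eq(1))
      show "restr (- ball 0 R) (g n) \<in> borel_measurable borel" by (rule admD(2)[OF adm_restr[OF ga S]])
      show "AE x in lborel. indicator {x. R \<le> norm x} x *\<^sub>R T n (\<rho> (s n)) x = restr (- ball 0 R) (g n) x"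
        using Tg[of n] by eventually_elim (auto simp: restr_def indicator_def)
    qed
    show "\<forall>\<^sub>F n in sequentially. 0 \<le> (LINT x:{x. norm x \<ge> R}|lebesgue. T n (\<rho> (s n)) x)"
      unfolding eq by (intro always_eventually allI mass_nonneg adm_restr ga S)
    have "mass (restr (- ball 0 R) (g n)) \<le> mass (\<lambda>x. \<bar>g n x - f0 x\<bar>)" for n
      unfolding mass_def
    proof (rule integral_mono_AE)
      show "integrable lborel (restr (- ball 0 R) (g n))" by (rule admD(4)[OF adm_restr[OF ga S]])
      show "integrable lborel (\<lambda>x. \<bar>g n x - f0 x\<bar>)" by (rule admD(4)[OF adm_abs_diff[OF ga lim(2)]])
      show "AE x in lborel. restr (- ball 0 R) (g n) x \<le> \<bar>g n x - f0 x\<bar>"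
        using R(2) by eventually_elim (auto simp: restr_def indicator_def)
    qed
    then show "\<forall>\<^sub>F n in sequentially. (LINT x:{x. norm x \<ge> R}|lebesgue. T n (\<rho> (s n)) x) \<le> mass (\<lambda>x. \<bar>shift (a n) (f (s n)) x - f0 x\<bar>)"
      unfolding eq by (intro always_eventually allI) (simp add: g_def)
  qed
  have refl: "AE x in lborel. f0 x = f0 x" by simp
  have c3: "Lp_converges p (\<lambda>n. T n (\<rho> (s n))) f0"
    unfolding Lp_converges_def
  proof (intro conjI allI)
    show "T n (\<rho> (s n)) \<in> Lp p" for n by (rule adm_cong_AE(3)[OF ga Tg])
    show "f0 \<in> Lp p" by (rule adm_cong_AE(3)[OF lim(2) refl])
    show "(\<lambda>n. Lp_norm p (\<lambda>x. T n (\<rho> (s n)) x - f0 x)) \<longlonglongrightarrow> 0"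
      unfolding Lp_norm_diff[OF ga lim(2) Tg]
      by (rule nonneg_limit_powr) (use lim(7) pint_nonneg p0 in \<open>auto simp: g_def\<close>)
  qed
  have c4: "(LINT x:cball 0 R|lebesgue. f0 x) = M"
  proof -
    have "(LINT x:cball 0 R|lebesgue. f0 x) = (LINT x|lborel. f0 x)"
      unfolding set_lebesgue_integral_def
    proof (rule lebesgue_AE_eq(1)[OF f0m])
      show "AE x in lborel. indicator (cball 0 R) x *\<^sub>R f0 x = f0 x"
        using R(2) by eventually_elim (auto simp: indicator_def)
    qed
    then show ?thesis using lim(3) by (simp add: mass_def)
  qed
  have c5: "ess_supp f0 \<subseteq> cball 0 R"
  proof -
    have "AE x in lborel. x \<in> - cball 0 R \<longrightarrow> f0 x = 0" using R(2) by eventually_elim auto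
    then have "AE x in lebesgue. x \<in> - cball 0 R \<longrightarrow> f0 x = 0" by (rule AE_completion)
    moreover have "open (- cball (0::R3) R)" by (intro open_Compl closed_cball)
    ultimately show ?thesis unfolding ess_supp_def by blast
  qed
  obtain C where C: "0 \<le> C"
    "\<And>f g. adm f \<Longrightarrow> adm g \<Longrightarrow> integrable lborel (\<lambda>x. (norm (grad_pot f x - grad_pot g x))\<^sup>2)"
    "\<And>f g. adm f \<Longrightarrow> adm g \<Longrightarrow>
      (LINT x|lborel. (norm (grad_pot f x - grad_pot g x))\<^sup>2) \<le> C * D (\<lambda>x. \<bar>f x - g x\<bar>) (\<lambda>x. \<bar>f x - g x\<bar>)"
    by (rule grad_pot_diff_L2) (rule that)
  have n2: "norm v powr 2 = (norm v)\<^sup>2" for v :: R3 by simp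
  have c6: "Lp_converges 2 (\<lambda>n. grad_pot (g n)) (grad_pot f0)"
    unfolding Lp_converges_def
  proof (intro conjI allI)
    \<comment> \<open>Compared with the zero density, whose gradient is 0, the estimate for
      differences gives membership in L^2.\<close>
    have zero: "adm (\<lambda>x. 0)" by (simp add: adm_def nonneg_borel_def)
    have mem: "grad_pot k \<in> Lp 2" if k: "adm k" for k
    proof -
      note km[measurable] = grad_pot_measurable[OF k]
      have "grad_pot (\<lambda>x. 0) x = 0" for x by (simp add: grad_pot_def)
      then have "integrable lborel (\<lambda>x. (norm (grad_pot k x))\<^sup>2)" using C(2)[OF k zero] by simp
      then have "integrable lebesgue (\<lambda>x. (norm (grad_pot k x))\<^sup>2)" by (subst integrable_completion) auto
      moreover have "grad_pot k \<in> borel_measurable lebesgue" by (rule lebesgue_measurable_AE_eq[OF km]) simp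
      ultimately show ?thesis unfolding Lp_def n2 by simp
    qed
    show "grad_pot (g n) \<in> Lp 2" for n by (rule mem[OF ga])
    show "grad_pot f0 \<in> Lp 2" by (rule mem[OF lim(2)])
    have eq: "(LINT x|lebesgue. (norm (grad_pot (g n) x - grad_pot f0 x))\<^sup>2) = (LINT x|lborel. (norm (grad_pot (g n) x - grad_pot f0 x))\<^sup>2)" for n
    proof (rule integral_completion)
      note [measurable] = grad_pot_measurable[OF ga] grad_pot_measurable[OF lim(2)]
      show "(\<lambda>x. (norm (grad_pot (g n) x - grad_pot f0 x))\<^sup>2) \<in> borel_measurable lborel" by measurable
    qed
    have "(\<lambda>n. C * D (\<lambda>x. \<bar>g n x - f0 x\<bar>) (\<lambda>x. \<bar>g n x - f0 x\<bar>)) \<longlonglongrightarrow> C * 0"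
      unfolding g_def by (intro tendsto_mult tendsto_const lim(8))
    then have u: "(\<lambda>n. C * D (\<lambda>x. \<bar>g n x - f0 x\<bar>) (\<lambda>x. \<bar>g n x - f0 x\<bar>)) \<longlonglongrightarrow> 0" by simp
    have "(\<lambda>n. LINT x|lborel. (norm (grad_pot (g n) x - grad_pot f0 x))\<^sup>2) \<longlonglongrightarrow> 0"
      by (rule tendsto_sandwich[OF _ _ tendsto_const u]) (use C(3)[OF ga lim(2)] in \<open>auto intro!: always_eventually integral_nonneg_AE\<close>)
    then have "(\<lambda>n. (LINT x|lborel. (norm (grad_pot (g n) x - grad_pot f0 x))\<^sup>2) powr (1 / 2)) \<longlonglongrightarrow> 0"
      by (rule nonneg_limit_powr) (auto intro!: integral_nonneg_AE)
    then show "(\<lambda>n. Lp_norm 2 (\<lambda>x. grad_pot (g n) x - grad_pot f0 x)) \<longlonglongrightarrow> 0"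
      unfolding Lp_norm_def n2 eq .
  qed
  have c7: "\<forall>n. weak_gradient (grav_potential (T n (\<rho> (s n)))) (grad_pot (g n))"
    using weak_gradient_grav_potential[OF admD(4)[OF ga]] grav_potential_cong_AE[OF gm Tg] by simp
  have c8: "weak_gradient (grav_potential f0) (grad_pot f0)"
    by (rule weak_gradient_grav_potential[OF admD(4)[OF lim(2)]])
  have c9: "is_arg_min (energy K \<mu> J) (\<lambda>\<sigma>. \<sigma> \<in> constraint_set \<mu> M) f0"
  proof -
    have "energy K \<mu> J f0 = A * ts\<^sup>2 - c * ts / 2"
      using energy_eq[OF lim(2) refl] lim(4,5) X(2) by (simp add: c_def)
    also have "\<dots> = h" using A by (simp add: ts_def h_def power2_eq_square field_simps)
    finally have "energy K \<mu> J f0 = h" .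
    moreover have "f0 \<in> constraint_set \<mu> M" by (rule constr[OF lim(2,3) refl])
    ultimately show ?thesis unfolding is_arg_min_def using lower by (auto simp: not_less)
  qed
  show ?thesis
    unfolding p_def[symmetric]
    by (rule exI[of _ T], rule exI[of _ s], rule exI[of _ R], rule exI[of _ f0])
      (intro conjI c1 lim(1) R(1) c2 c3 c4 c5 c9 exI[of _ "\<lambda>n. grad_pot (g n)"] exI[of _ "grad_pot f0"] c6 c7 c8)
qed

end
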